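(* Let $n\ge 2$, $p>1$, $0<r<R<\infty$ and $i\in\{1,2\}$. For every $u\in M_i(r,R)$, $$L^i(u)\ \ge\ \left(\frac1p\right)^p\frac{\left[K^i_0(u)+(p-1)K^i_1(u)\right]^p}{\left(K^i_1(u)\right)^{p-1}}.$$
   Context: $B_\rho\subset\mathbb{R}^n$ is the open ball of radius $\rho$ centered at $0$; $\langle\cdot,\cdot\rangle$ is the Euclidean scalar product; $d\sigma=dS$ is surface measure. Set $p'=\frac{p}{p-1}$ and $m=\frac{p-n}{p-1}$ (so $m=0$ iff $p=n$). Functions $u$ are real-valued and weakly differentiable on $B_R\setminus\bar B_r$, with $\int_{B_R\setminus B_r}\left|\frac{\langle x,\nabla u\rangle}{|x|}\right|^p dx<\infty$; values on spheres (including boundary spheres) are taken in the sense of traces, i.e. using the representative that is absolutely continuous along almost every ray from the origin. $M_1(r,R)$ is the set of such $u$ satisfying, as $\hat R\to R-0$: $\left|\frac{R^m-\hat R^m}{m}\right|^{1-p}\int_{\partial B_{\hat R}}|u|^p\,d\sigma\to0$ if $m\ne0$, and $\left|\ln\frac{R}{\hat R}\right|^{1-n}\int_{\partial B_{\hat R}}|u|^n\,d\sigma\to0$ if $m=0$. $M_2(r,R)$ is the set of such $u$ satisfying, as $\hat r\to r+0$: $\left|\frac{\hat r^m-r^m}{m}\right|^{1-p}\int_{\partial B_{\hat r}}|u|^p\,d\sigma\to0$ if $m\ne0$, and $\left|\ln\frac{\hat r}{r}\right|^{1-n}\int_{\partial B_{\hat r}}|u|^n\,d\sigma\to0$ if $m=0$.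 The functions $\psi_1,\psi_2$ are the $p$-harmonic functions in $B_R\setminus\bar B_r$ with $\psi_1=0$ on $\partial B_R$, $\psi_1=1$ on $\partial B_r$, and $\psi_2=1$ on $\partial B_R$, $\psi_2=0$ on $\partial B_r$; explicitly $$\psi_1(x)=\frac{R^m-|x|^m}{R^m-r^m},\quad \psi_2(x)=\frac{|x|^m-r^m}{R^m-r^m}\quad(m\ne0),$$ $$\psi_1(x)=\frac{\ln(R/|x|)}{\ln(R/r)},\quad \psi_2(x)=\frac{\ln(|x|/r)}{\ln(R/r)}\quad(m=0).$$ Define $$L^i(u)=\int_{B_R\setminus B_r}\left|\frac{\langle\nabla\psi_i,\nabla u\rangle}{|\nabla\psi_i|}\right|^pdx=\int_{B_R\setminus B_r}\left|\frac{\langle x,\nabla u\rangle}{|x|}\right|^pdx,$$ $$K^i_1(u)=\int_{B_R\setminus B_r}\left|\frac{\nabla\psi_i}{\psi_i}\right|^p|u|^p\,dx,$$ $$K^i_0(u)=\int_{\partial(B_R\setminus B_r)}\left|\frac{\nabla\psi_i}{\psi_i}\right|^{p-2}\left\langle\frac{\nabla\psi_i}{\psi_i},\nu\right\rangle|u|^p\,dS,$$ where $\nu$ is the outward unit normal to $B_R\setminus B_r$. Since $\psi_i$ vanishes on one boundary sphere, $K^i_0(u)$ is understood as the limit, as $\hat R\to R-0$ and $\hat r\to r+0$, of the same integral over $\partial(B_{\hat R}\setminus B_{\hat r})$ with its outward normal. If $u=0$ a.e., so that $K^i_1(u)=0$, the right-hand side of the inequality is understood as $0$. *)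

theory Defs
  imports "HOL-Analysis.Analysis"
begin

text \<open>Throughout, the role of \<open>\<real>\<^sup>n\<close> is played by a Euclidean space of dimension \<open>n = DIM('a)\<close>.\<close>

definition annulus :: "real \<Rightarrow> real \<Rightarrow> 'a::euclidean_space set" where
  "annulus r R = ball 0 R - cball 0 r"

definition grad :: "('a::euclidean_space \<Rightarrow> real) \<Rightarrow> 'a \<Rightarrow> 'a" where
  "grad f x = (SOME D. GDERIV f x :> D)"


section \<open>Weak differentiability\<close>

definition locally_integrable_on :: "('a::euclidean_space \<Rightarrow> 'b::euclidean_space) \<Rightarrow> 'a set \<Rightarrow> bool" where
  "locally_integrable_on f \<Omega> \<longleftrightarrow> (\<forall>K. compact K \<longrightarrow> K \<subseteq> \<Omega> \<longrightarrow> f absolutely_integrable_on K)"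

text \<open>
  First-order weak derivatives are tested against \<open>C\<^sup>1\<close> functions with compact support in \<open>\<Omega>\<close>, as in
  Gilbarg and Trudinger, Section 7.3; by mollification this is the same notion as with smooth test
  functions.
\<close>

definition test_functions :: "'a::euclidean_space set \<Rightarrow> ('a \<Rightarrow> real) set" where
  "test_functions \<Omega> =
    {\<phi>. (\<forall>x. \<phi> differentiable (at x)) \<and> continuous_on UNIV (grad \<phi>) \<and>
        compact (closure {x. \<phi> x \<noteq> 0}) \<and> closure {x. \<phi> x \<noteq> 0} \<subseteq> \<Omega>}"

definition has_weak_gradient_on ::
    "('a::euclidean_space \<Rightarrow> real) \<Rightarrow> ('a \<Rightarrow> 'a) \<Rightarrow> 'a set \<Rightarrow> bool" where
  "has_weak_gradient_on u g \<Omega> \<longleftrightarrow>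
    locally_integrable_on u \<Omega> \<and> locally_integrable_on g \<Omega> \<and>
    (\<forall>\<phi> \<in> test_functions \<Omega>.
      (LINT x:\<Omega>|lebesgue. u x *\<^sub>R grad \<phi> x) = - (LINT x:\<Omega>|lebesgue. \<phi> x *\<^sub>R g x))"

definition weakly_differentiable_on :: "('a::euclidean_space \<Rightarrow> real) \<Rightarrow> 'a set \<Rightarrow> bool" where
  "weakly_differentiable_on u \<Omega> \<longleftrightarrow> (\<exists>g. has_weak_gradient_on u g \<Omega>)"

text \<open>The weak gradient is unique only up to null sets in \<open>\<Omega>\<close>; it is only used below integrals over \<open>\<Omega>\<close>.\<close>

definition weak_grad :: "'a::euclidean_space set \<Rightarrow> ('a \<Rightarrow> real) \<Rightarrow> 'a \<Rightarrow> 'a" where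
  "weak_grad \<Omega> u = (SOME g. has_weak_gradient_on u g \<Omega>)"


section \<open>Surface measure and values on spheres\<close>

text \<open>
  Surface measure on \<open>sphere 0 \<rho>\<close> for \<open>\<rho> > 0\<close>, regarded as a Borel measure on the whole space. As in
  polar coordinates, a Borel set \<open>E\<close> of the sphere has measure \<open>n / \<rho>\<close> times the Lebesgue measure of the
  cone \<open>{t x | 0 < t < 1, x \<in> E}\<close>; thus the whole sphere gets \<open>n \<rho>\<^sup>n\<^sup>-\<^sup>1\<close> times the volume of the
  unit ball.
\<close>

definition surface_measure :: "real \<Rightarrow> 'a::euclidean_space measure" where
  "surface_measure \<rho> = scale_measure (ennreal (real DIM('a) / \<rho>))
    (distr (restrict_space lborel (ball 0 \<rho> - {0})) borel (\<lambda>x. (\<rho> / norm x) *\<^sub>R x))"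

definition absolutely_continuous_on :: "real set \<Rightarrow> (real \<Rightarrow> real) \<Rightarrow> bool" where
  "absolutely_continuous_on I f \<longleftrightarrow>
    (\<forall>\<epsilon>>0. \<exists>\<delta>>0. \<forall>(N::nat) (s::nat \<Rightarrow> real) (t::nat \<Rightarrow> real).
      (\<forall>k<N. s k \<le> t k \<and> {s k..t k} \<subseteq> I) \<longrightarrow>
      (\<forall>k<N. \<forall>l<N. k \<noteq> l \<longrightarrow> {s k<..<t k} \<inter> {s l<..<t l} = {}) \<longrightarrow>
      (\<Sum>k<N. t k - s k) < \<delta> \<longrightarrow> (\<Sum>k<N. \<bar>f (t k) - f (s k)\<bar>) < \<epsilon>)"

text \<open>
  The representative of \<open>u\<close> which is absolutely continuous along almost every ray, up to and including
  the two boundary spheres. Two such representatives agree, on almost every ray, at every point of the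
  closed annulus, so their restrictions to each sphere agree almost everywhere.
\<close>

definition is_radial_rep :: "real \<Rightarrow> real \<Rightarrow> ('a::euclidean_space \<Rightarrow> real) \<Rightarrow> ('a \<Rightarrow> real) \<Rightarrow> bool" where
  "is_radial_rep r R u v \<longleftrightarrow>
    v \<in> borel_measurable borel \<and>
    (AE x in lebesgue. x \<in> annulus r R \<longrightarrow> v x = u x) \<and>
    (AE \<omega> in surface_measure 1. absolutely_continuous_on {r..R} (\<lambda>t. v (t *\<^sub>R \<omega>)))"

definition radial_rep :: "real \<Rightarrow> real \<Rightarrow> ('a::euclidean_space \<Rightarrow> real) \<Rightarrow> 'a \<Rightarrow> real" where
  "radial_rep r R u = (SOME v. is_radial_rep r R u v)"


section \<open>The classes $M_1$ and $M_2$\<close>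

definition m_exp :: "nat \<Rightarrow> real \<Rightarrow> real" where
  "m_exp n p = (p - real n) / (p - 1)"

definition admissible :: "real \<Rightarrow> real \<Rightarrow> real \<Rightarrow> ('a::euclidean_space \<Rightarrow> real) \<Rightarrow> bool" where
  "admissible p r R u \<longleftrightarrow>
    weakly_differentiable_on u (annulus r R) \<and>
    (\<integral>\<^sup>+x\<in>annulus r R. ennreal (\<bar>(x \<bullet> weak_grad (annulus r R) u x) / norm x\<bar> powr p) \<partial>lebesgue) < \<infinity>"

definition weight :: "nat \<Rightarrow> real \<Rightarrow> real \<Rightarrow> real \<Rightarrow> real" where
  "weight n p a b =
    (let m = m_exp n p in
      if m \<noteq> 0 then \<bar>(b powr m - a powr m) / m\<bar> powr (1 - p)
      else \<bar>ln (b / a)\<bar> powr (1 - real n))"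

text \<open>
  For \<open>m_exp n p = 0\<close> one has \<open>p = n\<close>, so the exponent of \<open>u\<close> is \<open>p\<close> in both cases. The sphere
  integrals are taken in the extended nonnegative reals: convergence to \<open>0\<close> entails that they are
  eventually finite.
\<close>

definition sphere_mass :: "real \<Rightarrow> real \<Rightarrow> real \<Rightarrow> ('a::euclidean_space \<Rightarrow> real) \<Rightarrow> real \<Rightarrow> ennreal" where
  "sphere_mass p r R u \<rho> = (\<integral>\<^sup>+x. ennreal (\<bar>radial_rep r R u x\<bar> powr p) \<partial>surface_measure \<rho>)"

definition M1 :: "real \<Rightarrow> real \<Rightarrow> real \<Rightarrow> ('a::euclidean_space \<Rightarrow> real) set" where
  "M1 p r R = {u. admissible p r R u \<and>
    ((\<lambda>R'. ennreal (weight DIM('a) p R' R) * sphere_mass p r R u R') \<longlongrightarrow> 0) (at_left R)}"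

definition M2 :: "real \<Rightarrow> real \<Rightarrow> real \<Rightarrow> ('a::euclidean_space \<Rightarrow> real) set" where
  "M2 p r R = {u. admissible p r R u \<and>
    ((\<lambda>r'. ennreal (weight DIM('a) p r r') * sphere_mass p r R u r') \<longlongrightarrow> 0) (at_right r)}"

definition M :: "nat \<Rightarrow> real \<Rightarrow> real \<Rightarrow> real \<Rightarrow> ('a::euclidean_space \<Rightarrow> real) set" where
  "M i p r R = (if i = 1 then M1 p r R else M2 p r R)"


section \<open>The functionals\<close>

definition psi1 :: "real \<Rightarrow> real \<Rightarrow> real \<Rightarrow> 'a::euclidean_space \<Rightarrow> real" where
  "psi1 p r R x =
    (let m = m_exp DIM('a) p in
      if m \<noteq> 0 then (R powr m - norm x powr m) / (R powr m - r powr m)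
      else ln (R / norm x) / ln (R / r))"

definition psi2 :: "real \<Rightarrow> real \<Rightarrow> real \<Rightarrow> 'a::euclidean_space \<Rightarrow> real" where
  "psi2 p r R x =
    (let m = m_exp DIM('a) p in
      if m \<noteq> 0 then (norm x powr m - r powr m) / (R powr m - r powr m)
      else ln (norm x / r) / ln (R / r))"

definition psi :: "nat \<Rightarrow> real \<Rightarrow> real \<Rightarrow> real \<Rightarrow> 'a::euclidean_space \<Rightarrow> real" where
  "psi i p r R = (if i = 1 then psi1 p r R else psi2 p r R)"

definition grad_log_psi :: "nat \<Rightarrow> real \<Rightarrow> real \<Rightarrow> real \<Rightarrow> 'a::euclidean_space \<Rightarrow> 'a" where
  "grad_log_psi i p r R x = grad (psi i p r R) x /\<^sub>R psi i p r R x"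

definition L :: "nat \<Rightarrow> real \<Rightarrow> real \<Rightarrow> real \<Rightarrow> ('a::euclidean_space \<Rightarrow> real) \<Rightarrow> real" where
  "L i p r R u =
    (LINT x:annulus r R|lebesgue.
      \<bar>(grad (psi i p r R) x \<bullet> weak_grad (annulus r R) u x) / norm (grad (psi i p r R) x)\<bar> powr p)"

definition K1_integrand :: "nat \<Rightarrow> real \<Rightarrow> real \<Rightarrow> real \<Rightarrow> ('a::euclidean_space \<Rightarrow> real) \<Rightarrow> 'a \<Rightarrow> real" where
  "K1_integrand i p r R u x = norm (grad_log_psi i p r R x) powr p * \<bar>u x\<bar> powr p"

definition K1 :: "nat \<Rightarrow> real \<Rightarrow> real \<Rightarrow> real \<Rightarrow> ('a::euclidean_space \<Rightarrow> real) \<Rightarrow> real" where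
  "K1 i p r R u = (LINT x:annulus r R|lebesgue. K1_integrand i p r R u x)"

definition K0_integrand ::
    "nat \<Rightarrow> real \<Rightarrow> real \<Rightarrow> real \<Rightarrow> ('a::euclidean_space \<Rightarrow> real) \<Rightarrow> 'a \<Rightarrow> 'a \<Rightarrow> real" where
  "K0_integrand i p r R u \<nu> x =
    norm (grad_log_psi i p r R x) powr (p - 2) * (grad_log_psi i p r R x \<bullet> \<nu>) *
    \<bar>radial_rep r R u x\<bar> powr p"

text \<open>
  The integral over the boundary of \<open>ball 0 R' - ball 0 r'\<close>, where \<open>r < r' < R' < R\<close>. The outward unit
  normal is \<open>x / |x|\<close> on the outer sphere and \<open>- x / |x|\<close> on the inner one.
\<close>

definition K0_trunc ::
    "nat \<Rightarrow> real \<Rightarrow> real \<Rightarrow> real \<Rightarrow> ('a::euclidean_space \<Rightarrow> real) \<Rightarrow> real \<Rightarrow> real \<Rightarrow> real" where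
  "K0_trunc i p r R u r' R' =
    (LINT x|surface_measure R'. K0_integrand i p r R u (x /\<^sub>R norm x) x) +
    (LINT x|surface_measure r'. K0_integrand i p r R u (- (x /\<^sub>R norm x)) x)"

definition K0 :: "nat \<Rightarrow> real \<Rightarrow> real \<Rightarrow> real \<Rightarrow> ('a::euclidean_space \<Rightarrow> real) \<Rightarrow> real" where
  "K0 i p r R u = Lim (at_right r \<times>\<^sub>F at_left R) (\<lambda>(r', R'). K0_trunc i p r R u r' R')"

text \<open>
  Integrals of non-integrable functions and limits of divergent functions have arbitrary values in HOL.
  The following says that \<open>K0\<close> and \<open>K1\<close> do have their intended meaning for \<open>u\<close>. If \<open>u = 0\<close> almost
  everywhere, then \<open>K1\<close> is \<open>0\<close> and a quotient by \<open>K1 powr (p - 1)\<close> is \<open>0\<close>, since \<open>x / 0 = 0\<close>.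
\<close>

definition K_well_defined :: "nat \<Rightarrow> real \<Rightarrow> real \<Rightarrow> real \<Rightarrow> ('a::euclidean_space \<Rightarrow> real) \<Rightarrow> bool" where
  "K_well_defined i p r R u \<longleftrightarrow>
    set_integrable lebesgue (annulus r R) (K1_integrand i p r R u) \<and>
    (\<forall>\<rho>\<in>{r<..<R}. integrable (surface_measure \<rho>) (\<lambda>x. \<bar>radial_rep r R u x\<bar> powr p)) \<and>
    ((\<lambda>(r', R'). K0_trunc i p r R u r' R') \<longlongrightarrow> K0 i p r R u) (at_right r \<times>\<^sub>F at_left R)"

end

theory Submission
  imports Defs
begin

text \<open>
  In polar coordinates \<open>x = t \<omega>\<close> the function \<open>\<psi>\<close> depends on \<open>t\<close> only, and \<open>p\<close>-harmonicity says that
  \<open>|\<psi>'|\<^sup>p\<^sup>-\<^sup>2 \<psi>' t\<^sup>n\<^sup>-\<^sup>1\<close> is constant. Hence the flux \<open>F = t\<^sup>n\<^sup>-\<^sup>1 |\<psi>'/\<psi>|\<^sup>p\<^sup>-\<^sup>2 \<psi>'/\<psi>\<close> satisfies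
  \<open>F' = - (p - 1) G\<close> with \<open>G = t\<^sup>n\<^sup>-\<^sup>1 |\<psi>'/\<psi>|\<^sup>p\<close>. Let \<open>v\<close> be the restriction of \<open>u\<close> to a ray on which \<open>u\<close> is
  absolutely continuous. The derivative of \<open>F |v|\<^sup>p\<close> is \<open>- (p - 1) G |v|\<^sup>p + p F |v|\<^sup>p\<^sup>-\<^sup>1 sgn(v) v'\<close>, and
  since \<open>|F|\<close> is \<open>G\<close> to the power \<open>(p - 1) / p\<close> times \<open>t\<close> to the power \<open>(n - 1) / p\<close>, Young's
  inequality with a free parameter \<open>\<mu> > 0\<close> bounds the last term by
  \<open>(p - 1) \<mu> G |v|\<^sup>p + \<mu>\<^sup>1\<^sup>-\<^sup>p t\<^sup>n\<^sup>-\<^sup>1 |v'|\<^sup>p\<close> (\<open>ray_inequality\<close>). Integrating over the rays between two spheres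
  of radii \<open>a < b\<close> inside the annulus gives, with the truncated boundary term \<open>K\<^sub>0(a,b)\<close> and the truncated
  integral \<open>K\<^sub>1(a,b)\<close>,
  \<open>K\<^sub>0(a,b) + (p - 1) (1 - \<mu>) K\<^sub>1(a,b) \<le> \<mu>\<^sup>1\<^sup>-\<^sup>p L\<close> (\<open>truncated_inequality\<close>).

  The class \<open>M\<^sub>i\<close> makes the part of the boundary term that sits on the sphere where \<open>\<psi>\<close> vanishes tend to
  \<open>0\<close>; the other part converges to a nonnegative number because the outward derivative of \<open>\<psi>\<close> is positive
  there. So \<open>K\<^sub>0(a,b)\<close> converges and \<open>K\<^sub>0 \<ge> 0\<close>. The choice \<open>\<mu> = 1/2\<close> then bounds \<open>K\<^sub>1(a,b)\<close>, whence
  \<open>K\<^sub>1 < \<infinity>\<close>, and the inequality passes to the limit. Taking \<open>\<mu> = (K\<^sub>0 + (p - 1) K\<^sub>1) / (p K\<^sub>1)\<close>, the best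
  possible value, yields the claim (\<open>flux_inequality\<close>).

  Three facts carry this. Integrals over the annulus decompose into integrals along rays, for the cone
  definition of surface measure (\<open>polar_measure_eq\<close>). The chain rule for \<open>F |v|\<^sup>p\<close> holds for every
  primitive \<open>v\<close> of an integrable function; it is proved by comparing increments on short intervals, which
  avoids differentiation almost everywhere (\<open>chain_product_primitive\<close>). Finally a weakly differentiable
  function whose radial derivative \<open>h\<close> is integrable has a representative that is a primitive of \<open>h\<close> along
  almost every ray, up to the boundary (\<open>radial_rep_primitive\<close>). For this the weak gradient is tested
  against \<open>x / |x|\<^sup>n\<close> times functions of the form \<open>\<eta>(|x|) X(x/|x|)\<close>. As \<open>x / |x|\<^sup>n\<close> is divergence free, only
  radial derivatives survive, and the remainder after subtracting a primitive of \<open>h\<close> is orthogonal to all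
  \<open>\<eta>'(t) X(\<omega>)\<close>; so it does not depend on \<open>t\<close>, as in the lemma of du Bois-Reymond.
\<close>

section \<open>Calculus along a ray\<close>

text \<open>
  Summing over a partition of mesh below \<open>\<delta>\<close>, the increments of \<open>D\<close> add up to at most \<open>\<epsilon>\<close> times the fixed
  number \<open>integral {a..b} g\<close>. This replaces the argument that a function with derivative \<open>0\<close> almost
  everywhere is constant, and needs no theory of differentiation of integrals.
\<close>

lemma small_increments_imp_const:
  fixes D g :: "real \<Rightarrow> real"
  assumes ab: "a \<le> b" and g: "g integrable_on {a..b}"
    and small: "\<And>\<epsilon>. \<epsilon> > 0 \<Longrightarrow> \<exists>\<delta>>0. \<forall>s t. a \<le> s \<and> s \<le> t \<and> t \<le> b \<and> t - s < \<delta> \<longrightarrow>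
                  \<bar>D t - D s\<bar> \<le> \<epsilon> * integral {s..t} g"
  shows "D b = D a"
proof (cases "a = b")
  case False
  have bd: "\<bar>D b - D a\<bar> \<le> \<epsilon> * integral {a..b} g" if eps: "\<epsilon> > 0" for \<epsilon>
  proof -
    obtain \<delta> where \<delta>: "\<delta> > 0" and sm: "\<And>s t. a \<le> s \<Longrightarrow> s \<le> t \<Longrightarrow> t \<le> b \<Longrightarrow> t - s < \<delta> \<Longrightarrow>
                  \<bar>D t - D s\<bar> \<le> \<epsilon> * integral {s..t} g"
      using small[OF eps] by blast
    obtain N :: nat where N: "(b - a) / \<delta> < real N" using reals_Archimedean2 by blast
    have N0: "N > 0" using N \<delta> ab False by (auto intro!: Nat.gr0I simp: field_simps)
    define x where "x k = a + real k * ((b - a) / real N)" for k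
    have step: "x (Suc k) - x k = (b - a) / real N" for k by (simp add: x_def add_divide_distrib distrib_right)
    have st: "(b - a) / real N < \<delta>" using N N0 \<delta> by (simp add: field_simps)
    have xa: "a \<le> x k" for k using ab by (simp add: x_def)
    have xN: "x N = b" using N0 by (simp add: x_def)
    have xb: "x k \<le> b" if "k \<le> N" for k
    proof -
      have "real k * ((b - a) / real N) \<le> real N * ((b - a) / real N)"
        using that ab by (intro mult_right_mono) auto
      then show ?thesis using N0 by (simp add: x_def)
    qed
    have mono: "x k \<le> x (Suc k)" for k using step[of k] ab by (simp add: field_simps)
    have "\<bar>D (x k) - D a\<bar> \<le> \<epsilon> * integral {a..x k} g" if "k \<le> N" for k
      using that
    proof (induction k)
      case 0 then show ?case by (simp add: x_def)
    next
      case (Suc k)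
      have 1: "\<bar>D (x (Suc k)) - D (x k)\<bar> \<le> \<epsilon> * integral {x k..x (Suc k)} g"
        using Suc.prems by (intro sm xa mono xb) (auto simp: step st)
      have gi: "g integrable_on {a..x (Suc k)}"
        using integrable_subinterval_real[OF g] xb[OF Suc.prems] by simp
      have "integral {a..x k} g + integral {x k..x (Suc k)} g = integral {a..x (Suc k)} g"
        by (intro Henstock_Kurzweil_Integration.integral_combine xa mono gi)
      then have "\<epsilon> * integral {a..x (Suc k)} g = \<epsilon> * integral {a..x k} g + \<epsilon> * integral {x k..x (Suc k)} g"
        by (metis distrib_left)
      with 1 Suc show ?case by linarith
    qed
    from this[of N] show ?thesis by (simp add: xN)
  qed
  have "\<bar>D b - D a\<bar> \<le> 0"
  proof (rule field_le_epsilon)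
    fix e :: real assume e: "e > 0"
    let ?I = "\<bar>integral {a..b} g\<bar> + 1"
    have "\<bar>D b - D a\<bar> \<le> (e / ?I) * integral {a..b} g" using e by (intro bd) (auto intro!: divide_pos_pos)
    also have "\<dots> \<le> (e / ?I) * ?I" using e by (intro mult_left_mono) auto
    also have "\<dots> = e" by simp
    finally show "\<bar>D b - D a\<bar> \<le> 0 + e" by simp
  qed
  then show ?thesis by simp
qed simp

lemma primitive_increment:
  fixes h :: "real \<Rightarrow> real"
  assumes h: "h integrable_on {a..b}" and v: "\<And>t. t \<in> {a..b} \<Longrightarrow> v t = v a + integral {a..t} h"
    and st: "a \<le> s" "s \<le> t" "t \<le> b"
  shows "v t - v s = integral {s..t} h"
proof -
  have "integral {a..s} h + integral {s..t} h = integral {a..t} h"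
    using st h by (intro Henstock_Kurzweil_Integration.integral_combine)
      (auto intro: integrable_subinterval_real)
  then show ?thesis using v[of s] v[of t] st by auto
qed

lemma primitive_continuous:
  fixes h :: "real \<Rightarrow> real"
  assumes h: "h integrable_on {a..b}" and v: "\<And>t. t \<in> {a..b} \<Longrightarrow> v t = v a + integral {a..t} h"
  shows "continuous_on {a..b} v"
proof -
  have "continuous_on {a..b} (\<lambda>t. v a + integral {a..t} h)"
    by (intro continuous_intros indefinite_integral_continuous_1 h)
  then show ?thesis by (rule continuous_on_eq) (simp add: v[symmetric])
qed

lemma abs_integrable_continuous_mult:
  fixes h k :: "real \<Rightarrow> real"
  assumes h: "h absolutely_integrable_on {a..b}" and k: "continuous_on {a..b} k"
  shows "(\<lambda>t. k t * h t) absolutely_integrable_on {a..b}"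
proof (rule absolutely_integrable_bounded_measurable_product_real)
  show "k \<in> borel_measurable (lebesgue_on {a..b})"
    using k by (intro continuous_imp_measurable_on_sets_lebesgue) auto
  show "bounded (k ` {a..b})" using k compact_continuous_image compact_imp_bounded by blast
qed (use h in auto)

text \<open>
  The fundamental theorem for \<open>F \<cdot> (Q \<circ> v)\<close> when \<open>v\<close> is merely a primitive of an integrable \<open>h\<close>. On a short
  interval \<open>{s..t}\<close> the mean value theorem turns the increment of \<open>F \<cdot> (Q \<circ> v)\<close> into the integral of the
  claimed derivative with its continuous coefficients frozen at points of \<open>{s..t}\<close>; by uniform continuity
  the error is at most \<open>\<epsilon>\<close> times the integral of \<open>|h| + 1\<close>.
\<close>

lemma chain_product_primitive:
  fixes h :: "real \<Rightarrow> real"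
  assumes ab: "a \<le> b" and h: "h absolutely_integrable_on {a..b}"
    and v: "\<And>t. t \<in> {a..b} \<Longrightarrow> v t = v a + integral {a..t} h"
    and F: "\<And>t. t \<in> {a..b} \<Longrightarrow> (F has_real_derivative F' t) (at t)" and F': "continuous_on {a..b} F'"
    and Q: "\<And>y. (Q has_real_derivative Q' y) (at y)" and Q': "continuous_on UNIV Q'"
  shows "((\<lambda>t. F' t * Q (v t) + F t * Q' (v t) * h t) has_integral (F b * Q (v b) - F a * Q (v a))) {a..b}"
proof -
  have hi: "h integrable_on {a..b}" using h by (simp add: absolutely_integrable_on_def)
  have cv: "continuous_on {a..b} v" by (rule primitive_continuous[OF hi v])
  have cF: "continuous_on {a..b} F"
    using F by (meson DERIV_continuous_on has_field_derivative_at_within)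
  have cQ: "continuous_on UNIV Q" using Q by (meson DERIV_continuous_on)
  have cQv: "continuous_on {a..b} (\<lambda>t. Q (v t))" 
    using continuous_on_compose2[OF cQ cv] by auto
  have cQ'v: "continuous_on {a..b} (\<lambda>t. Q' (v t))" 
    using continuous_on_compose2[OF Q' cv] by auto
  define f where "f t = F' t * Q (v t) + F t * Q' (v t) * h t" for t
  have fi: "f integrable_on {a..b}" unfolding f_def
  proof (rule integrable_add)
    show "(\<lambda>t. F' t * Q (v t)) integrable_on {a..b}"
      by (intro integrable_continuous_real continuous_intros F' cQv)
    show "(\<lambda>t. F t * Q' (v t) * h t) integrable_on {a..b}"
      using abs_integrable_continuous_mult[OF h continuous_on_mult[OF cF cQ'v]]
      by (simp add: absolutely_integrable_on_def)
  qed
  define D where "D t = F t * Q (v t) - integral {a..t} f" for t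
  define g where "g t = \<bar>h t\<bar> + 1" for t
  have gi: "g integrable_on {a..b}" unfolding g_def
    using h by (intro integrable_add) (auto simp: absolutely_integrable_on_def)
  have "D b = D a"
  proof (rule small_increments_imp_const[OF ab gi])
    fix \<epsilon> :: real assume \<epsilon>: "\<epsilon> > 0"
    \<comment> \<open>The two coefficients are regarded as functions of two independent points, since the mean value
      theorems for \<open>F\<close> and \<open>Q\<close> freeze them at different places.\<close>
    define P where "P z = F (fst z) * Q' (v (snd z))" for z
    define S where "S z = F' (fst z) * Q (v (snd z))" for z
    let ?K = "{a..b} \<times> {a..b}"
    have "continuous_on ?K P" "continuous_on ?K S" unfolding P_def S_def
      by (intro continuous_intros continuous_on_compose2[OF cF] continuous_on_compose2[OF F']
           continuous_on_compose2[OF cQ'v] continuous_on_compose2[OF cQv]; force)+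
    then have uc: "uniformly_continuous_on ?K P" "uniformly_continuous_on ?K S"
      by (auto intro!: compact_uniformly_continuous compact_Times)
    obtain d1 where d1: "d1 > 0" "\<And>z z'. z \<in> ?K \<Longrightarrow> z' \<in> ?K \<Longrightarrow> dist z' z < d1 \<Longrightarrow> dist (P z') (P z) < \<epsilon>"
      using uc(1) \<epsilon> unfolding uniformly_continuous_on_def by metis
    obtain d2 where d2: "d2 > 0" "\<And>z z'. z \<in> ?K \<Longrightarrow> z' \<in> ?K \<Longrightarrow> dist z' z < d2 \<Longrightarrow> dist (S z') (S z) < \<epsilon>"
      using uc(2) \<epsilon> unfolding uniformly_continuous_on_def by metis
    define d where "d = min d1 d2 / 2"
    have d: "d > 0" using d1 d2 by (simp add: d_def)
    have near: "dist (x, y) (z, z) < d1 \<and> dist (x, y) (z, z) < d2"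
      if "x \<in> {s..t}" "y \<in> {s..t}" "z \<in> {s..t}" "t - s < d" for s t x y z
    proof -
      have "dist (x, y) (z, z) \<le> dist x z + dist y z"
        unfolding dist_Pair_Pair by (rule sqrt_sum_squares_le_sum_abs[THEN order_trans]) (auto simp: dist_real_def)
      also have "\<dots> < 2 * d" using that by (auto simp: dist_real_def)
      finally show ?thesis by (auto simp: d_def)
    qed
    show "\<exists>\<delta>>0. \<forall>s t. a \<le> s \<and> s \<le> t \<and> t \<le> b \<and> t - s < \<delta> \<longrightarrow> \<bar>D t - D s\<bar> \<le> \<epsilon> * integral {s..t} g"
    proof (intro exI[of _ d] conjI d allI impI)
      fix s t assume "a \<le> s \<and> s \<le> t \<and> t \<le> b \<and> t - s < d"
      then have st: "a \<le> s" "s \<le> t" "t \<le> b" "t - s < d" by auto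
      have sub: "{s..t} \<subseteq> {a..b}" using st by auto
      note vinc = primitive_increment[OF hi v st(1-3)]
      obtain y where y: "y \<in> {s..t}" "Q (v t) - Q (v s) = Q' (v y) * (v t - v s)"
      proof -
        obtain \<xi> where \<xi>: "min (v s) (v t) \<le> \<xi>" "\<xi> \<le> max (v s) (v t)" "Q (v t) - Q (v s) = Q' \<xi> * (v t - v s)"
        proof (cases "v s" "v t" rule: linorder_cases)
          case less
          then obtain z where "v s < z" "z < v t" "Q (v t) - Q (v s) = (v t - v s) * Q' z"
            using MVT2[of "v s" "v t" Q Q'] Q by auto
          then show ?thesis using that[of z] less by (auto simp: mult.commute)
        next
          case equal then show ?thesis using that[of "v s"] by auto
        next
          case greater
          then obtain z where "v t < z" "z < v s" "Q (v s) - Q (v t) = (v s - v t) * Q' z"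
            using MVT2[of "v t" "v s" Q Q'] Q by auto
          then show ?thesis using that[of z] greater by (auto simp: algebra_simps)
        qed
        have cvs: "continuous_on {s..t} v" using cv sub continuous_on_subset by blast
        \<comment> \<open>The intermediate value is attained by \<open>v\<close>, so that only uniform continuity of \<open>Q' \<circ> v\<close> is needed.\<close>
        have "\<exists>y. s \<le> y \<and> y \<le> t \<and> v y = \<xi>"
        proof (cases "v s \<le> v t")
          case True then show ?thesis using IVT'[of v s \<xi> t] \<xi> st cvs by auto
        next
          case False then show ?thesis using IVT2'[of v t \<xi> s] \<xi> st cvs by auto
        qed
        then show ?thesis using that \<xi> by auto
      qed
      obtain x where x: "x \<in> {s..t}" "F t - F s = F' x * (t - s)"
      proof (cases "s = t")
        case False
        then obtain z where "s < z" "z < t" "F t - F s = (t - s) * F' z"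
          using MVT2[of s t F F'] F st by auto
        then show ?thesis using that[of z] by (auto simp: mult.commute)
      qed (use that st in auto)
      have hst: "h absolutely_integrable_on {s..t}" using h sub by (rule absolutely_integrable_on_subinterval)
      have fst': "f integrable_on {s..t}" using fi sub by (rule integrable_subinterval_real)
      define k where "k \<tau> = F t * Q' (v y) * h \<tau> + F' x * Q (v s)" for \<tau>
      have hist: "h integrable_on {s..t}" using hst by (simp add: absolutely_integrable_on_def)
      have ki: "k integrable_on {s..t}" unfolding k_def
        using integrable_on_cmult_left[OF hist, of "F t * Q' (v y)"] by (intro integrable_add) auto
      have "integral {s..t} k = F t * Q' (v y) * integral {s..t} h + F' x * Q (v s) * (t - s)"
        unfolding k_def using hist st
          integrable_on_cmult_left[OF hist, of "F t * Q' (v y)"]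
        by (subst Henstock_Kurzweil_Integration.integral_add) auto
      also have "\<dots> = F t * (Q (v t) - Q (v s)) + (F t - F s) * Q (v s)"
        by (simp only: y x vinc mult.assoc mult.left_commute mult.commute)
      also have "\<dots> = F t * Q (v t) - F s * Q (v s)" by (simp add: algebra_simps)
      finally have K: "integral {s..t} k = F t * Q (v t) - F s * Q (v s)" .
      have "integral {a..s} f + integral {s..t} f = integral {a..t} f"
        using st fi by (intro Henstock_Kurzweil_Integration.integral_combine)
          (auto intro: integrable_subinterval_real)
      then have "D t - D s = integral {s..t} k - integral {s..t} f"
        unfolding D_def K by simp
      also have "\<dots> = integral {s..t} (\<lambda>\<tau>. k \<tau> - f \<tau>)"
        by (rule Henstock_Kurzweil_Integration.integral_diff[symmetric, OF ki fst'])
      finally have "\<bar>D t - D s\<bar> = norm (integral {s..t} (\<lambda>\<tau>. k \<tau> - f \<tau>))" by simp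
      also have "\<dots> \<le> integral {s..t} (\<lambda>\<tau>. \<epsilon> * g \<tau>)"
      proof (rule integral_norm_bound_integral)
        show "(\<lambda>\<tau>. k \<tau> - f \<tau>) integrable_on {s..t}" by (rule integrable_diff[OF ki fst'])
        show "(\<lambda>\<tau>. \<epsilon> * g \<tau>) integrable_on {s..t}"
          using integrable_on_cmult_left[OF integrable_subinterval_real[OF gi sub]] by simp
        fix \<tau> assume \<tau>: "\<tau> \<in> {s..t}"
        have "k \<tau> - f \<tau> = (P (t, y) - P (\<tau>, \<tau>)) * h \<tau> + (S (x, s) - S (\<tau>, \<tau>))"
          by (simp add: k_def f_def P_def S_def algebra_simps)
        also have "norm \<dots> \<le> \<bar>P (t, y) - P (\<tau>, \<tau>)\<bar> * \<bar>h \<tau>\<bar> + \<bar>S (x, s) - S (\<tau>, \<tau>)\<bar>"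
          by (metis abs_mult abs_triangle_ineq real_norm_def)
        also have "\<dots> \<le> \<epsilon> * \<bar>h \<tau>\<bar> + \<epsilon>"
        proof (intro add_mono mult_right_mono)
          show "\<bar>P (t, y) - P (\<tau>, \<tau>)\<bar> \<le> \<epsilon>"
            using d1(2)[of "(\<tau>,\<tau>)" "(t,y)"] near[of t s t y \<tau>] y(1) st sub \<tau> by (force simp: dist_real_def)
          show "\<bar>S (x, s) - S (\<tau>, \<tau>)\<bar> \<le> \<epsilon>"
            using d2(2)[of "(\<tau>,\<tau>)" "(x,s)"] near[of x s t s \<tau>] x(1) st sub \<tau> by (force simp: dist_real_def)
        qed auto
        finally show "norm (k \<tau> - f \<tau>) \<le> \<epsilon> * g \<tau>" by (simp add: g_def algebra_simps)
      qed
      finally show "\<bar>D t - D s\<bar> \<le> \<epsilon> * integral {s..t} g" by simp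
    qed
  qed
  then have "integral {a..b} f = F b * Q (v b) - F a * Q (v a)" by (simp add: D_def)
  then show ?thesis using integrable_integral[OF fi] by (simp add: f_def[abs_def])
qed

text \<open>
  Young's inequality for the exponents \<open>p / (p - 1)\<close> and \<open>p\<close>, with a weight \<open>\<mu>\<close> that is optimised at the very
  end. Keeping \<open>\<mu>\<close> free takes the place of Hoelder's inequality.
\<close>

lemma powr_tangent_inequality:
  fixes x y p \<mu> :: real
  assumes p: "p > 1" and x: "x \<ge> 0" and y: "y \<ge> 0" and \<mu>: "\<mu> > 0"
  shows "p * x powr (p - 1) * y \<le> (p - 1) * \<mu> * x powr p + \<mu> powr (1 - p) * y powr p"
proof (cases "x = 0 \<or> y = 0")
  case True then show ?thesis using assms by auto
next
  case False
  then have xy: "x > 0" "y > 0" using x y by auto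
  have "(\<mu> * x powr p) powr ((p - 1) / p) * (\<mu> powr (1 - p) * y powr p) powr (1 / p)
      \<le> (p - 1) / p * (\<mu> * x powr p) + 1 / p * (\<mu> powr (1 - p) * y powr p)"
    using p xy \<mu> by (intro Youngs_inequality_0) (auto simp: field_simps)
  also have "(\<mu> * x powr p) powr ((p - 1) / p) * (\<mu> powr (1 - p) * y powr p) powr (1 / p)
     = x powr (p - 1) * y * (\<mu> powr ((p - 1) / p) * \<mu> powr ((1 - p) / p))"
    using p xy \<mu> by (simp add: powr_mult powr_powr)
  also have "\<mu> powr ((p - 1) / p) * \<mu> powr ((1 - p) / p) = 1"
    using \<mu> p by (simp add: add_divide_distrib[symmetric] flip: powr_add)
  finally have "p * (x powr (p - 1) * y) \<le> p * ((p - 1) / p * (\<mu> * x powr p) + 1 / p * (\<mu> powr (1 - p) * y powr p))"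
    using p by (intro mult_left_mono) auto
  also have "\<dots> = (p - 1) * \<mu> * x powr p + \<mu> powr (1 - p) * y powr p"
    using p by (simp add: distrib_left)
  finally show ?thesis by (simp add: mult.assoc)
qed

lemma abs_powr_has_derivative:
  fixes y p :: real
  assumes p: "p > 1"
  shows "((\<lambda>y. \<bar>y\<bar> powr p) has_real_derivative p * \<bar>y\<bar> powr (p - 1) * sgn y) (at y)"
proof (cases "y = 0")
  case False
  have "((\<lambda>y. \<bar>y\<bar> powr p) has_real_derivative p * \<bar>y\<bar> powr (p - 1) * sgn y) (at y)
     \<longleftrightarrow> ((\<lambda>z. (sgn y * z) powr p) has_real_derivative p * \<bar>y\<bar> powr (p - 1) * sgn y) (at y)"
  proof (rule DERIV_cong_ev[OF refl _ refl])
    have "eventually (\<lambda>z. dist z y < \<bar>y\<bar>) (nhds y)" using False unfolding eventually_nhds_metric by (intro exI[of _ "\<bar>y\<bar>"]) auto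
    then show "eventually (\<lambda>z. \<bar>z\<bar> powr p = (sgn y * z) powr p) (nhds y)"
      by eventually_elim (auto simp: dist_real_def sgn_real_def)
  qed
  moreover have "((\<lambda>z. (sgn y * z) powr p) has_real_derivative p * \<bar>y\<bar> powr (p - 1) * sgn y) (at y)"
    using False by (auto intro!: derivative_eq_intros simp: sgn_real_def)
  ultimately show ?thesis by simp
next
  case True
  have "((\<lambda>y. (\<bar>y\<bar> powr p - 0) / (y - 0)) \<longlongrightarrow> 0) (at 0)"
  proof (rule Lim_null_comparison)
    show "eventually (\<lambda>z. norm ((\<bar>z\<bar> powr p - 0) / (z - 0)) \<le> \<bar>z\<bar> powr (p - 1)) (at (0::real))"
      by (intro eventuallyI) (auto simp: powr_diff)
    have "((\<lambda>z. \<bar>z\<bar> powr (p - 1)) \<longlongrightarrow> \<bar>0\<bar> powr (p - 1)) (at (0::real))"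
      using p by (intro tendsto_powr' tendsto_intros) auto
    then show "((\<lambda>z. \<bar>z\<bar> powr (p - 1)) \<longlongrightarrow> 0) (at (0::real))" by simp
  qed
  then show ?thesis using True by (simp add: has_field_derivative_iff)
qed

lemma continuous_on_abs_powr_sgn:
  fixes p :: real assumes p: "p > 1"
  shows "continuous_on UNIV (\<lambda>y::real. p * \<bar>y\<bar> powr (p - 1) * sgn y)"
proof -
  have "isCont (\<lambda>y::real. \<bar>y\<bar> powr (p - 1) * sgn y) y" for y
  proof (cases "y = 0")
    case True
    have "((\<lambda>z. \<bar>z\<bar> powr (p - 1) * sgn z) \<longlongrightarrow> 0) (at (0::real))"
    proof (rule Lim_null_comparison)
      show "eventually (\<lambda>z. norm (\<bar>z\<bar> powr (p - 1) * sgn z) \<le> \<bar>z\<bar> powr (p - 1)) (at (0::real))"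
        by (intro eventuallyI) (auto simp: sgn_real_def)
      have "((\<lambda>z. \<bar>z\<bar> powr (p - 1)) \<longlongrightarrow> \<bar>0\<bar> powr (p - 1)) (at (0::real))"
        using p by (intro tendsto_powr' tendsto_intros) auto
      then show "((\<lambda>z. \<bar>z\<bar> powr (p - 1)) \<longlongrightarrow> 0) (at (0::real))" by simp
    qed
    then show ?thesis using True by (simp add: isCont_def)
  next
    case False
    then have "((\<lambda>z. \<bar>z\<bar> powr (p - 1) * sgn z) \<longlongrightarrow> \<bar>y\<bar> powr (p - 1) * sgn y) (at y)"
      by (intro tendsto_intros) auto
    then show ?thesis by (simp add: isCont_def)
  qed
  then have "continuous_on UNIV (\<lambda>y::real. \<bar>y\<bar> powr (p - 1) * sgn y)"
    by (simp add: continuous_at_imp_continuous_on)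
  then have "continuous_on UNIV (\<lambda>y::real. p * (\<bar>y\<bar> powr (p - 1) * sgn y))"
    by (rule continuous_on_mult_left)
  then show ?thesis by (simp add: mult.assoc)
qed

text \<open>
  Truncate \<open>|f|\<close> at a level \<open>k\<close> so high that the cut-off part has integral below \<open>\<epsilon> / 2\<close>; on a set of measure
  below \<open>\<epsilon> / (2 (k + 1))\<close> the truncated part contributes less than \<open>\<epsilon> / 2\<close>.
\<close>

lemma integral_absolutely_continuous:
  fixes f :: "'a \<Rightarrow> real"
  assumes f: "integrable N f" and e: "\<epsilon> > 0"
  obtains \<delta> where "\<delta> > 0" "\<And>E. E \<in> sets N \<Longrightarrow> emeasure N E < ennreal \<delta> \<Longrightarrow> (LINT x:E|N. \<bar>f x\<bar>) < \<epsilon>"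
proof -
  have fm[measurable]: "f \<in> borel_measurable N" using f by auto
  have "(\<lambda>k. LINT x|N. \<bar>f x\<bar> - min \<bar>f x\<bar> (real k)) \<longlonglongrightarrow> (LINT x|N. 0)"
  proof (rule integral_dominated_convergence[where w="\<lambda>x. \<bar>f x\<bar>"])
    show "AE x in N. (\<lambda>k. \<bar>f x\<bar> - min \<bar>f x\<bar> (real k)) \<longlonglongrightarrow> 0"
    proof (rule AE_I2)
      fix x
      have "eventually (\<lambda>k. \<bar>f x\<bar> - min \<bar>f x\<bar> (real k) = 0) sequentially"
        using eventually_ge_at_top[of "nat \<lceil>\<bar>f x\<bar>\<rceil>"] by eventually_elim linarith
      then show "(\<lambda>k. \<bar>f x\<bar> - min \<bar>f x\<bar> (real k)) \<longlonglongrightarrow> 0" by (rule tendsto_eventually)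
    qed
  qed (use f in auto)
  then have "eventually (\<lambda>k. (LINT x|N. \<bar>f x\<bar> - min \<bar>f x\<bar> (real k)) < \<epsilon> / 2) sequentially"
    using e by (intro order_tendstoD(2)[of _ 0]) auto
  then obtain k where k: "(LINT x|N. \<bar>f x\<bar> - min \<bar>f x\<bar> (real k)) < \<epsilon> / 2"
    by (auto simp: eventually_sequentially)
  define \<delta> where "\<delta> = \<epsilon> / (2 * (real k + 1))"
  have d: "\<delta> > 0" using e by (simp add: \<delta>_def)
  show ?thesis
  proof (rule that[OF d])
    fix E assume E[measurable]: "E \<in> sets N" and small: "emeasure N E < ennreal \<delta>"
    have fin: "emeasure N E < \<infinity>" using order_less_trans[OF small ennreal_less_top] by simp
    have "ennreal (measure N E) < ennreal \<delta>"
      using small fin by (subst emeasure_eq_ennreal_measure[symmetric]) auto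
    then have mE: "measure N E < \<delta>" by (simp add: ennreal_less_iff)
    have mi: "integrable N (\<lambda>x. min \<bar>f x\<bar> (real k))"
      by (rule Bochner_Integration.integrable_bound[of _ "\<lambda>x. \<bar>f x\<bar>"]) (use f in auto)
    have "(LINT x:E|N. \<bar>f x\<bar>) \<le> (LINT x|N. (\<bar>f x\<bar> - min \<bar>f x\<bar> (real k)) + real k * indicator E x)"
      unfolding set_lebesgue_integral_def
    proof (rule integral_mono)
      show "integrable N (\<lambda>x. indicat_real E x *\<^sub>R \<bar>f x\<bar>)"
        using f by (intro integrable_mult_indicator) auto
      show "integrable N (\<lambda>x. \<bar>f x\<bar> - min \<bar>f x\<bar> (real k) + real k * indicat_real E x)"
        using f mi fin by (intro Bochner_Integration.integrable_add Bochner_Integration.integrable_diff integrable_mult_right integrable_abs) auto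
    qed (auto simp: indicator_def)
    also have "\<dots> = (LINT x|N. \<bar>f x\<bar> - min \<bar>f x\<bar> (real k)) + real k * measure N E"
      using f mi fin by (subst Bochner_Integration.integral_add) (auto intro!: Bochner_Integration.integrable_diff integrable_mult_right)
    also have "\<dots> < \<epsilon> / 2 + (real k + 1) * \<delta>"
    proof (rule add_less_le_mono[OF k])
      show "real k * measure N E \<le> (real k + 1) * \<delta>" using mE d by (intro mult_mono) auto
    qed
    also have "(real k + 1) * \<delta> = \<epsilon> / 2" unfolding \<delta>_def by (simp add: field_simps)
    finally show "(LINT x:E|N. \<bar>f x\<bar>) < \<epsilon>" by simp
  qed
qed

lemma absolutely_continuous_on_primitive:
  fixes h :: "real \<Rightarrow> real"
  assumes h: "h absolutely_integrable_on {a..b}"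
    and v: "\<And>t. t \<in> {a..b} \<Longrightarrow> v t = v a + integral {a..t} h"
  shows "absolutely_continuous_on {a..b} v"
  unfolding absolutely_continuous_on_def
proof (intro allI impI)
  fix \<epsilon> :: real assume \<epsilon>: "\<epsilon> > 0"
  have hi: "h integrable_on {a..b}" using h by (simp add: absolutely_integrable_on_def)
  define f where "f x = indicat_real {a..b} x *\<^sub>R h x" for x
  have f: "integrable lebesgue f" using h by (simp add: f_def[abs_def] set_integrable_def)
  have fset: "set_integrable lebesgue {s<..<t} (\<lambda>x. \<bar>f x\<bar>)" for s t
    unfolding set_integrable_def by (intro integrable_mult_indicator integrable_abs f) auto
  obtain \<delta> where \<delta>: "\<delta> > 0" "\<And>E. E \<in> sets lebesgue \<Longrightarrow> emeasure lebesgue E < ennreal \<delta> \<Longrightarrow> (LINT x:E|lebesgue. \<bar>f x\<bar>) < \<epsilon>"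
    using integral_absolutely_continuous[OF f \<epsilon>] by metis
  show "\<exists>\<delta>>0. \<forall>(N::nat) (s::nat \<Rightarrow> real) (t::nat \<Rightarrow> real).
      (\<forall>k<N. s k \<le> t k \<and> {s k..t k} \<subseteq> {a..b}) \<longrightarrow>
      (\<forall>k<N. \<forall>l<N. k \<noteq> l \<longrightarrow> {s k<..<t k} \<inter> {s l<..<t l} = {}) \<longrightarrow>
      (\<Sum>k<N. t k - s k) < \<delta> \<longrightarrow> (\<Sum>k<N. \<bar>v (t k) - v (s k)\<bar>) < \<epsilon>"
  proof (intro exI[of _ \<delta>] conjI \<delta> allI impI)
    fix N :: nat and s t :: "nat \<Rightarrow> real"
    assume st: "\<forall>k<N. s k \<le> t k \<and> {s k..t k} \<subseteq> {a..b}"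
      and dj: "\<forall>k<N. \<forall>l<N. k \<noteq> l \<longrightarrow> {s k<..<t k} \<inter> {s l<..<t l} = {}"
      and sm: "(\<Sum>k<N. t k - s k) < \<delta>"
    define E where "E = (\<Union>k<N. {s k<..<t k})"
    have dj': "disjoint_family_on (\<lambda>k. {s k<..<t k}) {..<N}"
      using dj unfolding disjoint_family_on_def by auto
    have "emeasure lebesgue E = (\<Sum>k<N. emeasure lebesgue {s k<..<t k})"
      unfolding E_def by (rule sum_emeasure[symmetric]) (use dj' in auto)
    also have "\<dots> = (\<Sum>k<N. ennreal (t k - s k))" using st by (intro sum.cong) auto
    also have "\<dots> = ennreal (\<Sum>k<N. t k - s k)" using st by (intro sum_ennreal) auto
    also have "\<dots> < ennreal \<delta>" using sm \<delta> by (intro ennreal_lessI) auto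
    finally have "(LINT x:E|lebesgue. \<bar>f x\<bar>) < \<epsilon>" by (intro \<delta>) (auto simp: E_def)
    also have "(LINT x:E|lebesgue. \<bar>f x\<bar>) = (\<Sum>k<N. (LINT x:{s k<..<t k}|lebesgue. \<bar>f x\<bar>))"
      unfolding E_def
      by (rule set_integral_finite_Union)
         (use dj' fset in auto)
    finally have less: "(\<Sum>k<N. (LINT x:{s k<..<t k}|lebesgue. \<bar>f x\<bar>)) < \<epsilon>" .
    have "\<bar>v (t k) - v (s k)\<bar> \<le> (LINT x:{s k<..<t k}|lebesgue. \<bar>f x\<bar>)" if "k < N" for k
    proof -
      have k: "a \<le> s k" "s k \<le> t k" "t k \<le> b" using st that by (force)+
      have "v (t k) - v (s k) = integral {s k..t k} h" by (rule primitive_increment[OF hi v k])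
      also have "\<dots> = integral {s k..t k} f"
        using k by (intro integral_cong) (auto simp: f_def)
      also have "\<bar>\<dots>\<bar> \<le> integral {s k..t k} (\<lambda>x. \<bar>f x\<bar>)"
      proof -
        have "f absolutely_integrable_on {s k..t k}"
          using f unfolding set_integrable_def by (intro integrable_mult_indicator) auto
        then show ?thesis
          using integral_norm_bound_integral[of f "{s k..t k}" "\<lambda>x. \<bar>f x\<bar>"]
          unfolding absolutely_integrable_on_def by simp
      qed
      also have "\<dots> = integral {s k<..<t k} (\<lambda>x. \<bar>f x\<bar>)" by (simp add: integral_open_interval_real)
      also have "\<dots> = (LINT x:{s k<..<t k}|lebesgue. \<bar>f x\<bar>)"
        by (rule set_lebesgue_integral_eq_integral(2)[symmetric, OF fset])
      finally show ?thesis .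
    qed
    then have "(\<Sum>k<N. \<bar>v (t k) - v (s k)\<bar>) \<le> (\<Sum>k<N. (LINT x:{s k<..<t k}|lebesgue. \<bar>f x\<bar>))"
      by (intro sum_mono) auto
    with less show "(\<Sum>k<N. \<bar>v (t k) - v (s k)\<bar>) < \<epsilon>" by linarith
  qed
qed

lemma absolutely_continuous_on_imp_continuous:
  assumes "absolutely_continuous_on {a..b} f"
  shows "continuous_on {a..b} f"
  unfolding continuous_on_iff
proof (intro ballI allI impI)
  fix x e :: real assume x: "x \<in> {a..b}" and e: "e > 0"
  then obtain d where d: "d > 0" and *: "\<forall>(N::nat) (s::nat \<Rightarrow> real) (t::nat \<Rightarrow> real).
      (\<forall>k<N. s k \<le> t k \<and> {s k..t k} \<subseteq> {a..b}) \<longrightarrow>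
      (\<forall>k<N. \<forall>l<N. k \<noteq> l \<longrightarrow> {s k<..<t k} \<inter> {s l<..<t l} = {}) \<longrightarrow>
      (\<Sum>k<N. t k - s k) < d \<longrightarrow> (\<Sum>k<N. \<bar>f (t k) - f (s k)\<bar>) < e"
    using assms[unfolded absolutely_continuous_on_def, THEN spec, THEN mp, OF e] by (elim exE conjE)
  show "\<exists>d>0. \<forall>x'\<in>{a..b}. dist x' x < d \<longrightarrow> dist (f x') (f x) < e"
  proof (intro exI[of _ d] conjI d ballI impI)
    fix y assume y: "y \<in> {a..b}" "dist y x < d"
    show "dist (f y) (f x) < e"
      using *[THEN spec, of "Suc 0", THEN spec, of "\<lambda>_. min x y", THEN spec, of "\<lambda>_. max x y"] x y
      by (cases "x \<le> y") (auto simp: dist_real_def min_def max_def abs_minus_commute)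
  qed
qed

section \<open>Polar coordinates\<close>

text \<open>
  All integrals over spheres are pulled back to the unit sphere. Its surface measure lives on the whole space
  and charges only unit vectors (\<open>AE_sphere_measure_norm\<close>).
\<close>

abbreviation sphere_measure :: "'a::euclidean_space measure" where
  "sphere_measure \<equiv> surface_measure 1"

lemma pred_borel_nonzero [measurable]: "Measurable.pred borel (\<lambda>x::'a::euclidean_space. x \<noteq> 0)"
  unfolding pred_def by (simp add: Collect_neg_eq)

lemma nn_integral_lborel_scale:
  fixes f :: "'a::euclidean_space \<Rightarrow> ennreal"
  assumes [measurable]: "f \<in> borel_measurable borel" and c: "c > 0"
  shows "(\<integral>\<^sup>+x. f x \<partial>lborel) = ennreal (c ^ DIM('a)) * (\<integral>\<^sup>+x. f (c *\<^sub>R x) \<partial>lborel)"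
proof -
  have "(\<integral>\<^sup>+x. f x \<partial>lborel) = (\<integral>\<^sup>+x. f x \<partial>density (distr lborel borel (\<lambda>x. 0 + c *\<^sub>R x)) (\<lambda>_. ennreal (\<bar>c\<bar> ^ DIM('a))))"
    using c by (subst lborel_affine[of c 0]) auto
  also have "\<dots> = ennreal (c ^ DIM('a)) * (\<integral>\<^sup>+x. f (c *\<^sub>R x) \<partial>lborel)"
    using c by (simp add: nn_integral_density nn_integral_distr nn_integral_cmult)
  finally show ?thesis .
qed

lemma scaled_direction: "(\<rho> / norm x) *\<^sub>R x = \<rho> *\<^sub>R sgn x"
  for x :: "'a::euclidean_space"
  by (simp add: sgn_div_norm divide_inverse)

lemma sets_surface_measure [simp, measurable_cong]: "sets (surface_measure \<rho>) = sets borel"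
  by (simp add: surface_measure_def)

lemma space_surface_measure [simp]: "space (surface_measure \<rho>) = UNIV"
  by (simp add: surface_measure_def space_scale_measure)

lemma measurable_surface_measure_eq [simp]: "measurable (surface_measure \<rho>) N = measurable borel N"
  by (rule measurable_cong_sets) simp_all

lemma nn_integral_surface_measure:
  fixes f :: "'a::euclidean_space \<Rightarrow> ennreal"
  assumes [measurable]: "f \<in> borel_measurable borel"
  shows "(\<integral>\<^sup>+x. f x \<partial>surface_measure \<rho>) =
    ennreal (real DIM('a) / \<rho>) * (\<integral>\<^sup>+x. f (\<rho> *\<^sub>R sgn x) * indicator (ball 0 \<rho> - {0}) x \<partial>lborel)"
  unfolding surface_measure_def scaled_direction
  by (simp add: nn_integral_scale_measure nn_integral_distr measurable_restrict_space1 nn_integral_restrict_space)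

lemma nn_integral_surface_measure_scale:
  fixes f :: "'a::euclidean_space \<Rightarrow> ennreal"
  assumes [measurable]: "f \<in> borel_measurable borel" and \<rho>: "\<rho> > 0"
  shows "(\<integral>\<^sup>+x. f x \<partial>surface_measure \<rho>) =
    ennreal (\<rho> ^ (DIM('a) - 1)) * (\<integral>\<^sup>+\<omega>. f (\<rho> *\<^sub>R \<omega>) \<partial>sphere_measure)"
proof -
  let ?n = "DIM('a)"
  have sg: "sgn (\<rho> *\<^sub>R x) = sgn x" for x :: 'a using \<rho> by (simp add: sgn_scaleR)
  have ind: "indicator (ball 0 \<rho> - {0}) (\<rho> *\<^sub>R x) = (indicator (ball 0 1 - {0}) x :: ennreal)" for x :: 'a
    using \<rho> by (auto simp: indicator_def dist_norm)
  have n: "\<rho> ^ ?n / \<rho> = \<rho> ^ (?n - 1)" using \<rho> DIM_positive[where 'a='a]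
    by (cases ?n) auto
  have "(\<integral>\<^sup>+x. f (\<rho> *\<^sub>R sgn x) * indicator (ball 0 \<rho> - {0}) x \<partial>lborel) =
     ennreal (\<rho> ^ ?n) * (\<integral>\<^sup>+x. f (\<rho> *\<^sub>R sgn x) * indicator (ball 0 1 - {0}) x \<partial>lborel)"
  proof -
    have "(\<lambda>x. f (\<rho> *\<^sub>R sgn x) * indicator (ball 0 \<rho> - {0}) x) \<in> borel_measurable borel"
      by (intro borel_measurable_times_ennreal borel_measurable_indicator measurable_compose[OF _ assms(1)]) auto
    from nn_integral_lborel_scale[OF this \<rho>] show ?thesis by (simp add: sg ind)
  qed
  then have "(\<integral>\<^sup>+x. f x \<partial>surface_measure \<rho>) = ennreal (real ?n / \<rho>) * ennreal (\<rho> ^ ?n) *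
     (\<integral>\<^sup>+x. f (\<rho> *\<^sub>R sgn x) * indicator (ball 0 1 - {0}) x \<partial>lborel)"
    by (simp add: nn_integral_surface_measure mult.assoc)
  also have "ennreal (real ?n / \<rho>) * ennreal (\<rho> ^ ?n) = ennreal (\<rho> ^ (?n - 1)) * ennreal (real ?n)"
  proof -
    have "real ?n / \<rho> * \<rho> ^ ?n = \<rho> ^ (?n - 1) * real ?n" unfolding n[symmetric] by simp
    then show ?thesis using \<rho> by (simp only: ennreal_mult[symmetric] zero_le_power less_imp_le divide_nonneg_pos of_nat_0_le_iff)
  qed
  finally show ?thesis by (simp add: nn_integral_surface_measure mult.assoc)
qed

lemma surface_measure_eq:
  assumes \<rho>: "\<rho> > 0"
  shows "(surface_measure \<rho> :: 'a::euclidean_space measure) =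
    density (distr sphere_measure borel (\<lambda>\<omega>. \<rho> *\<^sub>R \<omega>)) (\<lambda>_. ennreal (\<rho> ^ (DIM('a) - 1)))"
proof (rule measure_eqI)
  fix A :: "'a set" assume "A \<in> sets (surface_measure \<rho>)"
  then have A[measurable]: "A \<in> sets borel" by simp
  have "emeasure (surface_measure \<rho>) A = (\<integral>\<^sup>+x. indicator A x \<partial>surface_measure \<rho>)" by simp
  also have "\<dots> = ennreal (\<rho> ^ (DIM('a) - 1)) * (\<integral>\<^sup>+\<omega>. indicator A (\<rho> *\<^sub>R \<omega>) \<partial>sphere_measure)"
    using \<rho> by (intro nn_integral_surface_measure_scale) auto
  also have "(\<integral>\<^sup>+\<omega>. indicator A (\<rho> *\<^sub>R \<omega>) \<partial>sphere_measure)
      = (\<integral>\<^sup>+\<omega>. indicator A \<omega> \<partial>distr sphere_measure borel (\<lambda>\<omega>. \<rho> *\<^sub>R \<omega>))"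
    by (subst nn_integral_distr) auto
  also have "ennreal (\<rho> ^ (DIM('a) - 1)) * \<dots> =
     emeasure (density (distr sphere_measure borel (\<lambda>\<omega>. \<rho> *\<^sub>R \<omega>)) (\<lambda>_. ennreal (\<rho> ^ (DIM('a) - 1)))) A"
    by (subst emeasure_density) (auto simp: nn_integral_cmult)
  finally show "emeasure (surface_measure \<rho>) A =
     emeasure (density (distr sphere_measure borel (\<lambda>\<omega>. \<rho> *\<^sub>R \<omega>)) (\<lambda>_. ennreal (\<rho> ^ (DIM('a) - 1)))) A" .
qed simp

lemma integral_surface_measure:
  fixes f :: "'a::euclidean_space \<Rightarrow> real"
  assumes [measurable]: "f \<in> borel_measurable borel" and \<rho>: "\<rho> > 0"
  shows "(LINT x|surface_measure \<rho>. f x) = \<rho> ^ (DIM('a) - 1) * (LINT \<omega>|sphere_measure. f (\<rho> *\<^sub>R \<omega>))"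
  using \<rho> by (simp add: surface_measure_eq[OF \<rho>] integral_density integral_distr)

lemma integrable_surface_measure:
  fixes f :: "'a::euclidean_space \<Rightarrow> real"
  assumes [measurable]: "f \<in> borel_measurable borel" and \<rho>: "\<rho> > 0"
  shows "integrable (surface_measure \<rho>) f \<longleftrightarrow> integrable sphere_measure (\<lambda>\<omega>. f (\<rho> *\<^sub>R \<omega>))"
  using \<rho> by (simp add: surface_measure_eq[OF \<rho>] integrable_density integrable_distr_eq)

lemma finite_measure_sphere_measure: "finite_measure (sphere_measure :: 'a::euclidean_space measure)"
proof
  have "emeasure (sphere_measure :: 'a measure) UNIV = (\<integral>\<^sup>+x. 1 \<partial>(sphere_measure :: 'a measure))" by simp
  also have "\<dots> = ennreal (real DIM('a)) * emeasure lborel (ball 0 1 - {0::'a})"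
    by (subst nn_integral_surface_measure) simp_all
  also have "\<dots> < \<infinity>"
  proof -
    have "emeasure lborel (ball 0 1 - {0::'a}) < \<infinity>"
      by (rule emeasure_bounded_finite) (meson bounded_ball bounded_diff)
    then show ?thesis by (simp add: ennreal_mult_less_top)
  qed
  finally show "emeasure (sphere_measure :: 'a measure) (space sphere_measure) \<noteq> \<infinity>" by simp
qed

lemma AE_sphere_measure_norm: "AE \<omega> in (sphere_measure :: 'a::euclidean_space measure). norm \<omega> = 1"
proof (rule AE_I')
  show "{\<omega>::'a. norm \<omega> \<noteq> 1} \<in> null_sets sphere_measure"
  proof
    show "{\<omega>::'a. norm \<omega> \<noteq> 1} \<in> sets sphere_measure" by simp
    have "emeasure (sphere_measure :: 'a measure) {\<omega>. norm \<omega> \<noteq> 1} = (\<integral>\<^sup>+x. indicator {\<omega>. norm \<omega> \<noteq> 1} x \<partial>(sphere_measure :: 'a measure))"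
      by simp
    also have "\<dots> = ennreal (real DIM('a)) *
        (\<integral>\<^sup>+x. indicator {\<omega>. norm \<omega> \<noteq> 1} (sgn x) * indicator (ball 0 1 - {0}) (x::'a) \<partial>lborel)"
      by (subst nn_integral_surface_measure) simp_all
    also have "(\<lambda>x::'a. indicator {\<omega>. norm \<omega> \<noteq> 1} (sgn x) * indicator (ball 0 1 - {0}) x) = (\<lambda>x. 0::ennreal)"
      by (auto simp: indicator_def norm_sgn)
    finally show "emeasure sphere_measure {\<omega>::'a. norm \<omega> \<noteq> 1} = 0" by simp
  qed
qed auto

text \<open>
  The sets on which the polar decomposition is checked: pieces of a cone of directions \<open>B\<close> inside a ball.
\<close>

definition cone_part :: "'a::euclidean_space set \<Rightarrow> real \<Rightarrow> 'a set" where
  "cone_part B s = {x. x \<noteq> 0 \<and> norm x < s \<and> sgn x \<in> B}"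

lemma cone_part_measurable [measurable]: "B \<in> sets borel \<Longrightarrow> cone_part B s \<in> sets borel"
  unfolding cone_part_def by simp

text \<open>
  Scaling: the cone over \<open>B\<close> of radius \<open>1\<close> has volume \<open>\<sigma>(B) / n\<close> by the very definition of \<open>\<sigma>\<close>, and Lebesgue
  measure is homogeneous of degree \<open>n\<close>. The factor \<open>n\<close> stands on the left so that no division in the
  extended reals occurs.
\<close>

lemma emeasure_cone_part:
  fixes B :: "'a::euclidean_space set"
  assumes B[measurable]: "B \<in> sets borel" and s: "s \<ge> 0"
  shows "ennreal (real DIM('a)) * emeasure lborel (cone_part B s) = ennreal (s ^ DIM('a)) * emeasure sphere_measure B"
proof (cases "s = 0")
  case True
  then have "cone_part B s = {}" by (auto simp: cone_part_def)
  then show ?thesis using True by simp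
next
  case False
  then have s: "s > 0" using s by simp
  have "emeasure sphere_measure B = (\<integral>\<^sup>+x. indicator B x \<partial>sphere_measure)" by simp
  also have "\<dots> = ennreal (real DIM('a)) * (\<integral>\<^sup>+x. indicator B (sgn x) * indicator (ball 0 1 - {0}) x \<partial>lborel)"
    by (subst nn_integral_surface_measure) simp_all
  also have "(\<lambda>x. indicator B (sgn x) * indicator (ball 0 1 - {0}) x) = (\<lambda>x. indicator (cone_part B 1) x :: ennreal)"
    by (auto simp: indicator_def cone_part_def)
  finally have 1: "emeasure sphere_measure B = ennreal (real DIM('a)) * (\<integral>\<^sup>+x. indicator (cone_part B 1) x \<partial>lborel)" .
  have "emeasure lborel (cone_part B s) = (\<integral>\<^sup>+x. indicator (cone_part B s) x \<partial>lborel)" by simp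
  also have "\<dots> = ennreal (s ^ DIM('a)) * (\<integral>\<^sup>+x. indicator (cone_part B s) (s *\<^sub>R x) \<partial>lborel)"
    using s by (intro nn_integral_lborel_scale) auto
  also have "(\<lambda>x. indicator (cone_part B s) (s *\<^sub>R x)) = (\<lambda>x. indicator (cone_part B 1) x :: ennreal)"
    using s by (auto simp: indicator_def cone_part_def sgn_scaleR)
  finally show ?thesis by (simp add: 1 mult_ac)
qed

lemma emeasure_cone_part_finite: "emeasure lborel (cone_part B s) < \<infinity>"
proof (rule emeasure_bounded_finite)
  show "bounded (cone_part B s)" by (rule bounded_subset[of "ball 0 s"]) (auto simp: cone_part_def)
qed

lemma emeasure_lborel_sphere: "emeasure lborel (sphere (0::'a::euclidean_space) s) = 0"
proof -
  have "sphere (0::'a) s \<in> null_sets lebesgue" using negligible_sphere negligible_iff_null_sets by blast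
  then show ?thesis by (auto simp: null_sets_def)
qed

lemma nn_integral_power_tail:
  assumes n: "n \<ge> 1" and s: "0 \<le> s" "s \<le> R"
  shows "ennreal (real n) * (\<integral>\<^sup>+t. ennreal (t ^ (n - 1)) * indicator {s<..<R} t \<partial>lborel) + ennreal (s ^ n) = ennreal (R ^ n)"
proof -
  have "(\<integral>\<^sup>+t. ennreal (t ^ (n - 1)) * indicator {s<..<R} t \<partial>lborel) = (\<integral>\<^sup>+t. ennreal (t ^ (n - 1)) * indicator {s..R} t \<partial>lborel)"
    using AE_lborel_singleton[of s] AE_lborel_singleton[of R]
    by (intro nn_integral_cong_AE) (auto elim!: eventually_elim2 simp: indicator_def)
  also have "\<dots> = ennreal (R ^ n / real n - s ^ n / real n)"
    using n s by (intro nn_integral_FTC_Icc) (auto intro!: derivative_eq_intros simp: field_simps)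
  finally have "ennreal (real n) * (\<integral>\<^sup>+t. ennreal (t ^ (n - 1)) * indicator {s<..<R} t \<partial>lborel) = ennreal (R ^ n - s ^ n)"
    using n by (simp add: ennreal_mult'[symmetric] algebra_simps)
  then show ?thesis using s by (simp add: ennreal_plus[symmetric] power_mono del: ennreal_plus)
qed

text \<open>
  For a fixed set \<open>B\<close> of directions both sides are measures in \<open>A\<close>, so it suffices to compare them on the half
  lines \<open>{s<..}\<close>. There both complement the cone of radius \<open>s\<close> in the cone of radius \<open>R\<close>; the volumes of these
  cones are known by scaling and finite, so the smaller one can be cancelled. This is why the radii are restricted to
  \<open>{0<..<R}\<close>.
\<close>

lemma polar_emeasure:
  fixes B :: "'a::euclidean_space set"
  assumes B[measurable]: "B \<in> sets borel" and A: "A \<in> sets borel" and R: "R > 0"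
  shows "emeasure (density lborel (\<lambda>t. ennreal (t ^ (DIM('a) - 1)) * indicator {0<..<R} t)) A * emeasure sphere_measure B
    = emeasure lborel {x. x \<noteq> 0 \<and> norm x < R \<and> norm x \<in> A \<and> sgn x \<in> B}"
proof -
  let ?D = "density lborel (\<lambda>t. ennreal (t ^ (DIM('a) - 1)) * indicator {0<..<R} t)"
  let ?n = "DIM('a)"
  interpret S: finite_measure "sphere_measure :: 'a measure" by (rule finite_measure_sphere_measure)
  define N1 where "N1 = distr (restrict_space lborel (cone_part B R)) borel (norm :: 'a \<Rightarrow> real)"
  define N2 where "N2 = scale_measure (emeasure sphere_measure B) ?D"
  have e1: "emeasure N1 A' = emeasure lborel {x. x \<noteq> 0 \<and> norm x < R \<and> norm x \<in> A' \<and> sgn x \<in> B}" if [measurable]: "A' \<in> sets borel" for A'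
  proof -
    have "emeasure N1 A' = emeasure (restrict_space lborel (cone_part B R)) (norm -` A' \<inter> cone_part B R)"
      unfolding N1_def by (subst emeasure_distr) (auto simp: space_restrict_space intro!: measurable_restrict_space1)
    also have "\<dots> = emeasure lborel (norm -` A' \<inter> cone_part B R)"
      by (subst emeasure_restrict_space) auto
    also have "norm -` A' \<inter> cone_part B R = {x. x \<noteq> 0 \<and> norm x < R \<and> norm x \<in> A' \<and> sgn x \<in> B}"
      by (auto simp: cone_part_def)
    finally show ?thesis .
  qed
  have e2: "emeasure N2 A' = emeasure ?D A' * emeasure sphere_measure B" for A'
    by (simp add: N2_def mult.commute)
  have "N1 = N2"
  proof (rule measure_eqI_lessThan)
    show "sets N1 = sets borel" "sets N2 = sets borel" by (auto simp: N1_def N2_def)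
    fix s :: real
    have le: "emeasure N1 {s<..} \<le> emeasure lborel (cone_part B R)"
      by (subst e1) (auto intro!: emeasure_mono simp: cone_part_def)
    also have "\<dots> < \<infinity>" by (rule emeasure_cone_part_finite)
    finally show fin: "emeasure N1 {s<..} < \<infinity>" .
    \<comment> \<open>Half lines starting outside \<open>{0..R}\<close> reduce to the two extreme cases.\<close>
    define s' where "s' = max 0 (min s R)"
    have s': "0 \<le> s'" "s' \<le> R" using R by (auto simp: s'_def)
    have E1: "emeasure N1 {s<..} = emeasure lborel {x. x \<noteq> 0 \<and> s' < norm x \<and> norm x < R \<and> sgn x \<in> B}"
    proof -
      have "(s < norm x) \<longleftrightarrow> (s' < norm x)" if "x \<noteq> 0" "norm x < R" for x :: 'a
        using that R by (cases "s < 0"; cases "s \<le> R") (auto simp: s'_def min_def max_def intro: order.strict_trans)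
      then show ?thesis by (subst e1) (auto intro!: arg_cong[where f="emeasure lborel"])
    qed
    have E2: "emeasure ?D {s<..} = (\<integral>\<^sup>+t. ennreal (t ^ (?n - 1)) * indicator {s'<..<R} t \<partial>lborel)"
      by (subst emeasure_density) (auto intro!: nn_integral_cong simp: indicator_def s'_def)
    have "emeasure lborel (cone_part B R) = emeasure lborel ({x. x \<noteq> 0 \<and> s' < norm x \<and> norm x < R \<and> sgn x \<in> B} \<union> (cone_part B s'))"
    proof (rule emeasure_eq_AE)
      have "AE x in lborel. x \<notin> sphere (0::'a) s'"
        by (rule AE_not_in) (auto simp: null_sets_def emeasure_lborel_sphere)
      then show "AE x in lborel. (x \<in> cone_part B R) =
         (x \<in> {x. x \<noteq> 0 \<and> s' < norm x \<and> norm x < R \<and> sgn x \<in> B} \<union> cone_part B s')"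
        by eventually_elim (use s' in \<open>auto simp: cone_part_def\<close>)
    qed auto
    also have "\<dots> = emeasure N1 {s<..} + emeasure lborel (cone_part B s')"
      unfolding E1 by (rule plus_emeasure[symmetric]) (auto simp: cone_part_def)
    finally have "ennreal (real ?n) * emeasure N1 {s<..} + ennreal (s' ^ ?n) * emeasure sphere_measure B
        = ennreal (R ^ ?n) * emeasure sphere_measure B"
      using emeasure_cone_part[OF B, of R] emeasure_cone_part[OF B s'(1)] R by (simp add: distrib_left)
    also have "ennreal (R ^ ?n) = ennreal (real ?n) * emeasure ?D {s<..} + ennreal (s' ^ ?n)"
      unfolding E2 using s' by (subst nn_integral_power_tail) (auto simp: Suc_le_eq)
    finally have "ennreal (s' ^ ?n) * emeasure sphere_measure B + ennreal (real ?n) * emeasure N1 {s<..}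
        = ennreal (s' ^ ?n) * emeasure sphere_measure B + ennreal (real ?n) * emeasure N2 {s<..}"
      by (simp add: e2 distrib_right mult.assoc add.commute)
    then have "ennreal (real ?n) * emeasure N1 {s<..} = ennreal (real ?n) * emeasure N2 {s<..}"
      by (subst (asm) ennreal_add_left_cancel) (auto simp: ennreal_mult_eq_top_iff)
    then show "emeasure N1 {s<..} = emeasure N2 {s<..}"
      by (subst (asm) ennreal_mult_cancel_left) auto
  qed
  then show ?thesis using e1[OF A] e2[of A] by simp
qed

text \<open>
  Polar coordinates as an identity of measures: the image of Lebesgue measure under \<open>x \<mapsto> (|x|, x / |x|)\<close> is a
  product measure.
\<close>

lemma polar_measure_eq:
  assumes R: "R > 0"
  shows "density lborel (\<lambda>t. ennreal (t ^ (DIM('a) - 1)) * indicator {0<..<R} t) \<Otimes>\<^sub>M (sphere_measure :: 'a::euclidean_space measure)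
    = distr (restrict_space lborel (ball 0 R - {0})) (borel \<Otimes>\<^sub>M borel) (\<lambda>x. (norm x, sgn x))"
    (is "?D \<Otimes>\<^sub>M _ = ?P")
proof (rule pair_measure_eqI)
  interpret S: finite_measure "sphere_measure :: 'a measure" by (rule finite_measure_sphere_measure)
  show "sigma_finite_measure (sphere_measure :: 'a measure)" by unfold_locales
  show "sigma_finite_measure ?D"
    by (subst sigma_finite_measure.sigma_finite_iff_density_finite[OF sigma_finite_lborel]) (auto simp: indicator_def)
  show "sets (?D \<Otimes>\<^sub>M (sphere_measure :: 'a measure)) = sets ?P"
    by (simp cong: sets_pair_measure_cong)
  fix A :: "real set" and B :: "'a set" assume "A \<in> sets ?D" "B \<in> sets sphere_measure"
  then have [measurable]: "A \<in> sets borel" "B \<in> sets borel" by auto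
  have m: "(\<lambda>x::'a. (norm x, sgn x)) \<in> restrict_space lborel (ball 0 R - {0}) \<rightarrow>\<^sub>M borel \<Otimes>\<^sub>M borel"
    by (rule measurable_restrict_space1) simp
  have "emeasure ?P (A \<times> B) = emeasure lborel (((\<lambda>x. (norm x, sgn x)) -` (A \<times> B)) \<inter> (ball 0 R - {0}))"
    by (subst emeasure_distr[OF m]) (auto simp: space_restrict_space emeasure_restrict_space)
  also have "((\<lambda>x. (norm x, sgn x)) -` (A \<times> B)) \<inter> (ball 0 R - {0}) = {x. x \<noteq> 0 \<and> norm x < R \<and> norm x \<in> A \<and> sgn x \<in> B}"
    by (auto simp: dist_norm)
  finally show "emeasure ?D A * emeasure sphere_measure B = emeasure ?P (A \<times> B)"
    using polar_emeasure[of B A R] R by simp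
qed

lemma pair_sigma_finite_lborel_sphere: "pair_sigma_finite (lborel :: real measure) (sphere_measure :: 'a::euclidean_space measure)"
proof -
  interpret S: finite_measure "sphere_measure :: 'a measure" by (rule finite_measure_sphere_measure)
  show ?thesis ..
qed

lemma polar_density_eq:
  assumes R: "R > 0"
  shows "density (lborel \<Otimes>\<^sub>M (sphere_measure :: 'a::euclidean_space measure))
      (\<lambda>(t, \<omega>). ennreal (t ^ (DIM('a) - 1) * indicator {0<..<R} t))
    = distr (restrict_space lborel (ball 0 R - {0})) (borel \<Otimes>\<^sub>M borel) (\<lambda>x. (norm x, sgn x))"
proof -
  interpret S: finite_measure "sphere_measure :: 'a measure" by (rule finite_measure_sphere_measure)
  have "density lborel (\<lambda>t. ennreal (t ^ (DIM('a) - 1)) * indicator {0<..<R} t) \<Otimes>\<^sub>M density (sphere_measure :: 'a measure) (\<lambda>_. 1)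
      = density (lborel \<Otimes>\<^sub>M (sphere_measure :: 'a measure)) (\<lambda>(t, \<omega>). ennreal (t ^ (DIM('a) - 1)) * indicator {0<..<R} t * 1)"
    by (rule pair_measure_density) (auto simp: density_1 S.sigma_finite_measure_axioms)
  moreover have "(\<lambda>(t, \<omega>::'a). ennreal (t ^ (DIM('a) - 1)) * indicator {0<..<R} t * 1) =
      (\<lambda>(t, \<omega>). ennreal (t ^ (DIM('a) - 1) * indicator {0<..<R} t))"
    by (auto simp: indicator_def)
  ultimately show ?thesis using polar_measure_eq[OF R, where 'a='a] by (simp add: density_1)
qed

lemma AE_pair_norm_1:
  "AE z in (lborel :: real measure) \<Otimes>\<^sub>M (sphere_measure :: 'a::euclidean_space measure). norm (snd z) = 1"
proof -
  interpret pair_sigma_finite "lborel :: real measure" "sphere_measure :: 'a measure"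
    by (rule pair_sigma_finite_lborel_sphere)
  show ?thesis
  proof (rule AE_pair_measure)
    show "{z \<in> space ((lborel :: real measure) \<Otimes>\<^sub>M (sphere_measure :: 'a measure)). norm (snd z) = 1} \<in> sets (lborel \<Otimes>\<^sub>M sphere_measure)"
      by measurable
    show "AE t in lborel. AE \<omega> in (sphere_measure :: 'a measure). norm (snd (t, \<omega>)) = 1"
      by (rule AE_I2) (simp add: AE_sphere_measure_norm)
  qed
qed

lemma in_annulus_polar: "norm \<omega> = 1 \<Longrightarrow> 0 < r \<Longrightarrow> 0 < t \<Longrightarrow> t *\<^sub>R \<omega> \<in> annulus r R \<longleftrightarrow> r < t \<and> t < R"
  by (auto simp: annulus_def dist_norm)

lemma annulus_borel [measurable]: "annulus r R \<in> sets borel"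
  unfolding annulus_def by simp

lemma polar_nn_integral_pair:
  fixes f :: "'a::euclidean_space \<Rightarrow> ennreal"
  assumes f[measurable]: "f \<in> borel_measurable borel" and r: "0 < r" "r < R"
  shows "(\<integral>\<^sup>+x. f x * indicator (annulus r R) x \<partial>lborel) =
    (\<integral>\<^sup>+z. ennreal (indicator {r<..<R} (fst z) * fst z ^ (DIM('a) - 1)) * f (fst z *\<^sub>R snd z) \<partial>(lborel \<Otimes>\<^sub>M sphere_measure))"
proof -
  have m: "(\<lambda>x::'a. (norm x, sgn x)) \<in> restrict_space lborel (ball 0 R - {0}) \<rightarrow>\<^sub>M borel \<Otimes>\<^sub>M borel"
    by (rule measurable_restrict_space1) simp
  let ?g = "\<lambda>z::real \<times> 'a. f (fst z *\<^sub>R snd z) * indicator (annulus r R) (fst z *\<^sub>R snd z)"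
  have eq: "norm x *\<^sub>R sgn x = x" for x :: 'a by (cases "x = 0") (simp_all add: sgn_div_norm)
  have "(\<integral>\<^sup>+x. f x * indicator (annulus r R) x \<partial>lborel)
      = (\<integral>\<^sup>+x. f x * indicator (annulus r R) x * indicator (ball 0 R - {0}) x \<partial>lborel)"
    using r by (intro nn_integral_cong) (auto simp: indicator_def annulus_def)
  also have "\<dots> = (\<integral>\<^sup>+x. ?g (norm x, sgn x) \<partial>restrict_space lborel (ball 0 R - {0}))"
    by (subst nn_integral_restrict_space) (auto simp: eq)
  also have "\<dots> = (\<integral>\<^sup>+z. ?g z \<partial>distr (restrict_space lborel (ball 0 R - {0})) (borel \<Otimes>\<^sub>M borel) (\<lambda>x. (norm x, sgn x)))"
    by (subst nn_integral_distr[OF m]) simp_all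
  also have "\<dots> = (\<integral>\<^sup>+z. ?g z \<partial>density (lborel \<Otimes>\<^sub>M (sphere_measure :: 'a measure))
      (\<lambda>(t, \<omega>). ennreal (t ^ (DIM('a) - 1) * indicator {0<..<R} t)))"
    by (simp only: polar_density_eq[OF order.strict_trans[OF r]])
  also have "\<dots> = (\<integral>\<^sup>+z. ennreal (indicator {r<..<R} (fst z) * fst z ^ (DIM('a) - 1)) * f (fst z *\<^sub>R snd z) \<partial>(lborel \<Otimes>\<^sub>M sphere_measure))"
    unfolding split_beta'
  proof (subst nn_integral_density)
    show "(\<integral>\<^sup>+ x. ennreal (fst x ^ (DIM('a) - 1) * indicator {0<..<R} (fst x)) * ?g x \<partial>(lborel \<Otimes>\<^sub>M sphere_measure)) =
      (\<integral>\<^sup>+z. ennreal (indicator {r<..<R} (fst z) * fst z ^ (DIM('a) - 1)) * f (fst z *\<^sub>R snd z) \<partial>(lborel \<Otimes>\<^sub>M sphere_measure))"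
    proof (rule nn_integral_cong_AE)
      show "AE z in lborel \<Otimes>\<^sub>M (sphere_measure :: 'a measure).
          ennreal (fst z ^ (DIM('a) - 1) * indicator {0<..<R} (fst z)) * ?g z
        = ennreal (indicator {r<..<R} (fst z) * fst z ^ (DIM('a) - 1)) * f (fst z *\<^sub>R snd z)"
        using AE_pair_norm_1
      proof eventually_elim
        case (elim z)
        then show ?case using r by (cases "0 < fst z") (auto simp: indicator_def in_annulus_polar)
      qed
    qed
  qed measurable
  finally show ?thesis .
qed

lemma polar_nn_integral:
  fixes f :: "'a::euclidean_space \<Rightarrow> ennreal"
  assumes f[measurable]: "f \<in> borel_measurable borel" and r: "0 < r" "r < R"
  shows "(\<integral>\<^sup>+x. f x * indicator (annulus r R) x \<partial>lborel) =
    (\<integral>\<^sup>+\<omega>. (\<integral>\<^sup>+t. ennreal (indicator {r<..<R} t * t ^ (DIM('a) - 1)) * f (t *\<^sub>R \<omega>) \<partial>lborel) \<partial>sphere_measure)"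
proof -
  interpret pair_sigma_finite "lborel :: real measure" "sphere_measure :: 'a measure"
    by (rule pair_sigma_finite_lborel_sphere)
  show ?thesis
    unfolding polar_nn_integral_pair[OF f r]
    by (subst nn_integral_snd[symmetric]) (simp_all add: split_beta')
qed

lemma polar_AE_iff:
  fixes P :: "'a::euclidean_space \<Rightarrow> bool"
  assumes P[measurable]: "Measurable.pred borel P" and r: "0 < r" "r < R"
  shows "(AE x in lborel. x \<in> annulus r R \<longrightarrow> P x) \<longleftrightarrow>
    (AE \<omega> in sphere_measure. AE t in lborel. r < t \<and> t < R \<longrightarrow> P (t *\<^sub>R \<omega>))"
proof -
  let ?f = "\<lambda>x::'a. indicator {x. \<not> P x} x :: ennreal"
  have "(AE x in lborel. x \<in> annulus r R \<longrightarrow> P x) \<longleftrightarrow> (AE x in lborel. ?f x * indicator (annulus r R) x = 0)"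
    by (intro AE_cong) (auto simp: indicator_def)
  also have "\<dots> \<longleftrightarrow> (\<integral>\<^sup>+x. ?f x * indicator (annulus r R) x \<partial>lborel) = 0"
    by (subst nn_integral_0_iff_AE) auto
  also have "\<dots> \<longleftrightarrow> (AE \<omega> in sphere_measure. (\<integral>\<^sup>+t. ennreal (indicator {r<..<R} t * t ^ (DIM('a) - 1)) * ?f (t *\<^sub>R \<omega>) \<partial>lborel) = 0)"
    by (subst polar_nn_integral[OF _ r], simp, subst nn_integral_0_iff_AE) (simp_all add: measurable_If)
  also have "\<dots> \<longleftrightarrow> (AE \<omega> in sphere_measure. AE t in lborel. ennreal (indicator {r<..<R} t * t ^ (DIM('a) - 1)) * ?f (t *\<^sub>R \<omega>) = 0)"
    by (intro AE_cong, subst nn_integral_0_iff_AE) simp_all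
  also have "\<dots> \<longleftrightarrow> (AE \<omega> in sphere_measure. AE t in lborel. r < t \<and> t < R \<longrightarrow> P (t *\<^sub>R \<omega>))"
  proof (intro AE_cong)
    fix \<omega> :: 'a and t :: real
    have "r < t \<Longrightarrow> 0 < t ^ (DIM('a) - 1)" using r by simp
    then show "(ennreal (indicator {r<..<R} t * t ^ (DIM('a) - 1)) * ?f (t *\<^sub>R \<omega>) = 0) = (r < t \<and> t < R \<longrightarrow> P (t *\<^sub>R \<omega>))"
      by (auto simp: indicator_def ennreal_eq_0_iff not_le)
  qed
  finally show ?thesis .
qed

text \<open>
  For the forward direction \<open>P\<close> may be replaced by the complement of a Borel null set.
\<close>

lemma polar_AE:
  fixes P :: "'a::euclidean_space \<Rightarrow> bool"
  assumes P: "AE x in lborel. x \<in> annulus r R \<longrightarrow> P x" and r: "0 < r" "r < R"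
  shows "AE \<omega> in sphere_measure. AE t in lborel. r < t \<and> t < R \<longrightarrow> P (t *\<^sub>R \<omega>)"
proof -
  obtain N where N: "{x \<in> space lborel. \<not> (x \<in> annulus r R \<longrightarrow> P x)} \<subseteq> N" "emeasure lborel N = 0" "N \<in> sets lborel"
    using AE_E[OF P] .
  have [measurable]: "N \<in> sets borel" using N by simp
  have "AE x in lborel. x \<in> annulus r R \<longrightarrow> x \<notin> N"
    using N by (intro AE_I'[of N]) auto
  then have "AE \<omega> in sphere_measure. AE t in lborel. r < t \<and> t < R \<longrightarrow> t *\<^sub>R \<omega> \<notin> N"
    by (subst (asm) polar_AE_iff[OF _ r]) auto
  then show ?thesis
    using AE_sphere_measure_norm
  proof eventually_elim
    case (elim \<omega>)
    from elim(1) show ?case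
    proof eventually_elim
      case (elim t)
      then show ?case using N(1) r in_annulus_polar[of \<omega> r t R] \<open>norm \<omega> = 1\<close> by (auto simp: subset_eq)
    qed
  qed
qed

text \<open>
  The Bochner version of \<open>polar_nn_integral\<close>. It is stated on the product space, because the two iterated
  integrals and the separate treatment of integrability then come from Fubini's theorem there.
\<close>

lemma polar_integrable:
  fixes f :: "'a::euclidean_space \<Rightarrow> real"
  assumes f[measurable]: "f \<in> borel_measurable borel" and r: "0 < r" "r < R"
  shows "set_integrable lborel (annulus r R) f \<longleftrightarrow>
    integrable (lborel \<Otimes>\<^sub>M sphere_measure) (\<lambda>z. indicator {r<..<R} (fst z) * fst z ^ (DIM('a) - 1) * f (fst z *\<^sub>R snd z))"
    (is "_ \<longleftrightarrow> ?I")
    and polar_integral: "(LINT x:annulus r R|lborel. f x) =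
      (LINT z|(lborel \<Otimes>\<^sub>M sphere_measure). indicator {r<..<R} (fst z) * fst z ^ (DIM('a) - 1) * f (fst z *\<^sub>R snd z))"
proof -
  have m: "(\<lambda>x::'a. (norm x, sgn x)) \<in> restrict_space lborel (ball 0 R - {0}) \<rightarrow>\<^sub>M borel \<Otimes>\<^sub>M borel"
    by (rule measurable_restrict_space1) simp
  let ?g = "\<lambda>z::real \<times> 'a. indicator (annulus r R) (fst z *\<^sub>R snd z) * f (fst z *\<^sub>R snd z)"
  have eq: "norm x *\<^sub>R sgn x = x" for x :: 'a by (cases "x = 0") (simp_all add: sgn_div_norm)
  have ind: "indicator (annulus r R) x *\<^sub>R f x = indicator (ball 0 R - {0}) x *\<^sub>R ?g (norm x, sgn x)" for x
    using r by (auto simp: indicator_def annulus_def eq)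
  have pol: "AE z in lborel \<Otimes>\<^sub>M (sphere_measure :: 'a measure).
      (fst z ^ (DIM('a) - 1) * indicator {0<..<R} (fst z)) *\<^sub>R ?g z = indicator {r<..<R} (fst z) * fst z ^ (DIM('a) - 1) * f (fst z *\<^sub>R snd z)"
    using AE_pair_norm_1 by eventually_elim (use r in \<open>auto simp: indicator_def in_annulus_polar\<close>)
  have de: "density (lborel \<Otimes>\<^sub>M (sphere_measure :: 'a::euclidean_space measure))
      (\<lambda>z. ennreal (fst z ^ (DIM('a) - 1) * indicator {0<..<R} (fst z)))
    = distr (restrict_space lborel (ball 0 R - {0})) (borel \<Otimes>\<^sub>M borel) (\<lambda>x. (norm x, sgn x))"
    using polar_density_eq[of R, where 'a='a] r by (simp add: split_beta')
  have "set_integrable lborel (annulus r R) f \<longleftrightarrow> integrable (restrict_space lborel (ball 0 R - {0})) (\<lambda>x. ?g (norm x, sgn x))"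
    unfolding set_integrable_def by (subst integrable_restrict_space) (auto simp only: ind, auto)
  also have "\<dots> \<longleftrightarrow> integrable (distr (restrict_space lborel (ball 0 R - {0})) (borel \<Otimes>\<^sub>M borel) (\<lambda>x. (norm x, sgn x))) ?g"
    by (rule integrable_distr_eq[symmetric, OF m]) measurable
  also have "\<dots> \<longleftrightarrow> integrable (lborel \<Otimes>\<^sub>M (sphere_measure :: 'a measure))
     (\<lambda>z. (fst z ^ (DIM('a) - 1) * indicator {0<..<R} (fst z)) *\<^sub>R ?g z)"
    unfolding de[symmetric] by (rule integrable_density) (auto simp: indicator_def)
  also have "\<dots> \<longleftrightarrow> ?I"
    by (rule integrable_cong_AE[OF _ _ pol]) measurable
  finally show "set_integrable lborel (annulus r R) f \<longleftrightarrow> ?I" .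
  have "(LINT x:annulus r R|lborel. f x) = (LINT x|(restrict_space lborel (ball 0 R - {0})). ?g (norm x, sgn x))"
    unfolding set_lebesgue_integral_def by (subst integral_restrict_space) (auto simp only: ind, auto)
  also have "\<dots> = (LINT z|(distr (restrict_space lborel (ball 0 R - {0})) (borel \<Otimes>\<^sub>M borel) (\<lambda>x. (norm x, sgn x))). ?g z)"
    by (rule integral_distr[symmetric, OF m]) measurable
  also have "\<dots> = (LINT z|(lborel \<Otimes>\<^sub>M (sphere_measure :: 'a measure)).
     (fst z ^ (DIM('a) - 1) * indicator {0<..<R} (fst z)) *\<^sub>R ?g z)"
    unfolding de[symmetric] by (rule integral_density) (auto simp: indicator_def)
  also have "\<dots> = (LINT z|(lborel \<Otimes>\<^sub>M sphere_measure). indicator {r<..<R} (fst z) * fst z ^ (DIM('a) - 1) * f (fst z *\<^sub>R snd z))"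
    by (rule integral_cong_AE[OF _ _ pol]) measurable
  finally show "(LINT x:annulus r R|lborel. f x) =
      (LINT z|(lborel \<Otimes>\<^sub>M sphere_measure). indicator {r<..<R} (fst z) * fst z ^ (DIM('a) - 1) * f (fst z *\<^sub>R snd z))" .
qed

section \<open>Radial test functions\<close>

text \<open>
  Continuous differentiability away from the origin, together with the value \<open>d\<close> of the Euler operator
  \<open>x \<cdot> \<nabla>f = |x| \<partial>\<^sub>r f\<close>. Only this radial part of the gradient enters the final identity, and it obeys simple
  rules: it is \<open>0\<close> for functions of the direction alone (\<open>euler_C1_direction\<close>) and it satisfies the product
  rule.
\<close>

definition euler_C1 :: "('a::euclidean_space \<Rightarrow> real) \<Rightarrow> ('a \<Rightarrow> real) \<Rightarrow> bool" where
  "euler_C1 f d \<longleftrightarrow>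
    (\<exists>f'. continuous_on (- {0}) f' \<and> (\<forall>x. x \<noteq> 0 \<longrightarrow> GDERIV f x :> f' x \<and> x \<bullet> f' x = d x))"

lemma GDERIV_imp_isCont: "GDERIV f x :> D \<Longrightarrow> isCont f x"
  unfolding gderiv_def by (rule has_derivative_continuous)

lemma euler_C1_continuous: "euler_C1 f d \<Longrightarrow> continuous_on (- {0}) f"
  unfolding euler_C1_def by (intro continuous_at_imp_continuous_on) (auto intro: GDERIV_imp_isCont)

lemma euler_C1_const: "euler_C1 (\<lambda>x. c) (\<lambda>x. 0)"
  unfolding euler_C1_def by (intro exI[of _ "\<lambda>x. 0"]) (auto intro: GDERIV_const)

lemma euler_C1_mult:
  assumes f: "euler_C1 f d" and g: "euler_C1 g e"
  shows "euler_C1 (\<lambda>x. f x * g x) (\<lambda>x. f x * e x + g x * d x)"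
proof -
  obtain f' where f': "continuous_on (- {0}) f'" "\<And>x. x \<noteq> 0 \<Longrightarrow> GDERIV f x :> f' x \<and> x \<bullet> f' x = d x"
    using f unfolding euler_C1_def by blast
  obtain g' where g': "continuous_on (- {0}) g'" "\<And>x. x \<noteq> 0 \<Longrightarrow> GDERIV g x :> g' x \<and> x \<bullet> g' x = e x"
    using g unfolding euler_C1_def by blast
  show ?thesis unfolding euler_C1_def
  proof (intro exI[of _ "\<lambda>x. f x *\<^sub>R g' x + g x *\<^sub>R f' x"] conjI allI impI)
    show "continuous_on (- {0}) (\<lambda>x. f x *\<^sub>R g' x + g x *\<^sub>R f' x)"
      by (intro continuous_intros f' g' euler_C1_continuous[OF f] euler_C1_continuous[OF g])
  next
    fix x :: 'a assume x: "x \<noteq> 0"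
    show "GDERIV (\<lambda>x. f x * g x) x :> f x *\<^sub>R g' x + g x *\<^sub>R f' x"
      using f' g' x by (intro GDERIV_mult) auto
    show "x \<bullet> (f x *\<^sub>R g' x + g x *\<^sub>R f' x) = f x * e x + g x * d x"
      using f' g' x by (simp add: inner_add_right)
  qed
qed

lemma euler_C1_compose:
  assumes f: "euler_C1 f d" and s: "\<And>x. x \<noteq> 0 \<Longrightarrow> (s has_real_derivative s' (f x)) (at (f x))"
    and s': "continuous_on (f ` (- {0})) s'"
  shows "euler_C1 (\<lambda>x. s (f x)) (\<lambda>x. s' (f x) * d x)"
proof -
  obtain f' where f': "continuous_on (- {0}) f'" "\<And>x. x \<noteq> 0 \<Longrightarrow> GDERIV f x :> f' x \<and> x \<bullet> f' x = d x"
    using f unfolding euler_C1_def by blast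
  show ?thesis unfolding euler_C1_def
  proof (intro exI[of _ "\<lambda>x. s' (f x) *\<^sub>R f' x"] conjI allI impI)
    show "continuous_on (- {0}) (\<lambda>x. s' (f x) *\<^sub>R f' x)"
      by (intro continuous_intros f' continuous_on_compose2[OF s' euler_C1_continuous[OF f]]) auto
  next
    fix x :: 'a assume x: "x \<noteq> 0"
    show "GDERIV (\<lambda>x. s (f x)) x :> s' (f x) *\<^sub>R f' x"
      using f' s x by (intro GDERIV_DERIV_compose) auto
    show "x \<bullet> (s' (f x) *\<^sub>R f' x) = s' (f x) * d x"
      using f' x by simp
  qed
qed

lemma euler_C1_norm: "euler_C1 norm norm"
  unfolding euler_C1_def
proof (intro exI[of _ sgn] conjI allI impI)
  show "continuous_on (- {0}) (sgn :: 'a \<Rightarrow> 'a)" by (intro continuous_at_imp_continuous_on) (auto intro: isCont_sgn continuous_intros)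
next
  fix x :: 'a assume x: "x \<noteq> 0"
  show "GDERIV norm x :> sgn x" using x by (rule GDERIV_norm)
  show "x \<bullet> sgn x = norm x" using x by (simp add: sgn_div_norm dot_square_norm power2_eq_square)
qed

lemma euler_C1_inner: "euler_C1 (\<lambda>x. x \<bullet> i) (\<lambda>x. x \<bullet> i)"
  unfolding euler_C1_def
proof (intro exI[of _ "\<lambda>x. i"] conjI allI impI)
  fix x :: 'a
  show "GDERIV (\<lambda>x. x \<bullet> i) x :> i" unfolding gderiv_def by (auto intro!: derivative_eq_intros simp: inner_commute)
qed (auto simp: inner_commute)

lemma euler_C1_cong:
  assumes "euler_C1 f d" "\<And>x. x \<noteq> 0 \<Longrightarrow> d x = e x" shows "euler_C1 f e"
  using assms unfolding euler_C1_def by metis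

lemma euler_C1_direction: "euler_C1 (\<lambda>x. sgn x \<bullet> i) (\<lambda>x. 0)"
proof -
  have "euler_C1 (\<lambda>x. inverse (norm x)) (\<lambda>x::'a. - (inverse (norm x) ^ 2) * norm x)"
  proof (rule euler_C1_compose[OF euler_C1_norm])
    show "(inverse has_real_derivative - (inverse (norm x) ^ 2)) (at (norm x))" if "x \<noteq> 0" for x :: 'a
      using that by (auto intro!: derivative_eq_intros simp: power2_eq_square)
    show "continuous_on (norm ` (- {0::'a})) (\<lambda>y. - (inverse y ^ 2))"
      by (intro continuous_intros) auto
  qed
  from euler_C1_mult[OF this euler_C1_inner[of i]] show ?thesis
    by (simp add: sgn_div_norm) (erule euler_C1_cong, simp add: field_simps power2_eq_square)
qed

lemma euler_C1_prod:
  assumes "finite I" "\<And>i. i \<in> I \<Longrightarrow> euler_C1 (f i) (\<lambda>x. 0)"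
  shows "euler_C1 (\<lambda>x. \<Prod>i\<in>I. f i x) (\<lambda>x. 0)"
  using assms
proof (induction I rule: finite_induct)
  case empty show ?case by (simp add: euler_C1_const)
next
  case (insert i I)
  then have "euler_C1 (\<lambda>x. f i x * (\<Prod>i\<in>I. f i x)) (\<lambda>x. f i x * 0 + (\<Prod>i\<in>I. f i x) * 0)"
    by (intro euler_C1_mult) auto
  then show ?case using insert by simp
qed

lemma grad_eq: "GDERIV f x :> D \<Longrightarrow> grad f x = D"
  unfolding grad_def
proof (rule some_equality)
  fix E assume "GDERIV f x :> D" "GDERIV f x :> E"
  then have "(\<lambda>h. h \<bullet> D) = (\<lambda>h. h \<bullet> E)"
    unfolding gderiv_def by (rule has_derivative_unique)
  then show "E = D" by (metis inner_commute vector_eq_rdot)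
qed

text \<open>
  A function that vanishes off a compact set not containing \<open>0\<close> vanishes near the origin, so
  the exceptional point of \<open>euler_C1\<close> does no harm.
\<close>

lemma test_function_from_euler_C1:
  assumes f: "euler_C1 f d" and K: "compact K" "K \<subseteq> \<Omega>" "0 \<notin> K" and z: "\<And>x. x \<notin> K \<Longrightarrow> f x = 0"
  shows "f \<in> test_functions \<Omega>" and "x \<notin> K \<Longrightarrow> grad f x = 0"
    and "\<exists>f'. (\<forall>x. GDERIV f x :> f' x) \<and> (\<forall>x. grad f x = f' x) \<and> continuous_on UNIV f'"
proof -
  obtain f' where f': "continuous_on (- {0}) f'" "\<And>x. x \<noteq> 0 \<Longrightarrow> GDERIV f x :> f' x \<and> x \<bullet> f' x = d x"
    using f unfolding euler_C1_def by blast
  have cl: "closed K" using K compact_imp_closed by blast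
  have out: "GDERIV f x :> 0" if "x \<notin> K" for x
  proof -
    have "((\<lambda>x. 0) has_derivative (\<lambda>h. 0)) (at x)" by simp
    then have "(f has_derivative (\<lambda>h. 0)) (at x)"
      by (rule has_derivative_transform_within_open[of _ _ _ _ "- K"]) (use cl that z in auto)
    then show ?thesis by (simp add: gderiv_def)
  qed
  then have go: "grad f x = 0" if "x \<notin> K" for x using that grad_eq by blast
  then show "x \<notin> K \<Longrightarrow> grad f x = 0" .
  have gd: "GDERIV f x :> grad f x" for x
    using f'(2)[of x] out[of x] K(3) grad_eq[of f x] by (cases "x = 0") auto
  have "continuous_on (- {0}) (grad f)"
    by (rule continuous_on_eq[OF f'(1)]) (use f'(2) grad_eq in force)
  moreover have "continuous_on (- K) (grad f)"
    by (rule continuous_on_eq[OF continuous_on_const[of _ 0]]) (auto simp: go)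
  ultimately have "continuous_on (- {0} \<union> - K) (grad f)"
    using cl by (intro continuous_on_open_Un) auto
  moreover have "- {0} \<union> - K = UNIV" using K by auto
  ultimately have cg: "continuous_on UNIV (grad f)" by simp
  then show "\<exists>f'. (\<forall>x. GDERIV f x :> f' x) \<and> (\<forall>x. grad f x = f' x) \<and> continuous_on UNIV f'"
    using gd by blast
  have sub: "closure {x. f x \<noteq> 0} \<subseteq> K"
    using z cl by (intro closure_minimal) auto
  have "compact (closure {x. f x \<noteq> 0})"
  proof -
    have "K \<inter> closure {x. f x \<noteq> 0} = closure {x. f x \<noteq> 0}" using sub by (rule Int_absorb1)
    then show ?thesis using compact_Int_closed[OF K(1) closed_closure[of "{x. f x \<noteq> 0}"]] by simp
  qed
  then show "f \<in> test_functions \<Omega>" unfolding test_functions_def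
    using cg sub K gd by (auto simp: gderiv_def differentiable_def)
qed

lemma set_integrable_product_compact_support:
  fixes u k :: "'a::euclidean_space \<Rightarrow> real"
  assumes u: "u absolutely_integrable_on K" and K: "compact K" "K \<subseteq> \<Omega>" and k: "continuous_on K k"
    and z: "\<And>x. x \<in> \<Omega> - K \<Longrightarrow> k x = 0"
  shows "set_integrable lebesgue \<Omega> (\<lambda>x. k x * u x)"
proof -
  have "(\<lambda>x. k x * u x) absolutely_integrable_on K"
  proof (rule absolutely_integrable_bounded_measurable_product[OF bilinear_times])
    show "k \<in> borel_measurable (lebesgue_on K)"
      using k K by (intro continuous_imp_measurable_on_sets_lebesgue) (auto intro: compact_imp_closed lmeasurable_compact fmeasurableD)
    show "bounded (k ` K)" using k K compact_continuous_image compact_imp_bounded by blast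
    show "K \<in> sets lebesgue" using K by (auto intro: lmeasurable_compact fmeasurableD)
  qed (use u in auto)
  moreover have "indicator \<Omega> x *\<^sub>R (k x * u x) = indicator K x *\<^sub>R (k x * u x)" for x
    using z[of x] K by (auto simp: indicator_def)
  ultimately show ?thesis unfolding set_integrable_def by presburger
qed

lemma set_integrable_from_components:
  fixes f :: "'c \<Rightarrow> 'a::euclidean_space"
  assumes "\<And>k. set_integrable N A (\<lambda>x. f x \<bullet> k)"
  shows "set_integrable N A f"
proof -
  have "integrable N (\<lambda>x. \<Sum>k\<in>Basis. (indicator A x *\<^sub>R (f x \<bullet> k)) *\<^sub>R k)"
    using assms unfolding set_integrable_def
    by (intro Bochner_Integration.integrable_sum integrable_scaleR_left) auto
  moreover have "(\<Sum>k\<in>Basis. (indicator A x *\<^sub>R (f x \<bullet> k)) *\<^sub>R k) = indicator A x *\<^sub>R f x" for x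
    by (rule euclidean_eqI) (simp add: inner_sum_left inner_Basis if_distrib cong: if_cong)
  ultimately show ?thesis unfolding set_integrable_def by simp
qed

lemma sum_inner_Basis: "(\<Sum>j\<in>Basis. (x \<bullet> j) * (y \<bullet> j)) = x \<bullet> (y::'a::euclidean_space)"
  by (simp add: euclidean_inner[of x y])

text \<open>
  Apply the definition of the weak gradient to each component of the vector field \<open>\<psi>(x) x / |x|\<^sup>n\<close> and add up.
  As \<open>x / |x|\<^sup>n\<close> is divergence free away from \<open>0\<close>, the divergence of the field is
  \<open>(x \<cdot> \<nabla>\<psi>) / |x|\<^sup>n\<close>: tangential derivatives disappear, and in polar coordinates the factor \<open>|x|\<^sup>-\<^sup>n\<close> cancels the
  Jacobian up to one power of \<open>|x|\<close>.
\<close>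

lemma weak_radial_identity:
  fixes u :: "'a::euclidean_space \<Rightarrow> real"
  assumes wg: "has_weak_gradient_on u g \<Omega>" and \<psi>: "euler_C1 \<psi> d"
    and K: "compact K" "K \<subseteq> \<Omega>" "0 \<notin> K" and z: "\<And>x. x \<notin> K \<Longrightarrow> \<psi> x = 0"
  shows "(LINT x:\<Omega>|lebesgue. d x / norm x ^ DIM('a) * u x) =
    - (LINT x:\<Omega>|lebesgue. \<psi> x / norm x ^ DIM('a) * (x \<bullet> g x))"
proof -
  let ?n = "DIM('a)"
  define s where "s y = inverse (y ^ ?n)" for y :: real
  define s' where "s' y = - real ?n * inverse (y ^ (?n + 1))" for y :: real
  have ds: "(s has_real_derivative s' y) (at y)" if "y > 0" for y
  proof -
    obtain k where k: "?n = Suc k" using DIM_positive[where 'a='a] gr0_implies_Suc by blast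
    have "((\<lambda>y. y ^ Suc k) has_real_derivative real (Suc k) * y ^ k) (at y)"
      using DERIV_pow[of "Suc k" y] by simp
    from DERIV_inverse_fun[OF this] 
    have "((\<lambda>y. inverse (y ^ Suc k)) has_real_derivative - (real (Suc k) * y ^ k * inverse ((y ^ Suc k) ^ Suc (Suc 0)))) (at y)"
      using that by simp
    moreover have "- (real (Suc k) * y ^ k * inverse ((y ^ Suc k) ^ Suc (Suc 0))) = - real (Suc k) * inverse (y ^ (Suc k + 1))"
      using that by (simp add: field_simps)
    ultimately show ?thesis unfolding s_def s'_def k by simp
  qed
  have cs': "continuous_on (norm ` (- {0::'a})) s'" unfolding s'_def
    by (intro continuous_intros) auto
  have es: "euler_C1 (\<lambda>x::'a. s (norm x)) (\<lambda>x. s' (norm x) * norm x)"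
    by (rule euler_C1_compose[OF euler_C1_norm _ cs']) (auto intro: ds)
  define w where "w j x = (x \<bullet> j) * s (norm x)" for j x :: 'a
  have ew: "euler_C1 (w j) (\<lambda>x. (x \<bullet> j) * (s' (norm x) * norm x) + s (norm x) * (x \<bullet> j))" for j
    unfolding w_def by (rule euler_C1_mult[OF euler_C1_inner es])
  define \<phi> where "\<phi> j x = \<psi> x * w j x" for j x
  have e\<phi>: "\<exists>e. euler_C1 (\<phi> j) e" for j unfolding \<phi>_def using euler_C1_mult[OF \<psi> ew] by blast
  have z\<phi>: "\<phi> j x = 0" if "x \<notin> K" for j x using z that by (simp add: \<phi>_def)
  have test: "\<phi> j \<in> test_functions \<Omega>" and gout: "x \<notin> K \<Longrightarrow> grad (\<phi> j) x = 0" 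
    and gd: "GDERIV (\<phi> j) x :> grad (\<phi> j) x" and gc: "continuous_on UNIV (grad (\<phi> j))" for j x
  proof -
    obtain e where e: "euler_C1 (\<phi> j) e" using e\<phi> by blast
    note T = test_function_from_euler_C1[OF e K z\<phi>]
    show "\<phi> j \<in> test_functions \<Omega>" by (rule T(1))
    show "x \<notin> K \<Longrightarrow> grad (\<phi> j) x = 0" by (rule T(2))
    show "GDERIV (\<phi> j) x :> grad (\<phi> j) x" using T(3) by metis
    show "continuous_on UNIV (grad (\<phi> j))" using T(1) by (simp add: test_functions_def)
  qed
  have uK: "u absolutely_integrable_on K" and gK: "g absolutely_integrable_on K"
    using wg K unfolding has_weak_gradient_on_def locally_integrable_on_def by auto
  have gKj: "(\<lambda>x. g x \<bullet> j) absolutely_integrable_on K" for j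
    using gK by (rule absolutely_integrable_component)
  have c\<phi>: "continuous_on K (\<phi> j)" for j
    by (intro continuous_at_imp_continuous_on ballI GDERIV_imp_isCont[OF gd])
  have iu: "set_integrable lebesgue \<Omega> (\<lambda>x. (grad (\<phi> j) x \<bullet> k) * u x)" for j k
    by (intro set_integrable_product_compact_support[OF uK K(1,2)] continuous_intros
         continuous_on_subset[OF gc]) (auto simp: gout)
  have ig: "set_integrable lebesgue \<Omega> (\<lambda>x. \<phi> j x * (g x \<bullet> k))" for j k
    by (intro set_integrable_product_compact_support[OF gKj K(1,2)] c\<phi>) (auto simp: z\<phi>)
  have comp: "(LINT x:\<Omega>|lebesgue. (grad (\<phi> j) x \<bullet> j) * u x) = - (LINT x:\<Omega>|lebesgue. \<phi> j x * (g x \<bullet> j))"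
    if j: "j \<in> Basis" for j
  proof -
    have I1: "set_integrable lebesgue \<Omega> (\<lambda>x. u x *\<^sub>R grad (\<phi> j) x)"
      by (rule set_integrable_from_components) (use iu[of j] in \<open>simp add: mult.commute\<close>)
    have I2: "set_integrable lebesgue \<Omega> (\<lambda>x. \<phi> j x *\<^sub>R g x)"
      by (rule set_integrable_from_components) (use ig[of j] in simp)
    have "(LINT x:\<Omega>|lebesgue. u x *\<^sub>R grad (\<phi> j) x) \<bullet> j = - (LINT x:\<Omega>|lebesgue. \<phi> j x *\<^sub>R g x) \<bullet> j"
      using wg test[of j] unfolding has_weak_gradient_on_def by simp
    moreover have "(LINT x:\<Omega>|lebesgue. u x *\<^sub>R grad (\<phi> j) x) \<bullet> j = (LINT x:\<Omega>|lebesgue. (grad (\<phi> j) x \<bullet> j) * u x)"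
      using I1 unfolding set_lebesgue_integral_def set_integrable_def
      by (subst integral_inner_left[symmetric]) (auto simp: mult_ac)
    moreover have "(LINT x:\<Omega>|lebesgue. \<phi> j x *\<^sub>R g x) \<bullet> j = (LINT x:\<Omega>|lebesgue. \<phi> j x * (g x \<bullet> j))"
      using I2 unfolding set_lebesgue_integral_def set_integrable_def
      by (subst integral_inner_left[symmetric]) (auto simp: mult_ac)
    ultimately show ?thesis by simp
  qed
  obtain f' where F': "\<And>x. x \<noteq> 0 \<Longrightarrow> GDERIV \<psi> x :> f' x \<and> x \<bullet> f' x = d x"
    using \<psi> unfolding euler_C1_def by blast
  have K0: "d x = 0" if "x \<notin> K" "x \<noteq> 0" for x
  proof -
    have f': "GDERIV \<psi> x :> f' x" "x \<bullet> f' x = d x"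
      using F' that by auto
    have "grad \<psi> x = 0" using test_function_from_euler_C1(2)[OF \<psi> K z] that by blast
    then show ?thesis using grad_eq[OF f'(1)] f'(2) by simp
  qed
  \<comment> \<open>The divergence of \<open>\<psi>(x) x / |x|\<^sup>n\<close>.\<close>
  have div: "(\<Sum>j\<in>Basis. grad (\<phi> j) x \<bullet> j) = d x / norm x ^ ?n" if "x \<noteq> 0" for x
  proof -
    have f': "GDERIV \<psi> x :> f' x" "x \<bullet> f' x = d x"
      using F' that by auto
    have gw: "GDERIV (w j) x :> (x \<bullet> j) *\<^sub>R (s' (norm x) *\<^sub>R sgn x) + s (norm x) *\<^sub>R j" for j
      unfolding w_def
    proof (rule GDERIV_mult)
      show "GDERIV (\<lambda>x. x \<bullet> j) x :> j" unfolding gderiv_def by (auto intro!: derivative_eq_intros simp: inner_commute)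
      show "GDERIV (\<lambda>x. s (norm x)) x :> s' (norm x) *\<^sub>R sgn x"
        using that by (intro GDERIV_DERIV_compose GDERIV_norm ds) auto
    qed
    have "grad (\<phi> j) x = \<psi> x *\<^sub>R ((x \<bullet> j) *\<^sub>R (s' (norm x) *\<^sub>R sgn x) + s (norm x) *\<^sub>R j) + w j x *\<^sub>R f' x" for j
      unfolding \<phi>_def by (intro grad_eq GDERIV_mult f'(1) gw)
    then have "(\<Sum>j\<in>Basis. grad (\<phi> j) x \<bullet> j) = (\<Sum>j\<in>Basis. \<psi> x * s' (norm x) * ((x \<bullet> j) * (sgn x \<bullet> j))
        + \<psi> x * s (norm x) * (j \<bullet> j) + s (norm x) * ((x \<bullet> j) * (f' x \<bullet> j)))"
      by (intro sum.cong refl) (simp add: inner_add_left algebra_simps w_def)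
    also have "\<dots> = \<psi> x * s' (norm x) * (x \<bullet> sgn x) + \<psi> x * s (norm x) * real ?n + s (norm x) * (x \<bullet> f' x)"
      by (simp add: sum.distrib sum_distrib_left[symmetric] sum_inner_Basis)
    also have "\<psi> x * s' (norm x) * (x \<bullet> sgn x) + \<psi> x * s (norm x) * real ?n = 0"
      using that by (simp add: s_def s'_def sgn_div_norm dot_square_norm power2_eq_square field_simps)
    finally show ?thesis by (simp add: f' s_def divide_inverse mult.commute)
  qed
  have "(LINT x:\<Omega>|lebesgue. d x / norm x ^ ?n * u x) = (LINT x:\<Omega>|lebesgue. \<Sum>j\<in>Basis. (grad (\<phi> j) x \<bullet> j) * u x)"
    unfolding set_lebesgue_integral_def
  proof (rule Bochner_Integration.integral_cong[OF refl])
    fix x :: 'a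
    show "indicat_real \<Omega> x *\<^sub>R (d x / norm x ^ ?n * u x) = indicat_real \<Omega> x *\<^sub>R (\<Sum>j\<in>Basis. (grad (\<phi> j) x \<bullet> j) * u x)"
      using div[of x] gout[of 0] K(3) by (cases "x = 0") (auto simp: sum_distrib_right[symmetric])
  qed
  also have "\<dots> = (\<Sum>j\<in>Basis. (LINT x:\<Omega>|lebesgue. (grad (\<phi> j) x \<bullet> j) * u x))"
    using iu unfolding set_lebesgue_integral_def set_integrable_def scaleR_sum_right
    by (intro Bochner_Integration.integral_sum)
  also have "\<dots> = - (\<Sum>j\<in>Basis. (LINT x:\<Omega>|lebesgue. \<phi> j x * (g x \<bullet> j)))"
    by (simp add: comp sum_negf)
  also have "(\<Sum>j\<in>Basis. (LINT x:\<Omega>|lebesgue. \<phi> j x * (g x \<bullet> j))) = (LINT x:\<Omega>|lebesgue. \<Sum>j\<in>Basis. \<phi> j x * (g x \<bullet> j))"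
    using ig unfolding set_lebesgue_integral_def set_integrable_def scaleR_sum_right
    by (intro Bochner_Integration.integral_sum[symmetric])
  also have "(\<lambda>x. \<Sum>j\<in>Basis. \<phi> j x * (g x \<bullet> j)) = (\<lambda>x. \<psi> x / norm x ^ ?n * (x \<bullet> g x))"
  proof
    fix x
    have "(\<Sum>j\<in>Basis. \<phi> j x * (g x \<bullet> j)) = (\<Sum>j\<in>Basis. \<psi> x * s (norm x) * ((x \<bullet> j) * (g x \<bullet> j)))"
      by (intro sum.cong refl) (simp add: \<phi>_def w_def)
    also have "\<dots> = \<psi> x * s (norm x) * (x \<bullet> g x)"
      by (simp only: sum_distrib_left[symmetric] sum_inner_Basis)
    finally show "(\<Sum>j\<in>Basis. \<phi> j x * (g x \<bullet> j)) = \<psi> x / norm x ^ ?n * (x \<bullet> g x)"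
      by (simp add: s_def divide_inverse)
  qed
  finally show ?thesis .
qed

section \<open>Functions determined by their integrals over boxes\<close>

text \<open>
  Boxes form a generator of the Borel sets that is stable under intersection, so the integral of \<open>f\<close> vanishes
  over every Borel set.
\<close>

lemma AE_zero_from_boxes:
  fixes f :: "'b::euclidean_space \<Rightarrow> real"
  assumes sets: "sets N = sets borel" and f: "integrable N f"
    and box: "\<And>a b. (LINT x:box a b|N. f x) = 0"
  shows "AE x in N. f x = 0"
proof -
  have sp: "space N = UNIV" using sets_eq_imp_space_eq[OF sets] by simp
  have si: "set_integrable N A f" if "A \<in> sets borel" for A
    unfolding set_integrable_def using f that sets by (intro integrable_mult_indicator) auto
  have U: "(LINT x:UNIV|N. f x) = 0"
  proof -
    define B where "B k = box (\<Sum>i\<in>Basis. - real k *\<^sub>R i) (\<Sum>i\<in>Basis. real k *\<^sub>R (i::'b))" for k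
    have inc: "incseq B"
    proof (rule incseq_SucI)
      show "B k \<le> B (Suc k)" for k unfolding B_def by (rule subset_box_imp) (simp add: inner_sum_left inner_Basis if_distrib cong: if_cong)
    qed
    have un: "(\<Union>k. B k) = UNIV"
    proof -
      have "x \<in> (\<Union>k. B k)" for x :: 'b
      proof -
        obtain k :: nat where k: "norm x < real k" using reals_Archimedean2 by blast
        have "\<bar>x \<bullet> i\<bar> < real k" if "i \<in> Basis" for i
          using Basis_le_norm[OF that, of x] k by linarith
        then have "x \<in> B k" unfolding B_def mem_box
          by (auto simp: inner_sum_left inner_Basis if_distrib abs_less_iff cong: if_cong) (smt (verit) )+
        then show ?thesis by blast
      qed
      then show ?thesis by blast
    qed
    have "(\<lambda>k. LINT x:B k|N. f x) \<longlonglongrightarrow> (LINT x:(\<Union>k. B k)|N. f x)"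
      using inc by (intro set_integral_cont_up) (simp_all add: sets un si, simp add: B_def)
    then show ?thesis unfolding un by (simp add: B_def box LIMSEQ_const_iff)
  qed
  have main: "(LINT x:A|N. f x) = 0" if "A \<in> sigma_sets UNIV (range (\<lambda>(a, b). box a b))" for A
  proof (rule sigma_sets_induct_disjoint[OF _ _ that])
    show "Int_stable (range (\<lambda>(a, b). box a b :: 'b set))"
      by (auto simp: Int_stable_def box_Int_box)
  next
    fix A assume "A \<in> range (\<lambda>(a, b). box a b :: 'b set)" then show "(LINT x:A|N. f x) = 0" using box by auto
  next
    fix A :: "'b set" assume A: "A \<in> sigma_sets UNIV (range (\<lambda>(a, b). box a b))" "(LINT x:A|N. f x) = 0"
    then have [measurable]: "A \<in> sets borel" unfolding borel_eq_box by simp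
    have "(LINT x:A \<union> (UNIV - A)|N. f x) = (LINT x:A|N. f x) + (LINT x:(UNIV - A)|N. f x)"
      by (intro set_integral_Un si) auto
    then show "(LINT x:UNIV - A|N. f x) = 0" using A U by simp
  next
    fix A :: "nat \<Rightarrow> 'b set"
    assume A: "disjoint_family A" "range A \<subseteq> sigma_sets UNIV (range (\<lambda>(a, b). box a b))" "\<And>i. (LINT x:A i|N. f x) = 0"
    then have [measurable]: "A i \<in> sets borel" for i unfolding borel_eq_box by auto
    have "(LINT x:(\<Union>i. A i)|N. f x) = (\<Sum>i. (LINT x:A i|N. f x))"
      using A(1) by (intro lebesgue_integral_countable_add) (auto simp: disjoint_family_on_def sets intro!: si)
    then show "(LINT x:(\<Union>i. A i)|N. f x) = 0" by (simp add: A)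
  qed (auto simp: set_lebesgue_integral_def)
  show ?thesis
  proof (rule density_unique_real[OF f integrable_zero])
    fix A assume "A \<in> sets N"
    then show "(LINT x:A|N. f x) = (LINT x:A|N. 0)"
      using main[of A] unfolding sets borel_eq_box by (simp add: set_lebesgue_integral_def)
  qed
qed

text \<open>
  Continuously differentiable, bounded by \<open>1\<close>, zero on the negative half line, and \<open>ramp (k y)\<close> increases to
  the indicator of \<open>y > 0\<close>. Products of two ramps approximate the indicator of an interval from inside.
\<close>

definition ramp :: "real \<Rightarrow> real" where "ramp y = (max 0 y)\<^sup>2 / (1 + (max 0 y)\<^sup>2)"
definition ramp' :: "real \<Rightarrow> real" where "ramp' y = 2 * max 0 y / (1 + (max 0 y)\<^sup>2)\<^sup>2"

lemma ramp_range: "0 \<le> ramp y" "ramp y \<le> 1" and ramp_nonpos: "y \<le> 0 \<Longrightarrow> ramp y = 0"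
  by (auto simp: ramp_def divide_le_eq_1 add_pos_nonneg)

lemma max_square_derivative: "((\<lambda>y. (max 0 y)\<^sup>2) has_real_derivative 2 * max 0 y) (at (y::real))"
proof -
  consider "y < 0" | "y = 0" | "y > 0" by linarith
  then show ?thesis
  proof cases
    case 1
    have "((\<lambda>y. (max 0 y)\<^sup>2) has_real_derivative 0) (at y)"
    proof (rule has_field_derivative_transform_within_open[of "\<lambda>_. 0" _ _ "{..<0}"])
    qed (use 1 in auto)
    then show ?thesis using 1 by simp
  next
    case 2
    have "((\<lambda>h. ((max 0 h)\<^sup>2 - 0) / (h - 0)) \<longlongrightarrow> 0) (at (0::real))"
    proof (rule Lim_null_comparison)
      show "eventually (\<lambda>h. norm (((max 0 h)\<^sup>2 - 0) / (h - 0)) \<le> \<bar>h\<bar>) (at (0::real))"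
        by (intro eventuallyI) (auto simp: max_def power2_eq_square)
      show "((\<lambda>h. \<bar>h\<bar>) \<longlongrightarrow> 0) (at (0::real))" by (rule tendsto_rabs_zero) (rule tendsto_ident_at)
    qed
    then show ?thesis using 2 by (simp add: has_field_derivative_iff)
  next
    case 3
    have "((\<lambda>y. (max 0 y)\<^sup>2) has_real_derivative 2 * y) (at y)"
    proof (rule has_field_derivative_transform_within_open[of "\<lambda>y. y\<^sup>2" _ _ "{0<..}"])
      show "((\<lambda>y. y\<^sup>2) has_real_derivative 2 * y) (at y)" by (auto intro!: derivative_eq_intros)
    qed (use 3 in auto)
    then show ?thesis using 3 by simp
  qed
qed

lemma ramp_has_derivative: "(ramp has_real_derivative ramp' y) (at y)"
proof -
  have pos: "1 + (max 0 y)\<^sup>2 \<noteq> 0" by (smt (verit) zero_le_power2)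
  have "((\<lambda>y. (max 0 y)\<^sup>2 / (1 + (max 0 y)\<^sup>2)) has_real_derivative
     ((2 * max 0 y) * (1 + (max 0 y)\<^sup>2) - (max 0 y)\<^sup>2 * (0 + 2 * max 0 y)) / ((1 + (max 0 y)\<^sup>2) * (1 + (max 0 y)\<^sup>2))) (at y)"
    by (intro DERIV_divide DERIV_add DERIV_const max_square_derivative pos)
  then show ?thesis unfolding ramp_def[abs_def] ramp'_def by (simp add: algebra_simps power2_eq_square)
qed

lemma continuous_ramp': "continuous_on S ramp'"
proof -
  have "1 + (max 0 y)\<^sup>2 \<noteq> 0" for y :: real by (smt (verit) zero_le_power2)
  then show ?thesis unfolding ramp'_def[abs_def] by (intro continuous_intros) auto
qed

lemma ramp_limit:
  "(\<lambda>k. ramp (real k * y)) \<longlonglongrightarrow> indicator {0<..} y"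
proof (cases "y > 0")
  case True
  have "(\<lambda>k. ramp (real k * y)) = (\<lambda>k. 1 - inverse (1 + (real k * y)\<^sup>2))"
    using True by (auto simp: ramp_def field_simps add_pos_nonneg add_nonneg_eq_0_iff)
  moreover have "(\<lambda>k. 1 - inverse (1 + (real k * y)\<^sup>2)) \<longlonglongrightarrow> 1" using True by real_asymp
  ultimately show ?thesis using True by simp
next
  case False
  then show ?thesis by (simp add: ramp_nonpos mult_nonneg_nonpos)
qed

definition bump :: "nat \<Rightarrow> real \<Rightarrow> real \<Rightarrow> real \<Rightarrow> real" where
  "bump k l u t = ramp (real k * (t - l)) * ramp (real k * (u - t))"

definition bump' :: "nat \<Rightarrow> real \<Rightarrow> real \<Rightarrow> real \<Rightarrow> real" where
  "bump' k l u t = ramp' (real k * (t - l)) * real k * ramp (real k * (u - t)) - ramp (real k * (t - l)) * (ramp' (real k * (u - t)) * real k)"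

lemma bump_range: "0 \<le> bump k l u t" "bump k l u t \<le> 1"
  unfolding bump_def using ramp_range by (auto intro!: mult_le_one)

lemma bump_outside: "t \<notin> {l<..<u} \<Longrightarrow> bump k l u t = 0"
  unfolding bump_def by (auto simp: not_less ramp_nonpos mult_nonneg_nonpos)

lemma bump_has_derivative: "(bump k l u has_real_derivative bump' k l u t) (at t)"
  unfolding bump_def[abs_def] bump'_def
  by (auto intro!: derivative_eq_intros DERIV_chain2[OF ramp_has_derivative] simp: algebra_simps)

lemma continuous_bump: "continuous_on S (bump k l u)"
  using bump_has_derivative by (meson DERIV_continuous_on has_field_derivative_at_within)

lemma continuous_ramp: "continuous_on S ramp"
  using ramp_has_derivative by (meson DERIV_continuous_on has_field_derivative_at_within)

lemma continuous_bump': "continuous_on S (bump' k l u)"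
  unfolding bump'_def[abs_def]
  by (intro continuous_intros continuous_on_compose2[OF continuous_ramp[of UNIV]] continuous_on_compose2[OF continuous_ramp'[of UNIV]]) auto

lemma bump_limit: "(\<lambda>k. bump k l u t) \<longlonglongrightarrow> indicator {l<..<u} t"
proof -
  have "(\<lambda>k. bump k l u t) \<longlonglongrightarrow> indicator {0<..} (t - l) * indicator {0<..} (u - t)"
    unfolding bump_def by (intro tendsto_mult ramp_limit)
  also have "indicator {0<..} (t - l) * indicator {0<..} (u - t) = (indicator {l<..<u} t :: real)"
    by (auto simp: indicator_def)
  finally show ?thesis .
qed

lemma bump_pos: "l < t \<Longrightarrow> t < u \<Longrightarrow> k > 0 \<Longrightarrow> bump k l u t > 0"
  unfolding bump_def ramp_def by (auto intro!: mult_pos_pos divide_pos_pos add_pos_pos)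

section \<open>Absolute continuity along almost every ray\<close>

lemma shrinking_margin:
  fixes r R :: real
  assumes r: "r < R"
  obtains e :: "nat \<Rightarrow> real" where "\<And>k. 0 < e k" "\<And>k. 2 * e k \<le> R - r" "decseq e" "e \<longlonglongrightarrow> 0"
proof
  let ?e = "\<lambda>k::nat. (R - r) / (real k + 3)"
  show "0 < ?e k" for k using r by simp
  have "(R - r) * 2 \<le> (R - r) * (real k + 3)" for k using r by (intro mult_left_mono) auto
  then show "2 * ?e k \<le> R - r" for k by (simp add: divide_le_eq mult.commute)
  show "decseq ?e" unfolding decseq_def using r by (auto intro!: divide_left_mono)
  show "?e \<longlonglongrightarrow> 0" by real_asymp
qed

lemma compact_closed_annulus: "compact {x::'a::euclidean_space. a \<le> norm x \<and> norm x \<le> b}"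
proof (rule compact_eq_bounded_closed[THEN iffD2], intro conjI)
  show "bounded {x::'a. a \<le> norm x \<and> norm x \<le> b}" by (rule bounded_subset[of "cball 0 b"]) auto
  show "closed {x::'a. a \<le> norm x \<and> norm x \<le> b}"
    by (intro closed_Collect_conj closed_Collect_le continuous_intros)
qed

text \<open>
  The target of polar coordinates without the Jacobian: pairs \<open>(t, \<omega>)\<close> of a radius and a direction.
\<close>

abbreviation cylinder_measure :: "(real \<times> 'a::euclidean_space) measure" where
  "cylinder_measure \<equiv> lborel \<Otimes>\<^sub>M sphere_measure"

lemma sets_cylinder_measure: "sets (cylinder_measure :: (real \<times> 'a::euclidean_space) measure) = sets borel"
  unfolding borel_prod[symmetric] by (intro sets_pair_measure_cong) auto

lemma cylinder_slices:
  fixes f :: "real \<times> 'a::euclidean_space \<Rightarrow> real"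
  assumes f: "integrable cylinder_measure f"
  shows "AE \<omega> in sphere_measure. integrable lborel (\<lambda>t. f (t, \<omega>))"
    and "integrable sphere_measure (\<lambda>\<omega>. LINT t|lborel. f (t, \<omega>))"
    and "(LINT \<omega>|sphere_measure. (LINT t|lborel. f (t, \<omega>))) = (LINT z|cylinder_measure. f z)"
proof -
  interpret pair_sigma_finite "lborel :: real measure" "sphere_measure :: 'a measure"
    by (rule pair_sigma_finite_lborel_sphere)
  have f': "integrable cylinder_measure (case_prod (\<lambda>t \<omega>. f (t, \<omega>)))" using f by simp
  show "AE \<omega> in sphere_measure. integrable lborel (\<lambda>t. f (t, \<omega>))" by (rule AE_integrable_snd[OF f'])
  show "integrable sphere_measure (\<lambda>\<omega>. LINT t|lborel. f (t, \<omega>))" by (rule integrable_snd[OF f'])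
  show "(LINT \<omega>|sphere_measure. (LINT t|lborel. f (t, \<omega>))) = (LINT z|cylinder_measure. f z)"
    using integral_snd[OF f'] by simp
qed

lemma cylinder_product:
  fixes f :: "real \<Rightarrow> real" and g :: "'a::euclidean_space \<Rightarrow> real"
  assumes f: "integrable lborel f" and g: "integrable sphere_measure g"
  shows "integrable cylinder_measure (\<lambda>z. f (fst z) * g (snd z))"
    and "(LINT z|cylinder_measure. f (fst z) * g (snd z)) = (LINT t|lborel. f t) * (LINT \<omega>|sphere_measure. g \<omega>)"
proof -
  interpret pair_sigma_finite "lborel :: real measure" "sphere_measure :: 'a measure"
    by (rule pair_sigma_finite_lborel_sphere)
  have [measurable]: "f \<in> borel_measurable borel" "g \<in> borel_measurable borel"
    using f g by auto
  show I: "integrable cylinder_measure (\<lambda>z. f (fst z) * g (snd z))"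
  proof (rule Fubini_integrable)
    show "integrable lborel (\<lambda>x. LINT y|sphere_measure. norm (f (fst (x, y)) * g (snd (x, y))))"
      using f by (simp add: abs_mult)
    show "AE x in lborel. integrable sphere_measure (\<lambda>y. f (fst (x, y)) * g (snd (x, y)))"
      using g by (auto intro!: AE_I2)
  qed measurable
  show "(LINT z|cylinder_measure. f (fst z) * g (snd z)) = (LINT t|lborel. f t) * (LINT \<omega>|sphere_measure. g \<omega>)"
    by (subst cylinder_slices(3)[OF I, symmetric]) simp
qed

lemma polar_integrable_unweighted:
  fixes f :: "'a::euclidean_space \<Rightarrow> real"
  assumes [measurable]: "f \<in> borel_measurable borel" and r: "0 < r" "r < R"
    and f: "set_integrable lborel (annulus r R) f"
  shows "integrable cylinder_measure (\<lambda>z. indicator {r<..<R} (fst z) * f (fst z *\<^sub>R snd z))"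
proof (rule Bochner_Integration.integrable_bound)
  let ?n = "DIM('a)"
  show "integrable cylinder_measure (\<lambda>z. inverse (r ^ (?n - 1)) * (indicator {r<..<R} (fst z) * fst z ^ (?n - 1) * f (fst z *\<^sub>R snd z)))"
    using f polar_integrable[of f r R] r by (intro integrable_mult_right) auto
  show "AE z in cylinder_measure. norm (indicator {r<..<R} (fst z) * f (fst z *\<^sub>R snd z))
      \<le> norm (inverse (r ^ (?n - 1)) * (indicator {r<..<R} (fst z) * fst z ^ (?n - 1) * f (fst z *\<^sub>R snd z)))"
  proof (rule AE_I2)
    fix z :: "real \<times> 'a"
    have "1 \<le> inverse (r ^ (?n - 1)) * fst z ^ (?n - 1)" if "r < fst z"
      using r that power_mono[of r "fst z" "?n - 1"] by (simp add: field_simps)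
    then have "1 * \<bar>f (fst z *\<^sub>R snd z)\<bar> \<le> inverse (r ^ (?n - 1)) * fst z ^ (?n - 1) * \<bar>f (fst z *\<^sub>R snd z)\<bar>" if "r < fst z"
      using that by (intro mult_right_mono) auto
    then show "norm (indicator {r<..<R} (fst z) * f (fst z *\<^sub>R snd z))
      \<le> norm (inverse (r ^ (?n - 1)) * (indicator {r<..<R} (fst z) * fst z ^ (?n - 1) * f (fst z *\<^sub>R snd z)))"
      using r by (auto simp: indicator_def abs_mult mult.assoc)
  qed
qed measurable

lemma lborel_slice_absolutely_integrable:
  fixes h :: "real \<Rightarrow> real"
  assumes h: "integrable lborel (\<lambda>t. indicator {a<..<b} t * h t)"
  shows "h absolutely_integrable_on {a..b}"
proof -
  have "integrable lebesgue (\<lambda>t. indicator {a<..<b} t * h t)"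
    using h by (subst integrable_completion) auto
  then have "h absolutely_integrable_on {a<..<b}" by (simp add: set_integrable_def)
  then show ?thesis
    by (rule absolutely_integrable_spike_set) (rule negligible_subset[of "{a,b}"]; auto)+
qed

text \<open>
  Below \<open>a\<close> the primitive is \<open>0\<close>, also to the left of \<open>r\<close>, where the integral is over an empty interval. So it is
  differentiable on the whole line and can be composed with the norm.
\<close>

lemma antiderivative_compact_support:
  fixes \<zeta> :: "real \<Rightarrow> real"
  assumes ra: "r < a" and c: "continuous_on UNIV \<zeta>" and z: "\<And>t. t \<notin> {a..b} \<Longrightarrow> \<zeta> t = 0"
  defines "\<eta> \<equiv> \<lambda>t. integral {r..t} \<zeta>"
  shows "(\<eta> has_real_derivative \<zeta> t) (at t)"
proof (cases "t < a")
  case True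
  have "(\<eta> has_real_derivative 0) (at t)"
  proof (rule has_field_derivative_transform_within_open[of "\<lambda>_. 0" _ _ "{..<a}"])
    fix x assume "x \<in> {..<a}"
    then have "integral {r..x} \<zeta> = integral {r..x} (\<lambda>_. 0)" by (intro integral_cong) (auto intro: z)
    then show "0 = \<eta> x" by (simp add: \<eta>_def)
  qed (use True in auto)
  then show ?thesis using z[of t] True by simp
next
  case False
  have "(\<eta> has_real_derivative \<zeta> t) (at t within {r..t+1})"
    unfolding \<eta>_def using False ra by (intro integral_has_real_derivative continuous_on_subset[OF c]) auto
  then show ?thesis using False ra by (subst (asm) at_within_interior) auto
qed

text \<open>
  \<open>h\<close> is the weak radial derivative of \<open>u\<close>, expressed by the identity of \<open>weak_radial_identity\<close>. Both
  functions are Borel measurable; in the application they are modified on a null set to achieve this.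
\<close>

locale radial_weak_derivative =
  fixes r R :: real and u h :: "'a::euclidean_space \<Rightarrow> real"
  assumes r: "0 < r" "r < R"
    and u_borel [measurable]: "u \<in> borel_measurable borel"
    and h_borel [measurable]: "h \<in> borel_measurable borel"
    and u_local: "\<And>a b. r < a \<Longrightarrow> b < R \<Longrightarrow> set_integrable lborel {x. a \<le> norm x \<and> norm x \<le> b} u"
    and h_integrable: "set_integrable lborel (annulus r R) h"
    and weak: "\<And>\<psi> d a b. euler_C1 \<psi> d \<Longrightarrow> r < a \<Longrightarrow> b < R \<Longrightarrow> (\<And>x. norm x \<notin> {a..b} \<Longrightarrow> \<psi> x = 0) \<Longrightarrow>
      (LINT x:annulus r R|lborel. d x / norm x ^ DIM('a) * u x) =
      - (LINT x:annulus r R|lborel. \<psi> x / norm x ^ DIM('a) * (norm x * h x))"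
begin

text \<open>
  \<open>k\<close> is \<open>h\<close> along rays, cut off to the annulus; \<open>H\<close> is its primitive that vanishes at radius \<open>r\<close>; \<open>w\<close> is the
  part of \<open>u\<close> not explained by \<open>H\<close>, which will turn out to be constant along rays.
\<close>

definition k :: "real \<Rightarrow> 'a \<Rightarrow> real" where "k s \<omega> = (if r < s \<and> s < R then h (s *\<^sub>R \<omega>) else 0)"

definition H :: "real \<Rightarrow> 'a \<Rightarrow> real" where "H t \<omega> = (LINT s|lborel. (if s \<le> t then k s \<omega> else 0))"

definition w :: "real \<times> 'a \<Rightarrow> real" where "w z = u (fst z *\<^sub>R snd z) - H (fst z) (snd z)"

lemma k_measurable [measurable]: "(\<lambda>z. k (fst z) (snd z)) \<in> borel_measurable (borel \<Otimes>\<^sub>M borel)"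
  unfolding k_def by measurable

lemma H_measurable [measurable]: "(\<lambda>z. H (fst z) (snd z)) \<in> borel_measurable (borel \<Otimes>\<^sub>M borel)"
  unfolding H_def k_def by (rule lborel.borel_measurable_lebesgue_integral) measurable

lemma w_measurable [measurable]: "w \<in> borel_measurable (borel \<Otimes>\<^sub>M borel)"
  unfolding w_def by measurable

lemma k_integrable: "integrable cylinder_measure (\<lambda>z. k (fst z) (snd z))"
proof -
  have "(\<lambda>z. k (fst z) (snd z)) = (\<lambda>z. indicator {r<..<R} (fst z) * h (fst z *\<^sub>R snd z))"
    by (auto simp: k_def indicator_def)
  then show ?thesis using polar_integrable_unweighted[OF h_borel r h_integrable] by simp
qed

lemma ray_absolutely_integrable:
  assumes "integrable lborel (\<lambda>s. k s \<omega>)" shows "(\<lambda>s. h (s *\<^sub>R \<omega>)) absolutely_integrable_on {r..R}"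
proof (rule lborel_slice_absolutely_integrable)
  have "(\<lambda>t. indicator {r<..<R} t * h (t *\<^sub>R \<omega>)) = (\<lambda>s. k s \<omega>)" by (auto simp: k_def indicator_def)
  then show "integrable lborel (\<lambda>t. indicator {r<..<R} t * h (t *\<^sub>R \<omega>))" using assms by simp
qed

lemma H_eq:
  assumes k: "integrable lborel (\<lambda>s. k s \<omega>)" and t: "t \<in> {r..R}"
  shows "H t \<omega> = integral {r..t} (\<lambda>s. h (s *\<^sub>R \<omega>))"
proof -
  have i: "integrable lborel (\<lambda>s. if s \<le> t then k s \<omega> else 0)"
    by (rule Bochner_Integration.integrable_bound[OF k]) (use k in \<open>auto intro!: measurable_If\<close>)
  have "H t \<omega> = integral UNIV (\<lambda>s. if s \<le> t then k s \<omega> else 0)"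
    unfolding H_def using has_integral_integral_lborel[OF i] by (simp add: integral_unique)
  also have "\<dots> = integral UNIV (\<lambda>s. if s \<in> {r..t} then h (s *\<^sub>R \<omega>) else 0)"
    by (rule integral_spike[of "{r,R}"]) (use t in \<open>auto simp: k_def\<close>)
  also have "\<dots> = integral {r..t} (\<lambda>s. h (s *\<^sub>R \<omega>))" by (rule integral_restrict_UNIV)
  finally show ?thesis .
qed

definition D :: "'a \<Rightarrow> real" where "D \<omega> = (LINT s|lborel. \<bar>k s \<omega>\<bar>)"

lemma D_integrable: "integrable sphere_measure D"
  using cylinder_slices(2)[OF integrable_abs[OF k_integrable]] by (simp add: D_def[abs_def])

lemma H_bound: "integrable lborel (\<lambda>s. k s \<omega>) \<Longrightarrow> \<bar>H t \<omega>\<bar> \<le> D \<omega>"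
proof -
  assume k: "integrable lborel (\<lambda>s. k s \<omega>)"
  have i: "integrable lborel (\<lambda>s. if s \<le> t then k s \<omega> else 0)"
    by (rule Bochner_Integration.integrable_bound[OF k]) (use k in \<open>auto intro!: measurable_If\<close>)
  have "\<bar>H t \<omega>\<bar> \<le> (LINT s|lborel. \<bar>if s \<le> t then k s \<omega> else 0\<bar>)" unfolding H_def by (rule integral_abs_bound)
  also have "\<dots> \<le> D \<omega>" unfolding D_def using i k by (intro integral_mono) auto
  finally show ?thesis .
qed

lemma AE_ray: "AE \<omega> in sphere_measure. integrable lborel (\<lambda>s. k s \<omega>)"
  using cylinder_slices(1)[OF k_integrable] by simp

lemma AE_cylinder_ray: "AE z in cylinder_measure. integrable lborel (\<lambda>s. k s (snd z))"
proof -
  interpret pair_sigma_finite "lborel :: real measure" "sphere_measure :: 'a measure"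
    by (rule pair_sigma_finite_lborel_sphere)
  show ?thesis
  proof (rule AE_pair_measure)
    have "{z \<in> space (cylinder_measure :: (real \<times> 'a) measure). integrable lborel (\<lambda>s. k s (snd z))}
      = {z \<in> space cylinder_measure. (\<integral>\<^sup>+s. ennreal \<bar>k s (snd z)\<bar> \<partial>lborel) < \<infinity>}"
      unfolding k_def by (subst integrable_iff_bounded) auto
    also have "\<dots> \<in> sets cylinder_measure" unfolding k_def by measurable
    finally show "{z \<in> space (cylinder_measure :: (real \<times> 'a) measure). integrable lborel (\<lambda>s. k s (snd z))} \<in> sets cylinder_measure" .
    show "AE x in lborel. AE y in sphere_measure. integrable lborel (\<lambda>s. k s (snd (x :: real, y)))"
      by (rule AE_I2) (simp add: AE_ray)
  qed
qed

lemma cutoff_H_integrable: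
  assumes \<zeta>: "integrable lborel \<zeta>" 
  shows "integrable cylinder_measure (\<lambda>z. \<zeta> (fst z) * H (fst z) (snd z))"
proof (rule Bochner_Integration.integrable_bound[OF cylinder_product(1)[OF \<zeta> D_integrable]])
  have [measurable]: "\<zeta> \<in> borel_measurable borel" using \<zeta> by auto
  show "(\<lambda>z. \<zeta> (fst z) * H (fst z) (snd z)) \<in> borel_measurable cylinder_measure" by measurable
  show "AE z in cylinder_measure. norm (\<zeta> (fst z) * H (fst z) (snd z)) \<le> norm (\<zeta> (fst z) * D (snd z))"
    using AE_cylinder_ray
  proof eventually_elim
    case (elim z)
    have "\<bar>H (fst z) (snd z)\<bar> \<le> \<bar>D (snd z)\<bar>" using H_bound[OF elim, of "fst z"] by linarith
    then show ?case by (simp add: abs_mult mult_left_mono)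
  qed
qed

lemma cutoff_u_integrable:
  assumes ab: "r < a" "b < R"
  shows "integrable cylinder_measure (\<lambda>z. indicator {a..b} (fst z) * u (fst z *\<^sub>R snd z))"
proof -
  let ?C = "{x::'a. a \<le> norm x \<and> norm x \<le> b}"
  have [measurable]: "?C \<in> sets borel" by measurable
  have "integrable lborel (\<lambda>x. indicator ?C x *\<^sub>R u x)"
    using u_local[OF ab] by (simp add: set_integrable_def)
  then have "set_integrable lborel (annulus r R) (\<lambda>x. indicator ?C x * u x)"
    unfolding set_integrable_def by (intro integrable_mult_indicator) auto
  from polar_integrable_unweighted[OF _ r this]
  have "integrable cylinder_measure (\<lambda>z. indicator {r<..<R} (fst z) * (indicator ?C (fst z *\<^sub>R snd z) * u (fst z *\<^sub>R snd z)))"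
    by simp
  then show ?thesis
  proof (rule integrable_cong_AE_imp)
    show "AE z in cylinder_measure. indicator {r<..<R} (fst z) * (indicator ?C (fst z *\<^sub>R snd z) * u (fst z *\<^sub>R snd z)) =
       indicator {a..b} (fst z) * u (fst z *\<^sub>R snd z)"
      using AE_pair_norm_1 by eventually_elim (use r ab in \<open>auto simp: indicator_def\<close>)
  qed measurable
qed

lemma cutoff_w_integrable:
  assumes ab: "r < a" "b < R"
  shows "integrable cylinder_measure (\<lambda>z. indicator {a..b} (fst z) * w z)"
proof -
  have "integrable cylinder_measure (\<lambda>z. indicator {a..b} (fst z) * u (fst z *\<^sub>R snd z) - indicator {a..b} (fst z) * H (fst z) (snd z))"
    by (intro Bochner_Integration.integrable_diff cutoff_u_integrable ab cutoff_H_integrable integrable_real_indicator)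
       (auto simp: emeasure_lborel_Icc_eq)
  then show ?thesis by (simp add: w_def right_diff_distrib)
qed

text \<open>
  The weak identity for the test function \<open>\<eta>(|x|) X(x/|x|)\<close>, in polar coordinates. All powers of the radius
  have cancelled.
\<close>

lemma weak_polar:
  assumes ab: "r < a" "b < R" and \<eta>: "\<And>t. (\<eta> has_real_derivative \<zeta> t) (at t)" and \<zeta>: "continuous_on UNIV \<zeta>"
    and z: "\<And>t. t \<notin> {a..b} \<Longrightarrow> \<eta> t = 0" and zz: "\<And>t. t \<notin> {a..b} \<Longrightarrow> \<zeta> t = 0"
    and X: "euler_C1 (\<lambda>x. X (sgn x)) (\<lambda>x. 0)" and [measurable]: "X \<in> borel_measurable borel"
  shows "(LINT z|cylinder_measure. \<zeta> (fst z) * X (snd z) * u (fst z *\<^sub>R snd z)) =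
    - (LINT z|cylinder_measure. \<eta> (fst z) * X (snd z) * k (fst z) (snd z))"
proof -
  let ?n = "DIM('a)"
  have c\<eta>: "continuous_on UNIV \<eta>" using \<eta> by (meson DERIV_continuous_on)
  have [measurable]: "\<eta> \<in> borel_measurable borel" "\<zeta> \<in> borel_measurable borel"
    using c\<eta> \<zeta> by (auto intro: borel_measurable_continuous_onI)
  have e: "euler_C1 (\<lambda>x. X (sgn x) * \<eta> (norm x)) (\<lambda>x. X (sgn x) * (\<zeta> (norm x) * norm x) + \<eta> (norm x) * 0)"
    by (intro euler_C1_mult X euler_C1_compose[OF euler_C1_norm] \<eta> continuous_on_subset[OF \<zeta>]) auto
  have n: "t ^ ?n = t * t ^ (?n - 1)" for t :: real by (cases ?n) auto
  have sg: "sgn (t *\<^sub>R \<omega>) = \<omega>" "norm (t *\<^sub>R \<omega>) = t" if "norm \<omega> = 1" "t > 0" for t and \<omega> :: 'a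
    using that by (auto simp: sgn_div_norm)
  have "(LINT z|cylinder_measure. \<zeta> (fst z) * X (snd z) * u (fst z *\<^sub>R snd z))
    = (LINT x:annulus r R|lborel. (X (sgn x) * (\<zeta> (norm x) * norm x) + \<eta> (norm x) * 0) / norm x ^ ?n * u x)"
  proof (subst polar_integral[OF _ r], measurable, rule integral_cong_AE)
    show "AE z in cylinder_measure. \<zeta> (fst z) * X (snd z) * u (fst z *\<^sub>R snd z) =
      indicator {r<..<R} (fst z) * fst z ^ (?n - 1) * ((X (sgn (fst z *\<^sub>R snd z)) * (\<zeta> (norm (fst z *\<^sub>R snd z)) * norm (fst z *\<^sub>R snd z)) +
        \<eta> (norm (fst z *\<^sub>R snd z)) * 0) / norm (fst z *\<^sub>R snd z) ^ ?n * u (fst z *\<^sub>R snd z))"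
      using AE_pair_norm_1
    proof eventually_elim
      case (elim z)
      show ?case
      proof (cases "r < fst z \<and> fst z < R")
        case True
        then have "fst z > 0" using r by simp
        then show ?thesis unfolding sg[OF elim \<open>fst z > 0\<close>] n using True by simp
      next
        case False then show ?thesis using zz[of "fst z"] ab by auto
      qed
    qed
  qed measurable
  also have "\<dots> = - (LINT x:annulus r R|lborel. X (sgn x) * \<eta> (norm x) / norm x ^ ?n * (norm x * h x))"
    by (rule weak[OF e ab]) (use z in auto)
  also have "(LINT x:annulus r R|lborel. X (sgn x) * \<eta> (norm x) / norm x ^ ?n * (norm x * h x))
    = (LINT z|cylinder_measure. \<eta> (fst z) * X (snd z) * k (fst z) (snd z))"
  proof (subst polar_integral[OF _ r], measurable, rule integral_cong_AE)
    show "AE z in cylinder_measure. indicator {r<..<R} (fst z) * fst z ^ (?n - 1) * (X (sgn (fst z *\<^sub>R snd z)) *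
         \<eta> (norm (fst z *\<^sub>R snd z)) / norm (fst z *\<^sub>R snd z) ^ ?n * (norm (fst z *\<^sub>R snd z) * h (fst z *\<^sub>R snd z))) =
       \<eta> (fst z) * X (snd z) * k (fst z) (snd z)"
      using AE_pair_norm_1
    proof eventually_elim
      case (elim z)
      show ?case
      proof (cases "r < fst z \<and> fst z < R")
        case True
        then have "fst z > 0" using r by simp
        then show ?thesis unfolding sg[OF elim \<open>fst z > 0\<close>] n using True by (simp add: k_def)
      next
        case False then show ?thesis by (auto simp: k_def)
      qed
    qed
  qed measurable
  finally show ?thesis .
qed

lemma continuous_compact_support_integrable:
  fixes \<zeta> :: "real \<Rightarrow> real"
  assumes c: "continuous_on UNIV \<zeta>" and z: "\<And>t. t \<notin> {a..b} \<Longrightarrow> \<zeta> t = 0"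
  shows "integrable lborel \<zeta>" and "\<exists>B. \<forall>t. \<bar>\<zeta> t\<bar> \<le> B"
proof -
  have "set_integrable lborel {a..b} \<zeta>"
    by (rule borel_integrable_compact[unfolded set_integrable_def[symmetric]]) (auto intro: continuous_on_subset[OF c])
  moreover have "(\<lambda>t. indicator {a..b} t *\<^sub>R \<zeta> t) = \<zeta>" using z by (auto simp: indicator_def fun_eq_iff)
  ultimately show "integrable lborel \<zeta>" by (simp add: set_integrable_def)
  have "bounded (\<zeta> ` {a..b})"
    by (intro compact_imp_bounded compact_continuous_image continuous_on_subset[OF c]) auto
  then obtain B where B: "\<forall>t\<in>{a..b}. \<bar>\<zeta> t\<bar> \<le> B" unfolding bounded_iff by auto
  have "\<bar>\<zeta> t\<bar> \<le> max B 0" for t using B[rule_format, of t] z[of t] by (cases "t \<in> {a..b}") (auto simp: le_max_iff_disj)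
  then show "\<exists>B. \<forall>t. \<bar>\<zeta> t\<bar> \<le> B" by blast
qed

lemma cylinder_bounded_mult:
  assumes "integrable cylinder_measure f" and "g \<in> borel_measurable (borel \<Otimes>\<^sub>M borel)" and B: "\<And>z::real \<times> 'a. \<bar>g z\<bar> \<le> B"
  shows "integrable cylinder_measure (\<lambda>z. g z * f z :: real)"
proof (rule Bochner_Integration.integrable_bound[of _ "\<lambda>z. B * f z"])
  have [measurable]: "f \<in> borel_measurable cylinder_measure" "g \<in> borel_measurable cylinder_measure"
    using assms(1,2) by auto
  show "(\<lambda>z. g z * f z) \<in> borel_measurable cylinder_measure" by measurable
  show "AE z in cylinder_measure. norm (g z * f z) \<le> norm (B * f z)"
  proof (rule AE_I2)
    fix z :: "real \<times> 'a"
    have "\<bar>g z\<bar> \<le> \<bar>B\<bar>" using B[of z] by linarith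
    then show "norm (g z * f z) \<le> norm (B * f z)" by (simp add: abs_mult mult_right_mono)
  qed
qed (use assms in auto)

text \<open>
  On each ray \<open>\<zeta> H + \<eta> h\<close> is the derivative of \<open>\<eta> H\<close>, where \<open>\<eta>\<close> is the primitive of \<open>\<zeta>\<close>. The mean of \<open>\<zeta>\<close> is
  \<open>0\<close>, so \<open>\<eta>\<close> has compact support and the integral of this derivative vanishes. Hence \<open>H\<close> satisfies the same
  weak identity as \<open>u\<close>, and the difference \<open>w\<close> satisfies it with right-hand side \<open>0\<close>.
\<close>

lemma cutoff_w_orthogonal:
  assumes ab: "r < a" "a \<le> b" "b < R" and \<zeta>: "continuous_on UNIV \<zeta>"
    and zz: "\<And>t. t \<notin> {a..b} \<Longrightarrow> \<zeta> t = 0" and mean: "(LINT t|lborel. \<zeta> t) = 0"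
    and X: "euler_C1 (\<lambda>x. X (sgn x)) (\<lambda>x. 0)" and Xm[measurable]: "X \<in> borel_measurable borel" and X1: "\<And>\<omega>. \<bar>X \<omega>\<bar> \<le> 1"
  shows "(LINT z|cylinder_measure. \<zeta> (fst z) * X (snd z) * w z) = 0"
proof -
  define \<eta> where "\<eta> t = integral {r..t} \<zeta>" for t
  have d\<eta>: "(\<eta> has_real_derivative \<zeta> t) (at t)" for t
    unfolding \<eta>_def[abs_def] using antiderivative_compact_support[OF ab(1) \<zeta> zz] by blast
  have c\<eta>: "continuous_on UNIV \<eta>" using d\<eta> by (meson DERIV_continuous_on)
  have [measurable]: "\<eta> \<in> borel_measurable borel" "\<zeta> \<in> borel_measurable borel"
    using c\<eta> \<zeta> by (auto intro: borel_measurable_continuous_onI)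
  note i\<zeta> = continuous_compact_support_integrable(1)[OF \<zeta> zz]
  obtain B where B: "\<And>t. \<bar>\<zeta> t\<bar> \<le> B" using continuous_compact_support_integrable(2)[OF \<zeta> zz] by blast
  have z: "\<eta> t = 0" if t: "t \<notin> {a..b}" for t
  proof (cases "t < a")
    case True
    then have "integral {r..t} \<zeta> = integral {r..t} (\<lambda>_. 0)" by (intro integral_cong) (auto intro: zz)
    then show ?thesis by (simp add: \<eta>_def)
  next
    case False
    then have bt: "b < t" using t by auto
    have "\<eta> t = integral UNIV (\<lambda>s. if s \<in> {r..t} then \<zeta> s else 0)" unfolding \<eta>_def by (rule integral_restrict_UNIV[symmetric])
    also have "(\<lambda>s. if s \<in> {r..t} then \<zeta> s else 0) = \<zeta>" using bt ab zz by force
    also have "integral UNIV \<zeta> = (LINT t|lborel. \<zeta> t)"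
      by (rule integral_unique[OF has_integral_integral_lborel[OF i\<zeta>]])
    finally show ?thesis using mean by simp
  qed
  obtain C where C: "\<And>t. \<bar>\<eta> t\<bar> \<le> C" using continuous_compact_support_integrable(2)[OF c\<eta> z] by blast
  have Iu: "integrable cylinder_measure (\<lambda>z. (\<zeta> (fst z) * X (snd z)) * (indicator {a..b} (fst z) * u (fst z *\<^sub>R snd z)))"
  proof (rule cylinder_bounded_mult[OF cutoff_u_integrable[OF ab(1,3)]])
    show "\<bar>\<zeta> (fst z) * X (snd z)\<bar> \<le> B * 1" for z :: "real \<times> 'a"
      unfolding abs_mult using B[of "fst z"] X1[of "snd z"] by (intro mult_mono) (auto intro: order_trans[OF abs_ge_zero])
  qed measurable
  moreover have "(\<lambda>z. (\<zeta> (fst z) * X (snd z)) * (indicator {a..b} (fst z) * u (fst z *\<^sub>R snd z)))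
     = (\<lambda>z. \<zeta> (fst z) * X (snd z) * u (fst z *\<^sub>R snd z))"
    using zz by (auto simp: indicator_def fun_eq_iff)
  ultimately have Iu: "integrable cylinder_measure (\<lambda>z. \<zeta> (fst z) * X (snd z) * u (fst z *\<^sub>R snd z))" by simp
  have IH: "integrable cylinder_measure (\<lambda>z. X (snd z) * (\<zeta> (fst z) * H (fst z) (snd z)))"
    by (rule cylinder_bounded_mult[where B=1, OF cutoff_H_integrable[OF i\<zeta>]]) (auto simp: X1)
  have Ik: "integrable cylinder_measure (\<lambda>z. (\<eta> (fst z) * X (snd z)) * k (fst z) (snd z))"
  proof (rule cylinder_bounded_mult[OF k_integrable])
    show "\<bar>\<eta> (fst z) * X (snd z)\<bar> \<le> C * 1" for z :: "real \<times> 'a"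
      unfolding abs_mult using C[of "fst z"] X1[of "snd z"] by (intro mult_mono) (auto intro: order_trans[OF abs_ge_zero])
  qed measurable
  have IF: "integrable cylinder_measure (\<lambda>z. X (snd z) * (\<zeta> (fst z) * H (fst z) (snd z)) + (\<eta> (fst z) * X (snd z)) * k (fst z) (snd z))"
    by (rule Bochner_Integration.integrable_add[OF IH Ik])
  have ray: "(LINT t|lborel. X \<omega> * (\<zeta> t * H t \<omega>) + (\<eta> t * X \<omega>) * k t \<omega>) = 0"
    if k: "integrable lborel (\<lambda>s. k s \<omega>)" and i: "integrable lborel (\<lambda>t. X \<omega> * (\<zeta> t * H t \<omega>) + (\<eta> t * X \<omega>) * k t \<omega>)" for \<omega>
  proof -
    have Ht: "H t \<omega> = H r \<omega> + integral {r..t} (\<lambda>s. h (s *\<^sub>R \<omega>))" if "t \<in> {r..R}" for t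
      using H_eq[OF k that] H_eq[OF k, of r] r by simp
    have "((\<lambda>t. \<zeta> t * (\<lambda>y. X \<omega> * y) (H t \<omega>) + \<eta> t * X \<omega> * h (t *\<^sub>R \<omega>)) has_integral
        (\<eta> R * (\<lambda>y. X \<omega> * y) (H R \<omega>) - \<eta> r * (\<lambda>y. X \<omega> * y) (H r \<omega>))) {r..R}"
      using r by (intro chain_product_primitive[where v="\<lambda>t. H t \<omega>"] ray_absolutely_integrable[OF k] Ht d\<eta> continuous_on_subset[OF \<zeta>])
        (auto intro!: derivative_eq_intros)
    moreover have "\<eta> R = 0" "\<eta> r = 0" using z[of R] z[of r] ab by auto
    ultimately have "((\<lambda>t. \<zeta> t * (X \<omega> * H t \<omega>) + \<eta> t * X \<omega> * h (t *\<^sub>R \<omega>)) has_integral 0) {r..R}" by simp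
    then have "((\<lambda>t. if t \<in> {r..R} then \<zeta> t * (X \<omega> * H t \<omega>) + \<eta> t * X \<omega> * h (t *\<^sub>R \<omega>) else 0) has_integral 0) UNIV"
      by (simp only: has_integral_restrict_UNIV)
    then have "((\<lambda>t. X \<omega> * (\<zeta> t * H t \<omega>) + (\<eta> t * X \<omega>) * k t \<omega>) has_integral 0) UNIV"
    proof (rule has_integral_spike[of "{}", rotated 2])
      fix t :: real
      show "X \<omega> * (\<zeta> t * H t \<omega>) + (\<eta> t * X \<omega>) * k t \<omega> = (if t \<in> {r..R} then \<zeta> t * (X \<omega> * H t \<omega>) + \<eta> t * X \<omega> * h (t *\<^sub>R \<omega>) else 0)"
        using zz[of t] z[of t] ab by (cases "t \<in> {a..b}") (auto simp: k_def)
    qed auto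
    then show ?thesis using has_integral_integral_lborel[OF i] has_integral_unique by blast
  qed
  have "(LINT z|cylinder_measure. X (snd z) * (\<zeta> (fst z) * H (fst z) (snd z)) + (\<eta> (fst z) * X (snd z)) * k (fst z) (snd z))
      = (LINT \<omega>|sphere_measure. (LINT t|lborel. X \<omega> * (\<zeta> t * H t \<omega>) + (\<eta> t * X \<omega>) * k t \<omega>))"
    using cylinder_slices(3)[OF IF] by simp
  also have "\<dots> = (LINT \<omega>|(sphere_measure :: 'a measure). 0)"
  proof (rule integral_cong_AE)
    show "AE \<omega> in sphere_measure. (LINT t|lborel. X \<omega> * (\<zeta> t * H t \<omega>) + (\<eta> t * X \<omega>) * k t \<omega>) = 0"
      using AE_ray cylinder_slices(1)[OF IF] by eventually_elim (use ray in simp)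
    show "(\<lambda>\<omega>. LINT t|lborel. X \<omega> * (\<zeta> t * H t \<omega>) + (\<eta> t * X \<omega>) * k t \<omega>) \<in> borel_measurable sphere_measure"
      using cylinder_slices(2)[OF IF] by simp
  qed simp
  finally have 0: "(LINT z|cylinder_measure. X (snd z) * (\<zeta> (fst z) * H (fst z) (snd z))) +
      (LINT z|cylinder_measure. (\<eta> (fst z) * X (snd z)) * k (fst z) (snd z)) = 0"
    by (simp add: Bochner_Integration.integral_add[OF IH Ik])
  have "(LINT z|cylinder_measure. \<zeta> (fst z) * X (snd z) * w z) =
     (LINT z|cylinder_measure. \<zeta> (fst z) * X (snd z) * u (fst z *\<^sub>R snd z) - X (snd z) * (\<zeta> (fst z) * H (fst z) (snd z)))"
    by (intro Bochner_Integration.integral_cong refl) (simp add: w_def algebra_simps)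
  also have "\<dots> = (LINT z|cylinder_measure. \<zeta> (fst z) * X (snd z) * u (fst z *\<^sub>R snd z)) - (LINT z|cylinder_measure. X (snd z) * (\<zeta> (fst z) * H (fst z) (snd z)))"
    by (rule Bochner_Integration.integral_diff[OF Iu IH])
  also have "\<dots> = 0"
    using 0 weak_polar[OF ab(1,3) d\<eta> \<zeta> z zz X Xm] by simp
  finally show ?thesis .
qed

text \<open>
  A fixed interval well inside \<open>{r<..<R}\<close> and a fixed weight \<open>\<zeta>0\<close> on it with integral \<open>1\<close>. They serve to pick
  out the constant value of \<open>w\<close> on each ray as a mean; a value at a single radius would be meaningless at
  this stage.
\<close>

definition a0 :: real where "a0 = (2 * r + R) / 3"
definition b0 :: real where "b0 = (r + 2 * R) / 3"

lemma a0_b0: "r < a0" "a0 < b0" "b0 < R" using r by (auto simp: a0_def b0_def)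

definition \<zeta>0 :: "real \<Rightarrow> real" where "\<zeta>0 t = bump 1 a0 b0 t / (LINT t|lborel. bump 1 a0 b0 t)"

lemma bump_integral_pos: "(LINT t|lborel. bump 1 a0 b0 t) > 0"
proof -
  have i: "integrable lborel (bump 1 a0 b0)"
    by (rule continuous_compact_support_integrable(1)[where a=a0 and b=b0]) (auto intro: continuous_bump bump_outside)
  have "(LINT t|lborel. bump 1 a0 b0 t) = integral UNIV (bump 1 a0 b0)"
    by (rule integral_unique[symmetric, OF has_integral_integral_lborel[OF i]])
  also have "\<dots> = integral {a0..b0} (bump 1 a0 b0)"
  proof -
    have "bump 1 a0 b0 = (\<lambda>t. if t \<in> {a0..b0} then bump 1 a0 b0 t else 0)" by (intro ext) (auto intro!: bump_outside)
    then show ?thesis using integral_restrict_UNIV[of "{a0..b0}" "bump 1 a0 b0"] by simp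
  qed
  also have "\<dots> > 0"
  proof -
    have "integral {a0..b0} (bump 1 a0 b0) \<noteq> 0"
    proof
      assume "integral {a0..b0} (bump 1 a0 b0) = 0"
      then have "\<forall>t\<in>{a0..b0}. bump 1 a0 b0 t = 0"
        using integral_eq_0_iff[of a0 b0 "bump 1 a0 b0"] a0_b0 by (auto intro: continuous_bump bump_range)
      moreover have "bump 1 a0 b0 ((a0 + b0) / 2) > 0" using a0_b0 by (intro bump_pos) auto
      ultimately show False using a0_b0 by (auto dest!: bspec[of _ _ "(a0 + b0) / 2"])
    qed
    moreover have "integral {a0..b0} (bump 1 a0 b0) \<ge> 0"
      by (intro Henstock_Kurzweil_Integration.integral_nonneg integrable_continuous_real continuous_bump) (auto intro: bump_range)
    ultimately show ?thesis by simp
  qed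
  finally show ?thesis .
qed

lemma \<zeta>0: "continuous_on UNIV \<zeta>0" "t \<notin> {a0..b0} \<Longrightarrow> \<zeta>0 t = 0" "(LINT t|lborel. \<zeta>0 t) = 1"
  using bump_integral_pos unfolding \<zeta>0_def[abs_def]
  by (auto intro!: continuous_intros continuous_bump bump_outside)

lemma \<zeta>0_measurable [measurable]: "\<zeta>0 \<in> borel_measurable borel"
  using \<zeta>0(1) by (rule borel_measurable_continuous_onI)

definition W :: "'a \<Rightarrow> real" where "W \<omega> = (LINT t|lborel. \<zeta>0 t * w (t, \<omega>))"

lemma \<zeta>_w_integrable:
  assumes ab: "r < a" "b < R" and \<zeta>: "continuous_on UNIV \<zeta>" "\<And>t. t \<notin> {a..b} \<Longrightarrow> \<zeta> t = 0"
    and X[measurable]: "X \<in> borel_measurable borel" and X1: "\<And>\<omega>. \<bar>X \<omega>\<bar> \<le> 1"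
  shows "integrable cylinder_measure (\<lambda>z. \<zeta> (fst z) * X (snd z) * w z)"
proof -
  have [measurable]: "\<zeta> \<in> borel_measurable borel" using \<zeta>(1) by (rule borel_measurable_continuous_onI)
  obtain B where B: "\<And>t. \<bar>\<zeta> t\<bar> \<le> B" using continuous_compact_support_integrable(2)[OF \<zeta>] by blast
  have "integrable cylinder_measure (\<lambda>z. (\<zeta> (fst z) * X (snd z)) * (indicator {a..b} (fst z) * w z))"
  proof (rule cylinder_bounded_mult[OF cutoff_w_integrable[OF ab]])
    show "\<bar>\<zeta> (fst z) * X (snd z)\<bar> \<le> B * 1" for z :: "real \<times> 'a"
      unfolding abs_mult using B[of "fst z"] X1[of "snd z"] by (intro mult_mono) (auto intro: order_trans[OF abs_ge_zero])
  qed measurable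
  moreover have "(\<lambda>z. (\<zeta> (fst z) * X (snd z)) * (indicator {a..b} (fst z) * w z)) = (\<lambda>z. \<zeta> (fst z) * X (snd z) * w z)"
    using \<zeta>(2) by (auto simp: indicator_def fun_eq_iff)
  ultimately show ?thesis by simp
qed

lemma W_integrable: "integrable sphere_measure W"
  using cylinder_slices(2)[OF \<zeta>_w_integrable[OF a0_b0(1,3) \<zeta>0(1,2), of "\<lambda>_. 1"]]
  by (simp add: W_def[abs_def])

lemma W_measurable [measurable]: "W \<in> borel_measurable borel"
  using W_integrable by auto

text \<open>
  The mean of \<open>\<zeta>\<close> is no longer \<open>0\<close>. Subtracting from \<open>\<zeta>\<close> its integral times \<open>\<zeta>0\<close> gives a function of mean \<open>0\<close>,
  to which \<open>cutoff_w_orthogonal\<close> applies; the subtracted part produces exactly the term with \<open>W\<close>.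
\<close>

lemma defect_orthogonal:
  assumes ab: "r < a" "a \<le> b" "b < R" and \<zeta>: "continuous_on UNIV \<zeta>" "\<And>t. t \<notin> {a..b} \<Longrightarrow> \<zeta> t = 0"
    and X: "euler_C1 (\<lambda>x. X (sgn x)) (\<lambda>x. 0)" and Xm[measurable]: "X \<in> borel_measurable borel" and X1: "\<And>\<omega>. \<bar>X \<omega>\<bar> \<le> 1"
  shows "(LINT z|cylinder_measure. \<zeta> (fst z) * X (snd z) * (w z - W (snd z))) = 0"
proof -
  define c where "c = (LINT t|lborel. \<zeta> t)"
  note i\<zeta> = continuous_compact_support_integrable(1)[OF \<zeta>]
  note i\<zeta>0 = continuous_compact_support_integrable(1)[OF \<zeta>0(1,2)]
  note I1 = \<zeta>_w_integrable[OF ab(1,3) \<zeta> Xm X1]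
  note I0 = \<zeta>_w_integrable[OF a0_b0(1,3) \<zeta>0(1,2) Xm X1]
  have XW: "integrable sphere_measure (\<lambda>\<omega>. X \<omega> * W \<omega>)"
    by (rule Bochner_Integration.integrable_bound[OF W_integrable])
       (auto simp: abs_mult mult_left_le_one_le X1)
  have c0: "(LINT z|cylinder_measure. (\<zeta> (fst z) - c * \<zeta>0 (fst z)) * X (snd z) * w z) = 0"
  proof (rule cutoff_w_orthogonal[where a="min a a0" and b="max b b0"])
    show "continuous_on UNIV (\<lambda>t. \<zeta> t - c * \<zeta>0 t)" by (intro continuous_intros \<zeta> \<zeta>0)
    show "\<zeta> t - c * \<zeta>0 t = 0" if "t \<notin> {min a a0..max b b0}" for t
      using that \<zeta>(2)[of t] \<zeta>0(2)[of t] by (auto simp: min_le_iff_disj le_max_iff_disj)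
    show "(LINT t|lborel. \<zeta> t - c * \<zeta>0 t) = 0"
      using i\<zeta> i\<zeta>0 \<zeta>0(3) by (simp add: c_def)
  qed (use ab a0_b0 X X1 in auto)
  have "(LINT z|cylinder_measure. (\<zeta> (fst z) - c * \<zeta>0 (fst z)) * X (snd z) * w z) =
     (LINT z|cylinder_measure. \<zeta> (fst z) * X (snd z) * w z - c * (\<zeta>0 (fst z) * X (snd z) * w z))"
    by (intro Bochner_Integration.integral_cong refl) (simp add: algebra_simps)
  also have "\<dots> = (LINT z|cylinder_measure. \<zeta> (fst z) * X (snd z) * w z) - c * (LINT z|cylinder_measure. \<zeta>0 (fst z) * X (snd z) * w z)"
    using I1 I0 by simp
  finally have 1: "(LINT z|cylinder_measure. \<zeta> (fst z) * X (snd z) * w z) = c * (LINT z|cylinder_measure. \<zeta>0 (fst z) * X (snd z) * w z)"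
    using c0 by simp
  have "(LINT z|cylinder_measure. \<zeta>0 (fst z) * X (snd z) * w z) = (LINT \<omega>|sphere_measure. (LINT t|lborel. \<zeta>0 t * X \<omega> * w (t, \<omega>)))"
    using cylinder_slices(3)[OF I0] by simp
  also have "\<dots> = (LINT \<omega>|sphere_measure. X \<omega> * W \<omega>)"
  proof (intro Bochner_Integration.integral_cong refl)
    fix \<omega> :: 'a
    have "(LINT t|lborel. \<zeta>0 t * X \<omega> * w (t, \<omega>)) = (LINT t|lborel. X \<omega> * (\<zeta>0 t * w (t, \<omega>)))"
      by (intro Bochner_Integration.integral_cong refl) simp
    then show "(LINT t|lborel. \<zeta>0 t * X \<omega> * w (t, \<omega>)) = X \<omega> * W \<omega>" by (simp add: W_def)
  qed
  finally have 2: "(LINT z|cylinder_measure. \<zeta> (fst z) * X (snd z) * w z) = c * (LINT \<omega>|sphere_measure. X \<omega> * W \<omega>)"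
    using 1 by simp
  have "(LINT z|cylinder_measure. \<zeta> (fst z) * X (snd z) * (w z - W (snd z))) =
    (LINT z|cylinder_measure. \<zeta> (fst z) * X (snd z) * w z - \<zeta> (fst z) * (X (snd z) * W (snd z)))"
    by (intro Bochner_Integration.integral_cong refl) (simp add: algebra_simps)
  also have "\<dots> = (LINT z|cylinder_measure. \<zeta> (fst z) * X (snd z) * w z) - (LINT z|cylinder_measure. \<zeta> (fst z) * (X (snd z) * W (snd z)))"
    by (rule Bochner_Integration.integral_diff[OF I1 cylinder_product(1)[OF i\<zeta> XW]])
  also have "\<dots> = 0" using cylinder_product(2)[OF i\<zeta> XW] 2 by (simp add: c_def)
  finally show ?thesis .
qed

text \<open>
  Products of bumps in the radius and in the coordinates of the direction converge boundedly to indicators of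
  boxes in the product space. The cut-off to \<open>{a<..<b}\<close> keeps the supports inside the annulus, where \<open>u\<close> is
  only locally integrable.
\<close>

lemma defect_zero_local:
  assumes ab: "r < a" "a \<le> b" "b < R"
  shows "AE z in cylinder_measure. a < fst z \<and> fst z < b \<longrightarrow> w z = W (snd z)"
proof -
  define f where "f z = indicator {a<..<b} (fst z) * (w z - W (snd z))" for z
  have ind: "integrable lborel (indicat_real {a..b})"
    by (rule integrable_real_indicator) (auto simp: emeasure_lborel_Icc_eq)
  have ig: "integrable cylinder_measure (\<lambda>z. indicator {a..b} (fst z) * w z - indicator {a..b} (fst z) * W (snd z))"
    by (intro Bochner_Integration.integrable_diff cutoff_w_integrable ab cylinder_product(1) ind W_integrable)
  have fm[measurable]: "f \<in> borel_measurable (borel \<Otimes>\<^sub>M borel)" unfolding f_def by measurable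
  have fi: "integrable cylinder_measure f"
    by (rule Bochner_Integration.integrable_bound[OF ig])
       (auto simp: f_def indicator_def algebra_simps)
  have "AE z in cylinder_measure. f z = 0"
  proof (rule AE_zero_from_boxes[OF sets_cylinder_measure fi])
    fix l v :: "real \<times> 'a"
    define Y where "Y n \<omega> = (\<Prod>i\<in>Basis. bump n (snd l \<bullet> i) (snd v \<bullet> i) (\<omega> \<bullet> i))" for n and \<omega> :: 'a
    \<comment> \<open>Intersecting with \<open>{a<..<b}\<close> does not change the limit, because \<open>f\<close> vanishes outside.\<close>
    define \<xi> where "\<xi> n = bump n (max a (fst l)) (min b (fst v))" for n
    have Y1: "\<bar>Y n \<omega>\<bar> \<le> 1" for n \<omega> unfolding Y_def
      using bump_range by (auto simp: abs_prod intro!: prod_le_1)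
    have \<xi>1: "\<bar>\<xi> n t\<bar> \<le> 1" for n t unfolding \<xi>_def using bump_range[of n _ _ t] by auto
    have \<xi>c: "continuous_on UNIV (\<xi> n)" for n unfolding \<xi>_def by (rule continuous_bump)
    have \<xi>z: "\<xi> n t = 0" if "t \<notin> {a<..<b}" for n t unfolding \<xi>_def using that by (intro bump_outside) auto
    have Ym[measurable]: "Y n \<in> borel_measurable borel" for n
      unfolding Y_def by (intro borel_measurable_continuous_onI continuous_intros continuous_on_compose2[OF continuous_bump[of UNIV]]) auto
    have [measurable]: "\<xi> n \<in> borel_measurable borel" for n
      by (rule borel_measurable_continuous_onI[OF \<xi>c])
    have Ye: "euler_C1 (\<lambda>x. Y n (sgn x)) (\<lambda>x. 0)" for n unfolding Y_def
    proof (rule euler_C1_prod)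
      fix i :: 'a
      have "euler_C1 (\<lambda>x. bump n (snd l \<bullet> i) (snd v \<bullet> i) (sgn x \<bullet> i)) (\<lambda>x. bump' n (snd l \<bullet> i) (snd v \<bullet> i) (sgn x \<bullet> i) * 0)"
        by (intro euler_C1_compose[OF euler_C1_direction] bump_has_derivative continuous_bump')
      then show "euler_C1 (\<lambda>x. bump n (snd l \<bullet> i) (snd v \<bullet> i) (sgn x \<bullet> i)) (\<lambda>x. 0)" by simp
    qed simp
    have "(\<lambda>n. LINT z|cylinder_measure. \<xi> n (fst z) * Y n (snd z) * f z) \<longlonglongrightarrow> (LINT z|cylinder_measure. indicator (box l v) z *\<^sub>R f z)"
    proof (rule integral_dominated_convergence[where w="\<lambda>z. \<bar>f z\<bar>"])
      have "box l v \<in> sets (cylinder_measure :: (real \<times> 'a) measure)" unfolding sets_cylinder_measure by simp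
      then show "(\<lambda>z. indicator (box l v) z *\<^sub>R f z) \<in> borel_measurable cylinder_measure" by measurable
      show "AE z in cylinder_measure. (\<lambda>n. \<xi> n (fst z) * Y n (snd z) * f z) \<longlonglongrightarrow> indicator (box l v) z *\<^sub>R f z"
      proof (rule AE_I2)
        fix z :: "real \<times> 'a"
        have "(\<lambda>n. \<xi> n (fst z) * Y n (snd z) * f z) \<longlonglongrightarrow>
           indicator {max a (fst l)<..<min b (fst v)} (fst z) * (\<Prod>i\<in>Basis. indicator {snd l \<bullet> i<..<snd v \<bullet> i} (snd z \<bullet> i)) * f z"
          unfolding \<xi>_def Y_def by (intro tendsto_intros bump_limit)
        also have "(\<Prod>i\<in>Basis. indicator {snd l \<bullet> i<..<snd v \<bullet> i} (snd z \<bullet> i)) = (indicator (box (snd l) (snd v)) (snd z) :: real)"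
          by (auto simp: indicator_def box_def prod_zero_iff)
        also have "indicator {max a (fst l)<..<min b (fst v)} (fst z) * indicator (box (snd l) (snd v)) (snd z) * f z = indicator (box l v) z *\<^sub>R f z"
          unfolding box_prod[of l v] by (cases z) (auto simp: indicator_def f_def box_real)
        finally show "(\<lambda>n. \<xi> n (fst z) * Y n (snd z) * f z) \<longlonglongrightarrow> indicator (box l v) z *\<^sub>R f z" .
      qed
      show "AE z in cylinder_measure. norm (\<xi> n (fst z) * Y n (snd z) * f z) \<le> \<bar>f z\<bar>" for n
      proof (rule AE_I2)
        fix z :: "real \<times> 'a"
        have "\<bar>\<xi> n (fst z)\<bar> * \<bar>Y n (snd z)\<bar> \<le> 1" using \<xi>1 Y1 by (intro mult_le_one) auto
        then have "\<bar>\<xi> n (fst z)\<bar> * \<bar>Y n (snd z)\<bar> * \<bar>f z\<bar> \<le> 1 * \<bar>f z\<bar>" by (intro mult_right_mono) auto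
        then show "norm (\<xi> n (fst z) * Y n (snd z) * f z) \<le> \<bar>f z\<bar>" by (simp add: abs_mult)
      qed
    qed (use fi in auto)
    moreover have "(LINT z|cylinder_measure. \<xi> n (fst z) * Y n (snd z) * f z) = 0" for n
    proof -
      have "(LINT z|cylinder_measure. \<xi> n (fst z) * Y n (snd z) * f z) = (LINT z|cylinder_measure. \<xi> n (fst z) * Y n (snd z) * (w z - W (snd z)))"
        using \<xi>z by (intro Bochner_Integration.integral_cong refl) (auto simp: f_def indicator_def)
      also have "\<dots> = 0"
        by (rule defect_orthogonal[OF ab \<xi>c _ Ye Ym Y1]) (auto intro: \<xi>z)
      finally show ?thesis .
    qed
    ultimately show "(LINT x:box l v|cylinder_measure. f x) = 0"
      unfolding set_lebesgue_integral_def by (simp add: LIMSEQ_const_iff)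
  qed
  then show ?thesis by eventually_elim (auto simp: f_def)
qed

lemma defect_zero: "AE z in cylinder_measure. r < fst z \<and> fst z < R \<longrightarrow> w z = W (snd z)"
proof -
  obtain e :: "nat \<Rightarrow> real" where e: "\<And>n. 0 < e n" "\<And>n. 2 * e n \<le> R - r" and lim: "e \<longlonglongrightarrow> 0"
    by (rule shrinking_margin[OF r(2)]) (rule that)
  have "AE z in cylinder_measure. \<forall>n. r + e n < fst z \<and> fst z < R - e n \<longrightarrow> w z = W (snd z)"
    unfolding AE_all_countable
  proof
    show "AE z in cylinder_measure. r + e n < fst z \<and> fst z < R - e n \<longrightarrow> w z = W (snd z)" for n
      using e[of n] by (intro defect_zero_local) auto
  qed
  then show ?thesis
  proof eventually_elim
    case (elim z)
    show ?case
    proof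
      assume z: "r < fst z \<and> fst z < R"
      have "eventually (\<lambda>n. e n < min (fst z - r) (R - fst z)) sequentially"
        by (rule order_tendstoD(2)[OF lim]) (use z in auto)
      then obtain n where "e n < min (fst z - r) (R - fst z)" by (auto simp: eventually_sequentially)
      then show "w z = W (snd z)" using elim[rule_format, of n] by auto
    qed
  qed
qed

text \<open>
  The representative of \<open>u\<close>. It is defined by the value \<open>W\<close> on each ray and the primitive \<open>H\<close>, hence also on
  the two boundary spheres.
\<close>

definition v :: "'a \<Rightarrow> real" where "v x = W (sgn x) + H (norm x) (sgn x)"

lemma v_measurable [measurable]: "v \<in> borel_measurable borel"
proof -
  have "(\<lambda>x::'a. H (fst (norm x, sgn x)) (snd (norm x, sgn x))) \<in> borel_measurable borel"
    by (rule measurable_compose[OF _ H_measurable]) measurable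
  then show ?thesis unfolding v_def[abs_def] by simp
qed

lemma v_ray:
  assumes "norm \<omega> = 1" "0 < t" shows "v (t *\<^sub>R \<omega>) = W \<omega> + H t \<omega>"
proof -
  have "sgn (t *\<^sub>R \<omega>) = \<omega>" "norm (t *\<^sub>R \<omega>) = t" using assms by (auto simp: sgn_div_norm)
  then show ?thesis unfolding v_def by simp
qed

lemma v_eq_u: "AE x in lborel. x \<in> annulus r R \<longrightarrow> v x = u x"
proof (subst polar_AE_iff[OF _ r])
  interpret pair_sigma_finite "lborel :: real measure" "sphere_measure :: 'a measure"
    by (rule pair_sigma_finite_lborel_sphere)
  have "AE t in lborel. AE \<omega> in sphere_measure. r < t \<and> t < R \<longrightarrow> w (t, \<omega>) = W \<omega>"
    using AE_pair[OF defect_zero] by simp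
  moreover have "{z \<in> space cylinder_measure. r < fst z \<and> fst z < R \<longrightarrow> w (fst z, snd z) = W (snd z)} \<in> sets (cylinder_measure :: (real \<times> 'a) measure)"
    unfolding prod.collapse by measurable
  ultimately have "AE \<omega> in sphere_measure. AE t in lborel. r < t \<and> t < R \<longrightarrow> w (t, \<omega>) = W \<omega>"
    using AE_commute[of "\<lambda>t \<omega>. r < t \<and> t < R \<longrightarrow> w (t, \<omega>) = W \<omega>"] by blast
  then show "AE \<omega> in sphere_measure. AE t in lborel. r < t \<and> t < R \<longrightarrow> v (t *\<^sub>R \<omega>) = u (t *\<^sub>R \<omega>)"
    using AE_sphere_measure_norm
  proof eventually_elim
    case (elim \<omega>)
    from elim(1) show ?case
      by eventually_elim (use elim(2) r in \<open>auto simp: w_def v_ray\<close>)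
  qed
qed measurable

lemma v_primitive:
  "AE \<omega> in sphere_measure. (\<lambda>s. h (s *\<^sub>R \<omega>)) absolutely_integrable_on {r..R} \<and>
    (\<forall>t\<in>{r..R}. v (t *\<^sub>R \<omega>) = v (r *\<^sub>R \<omega>) + integral {r..t} (\<lambda>s. h (s *\<^sub>R \<omega>)))"
  using AE_ray AE_sphere_measure_norm
proof eventually_elim
  case (elim \<omega>)
  have "H r \<omega> = 0" using H_eq[OF elim(1), of r] r by simp
  then show ?case using ray_absolutely_integrable[OF elim(1)] r
    by (auto simp: v_ray[OF elim(2)] H_eq[OF elim(1)])
qed

end

section \<open>The radial representative\<close>

lemma locally_integrable_on_annulus_measurable:
  fixes f :: "'a::euclidean_space \<Rightarrow> 'b::euclidean_space"
  assumes f: "locally_integrable_on f (annulus r R)" and r: "r < R"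
  shows "(\<lambda>x. indicator (annulus r R) x *\<^sub>R f x) \<in> borel_measurable lebesgue"
proof -
  obtain e :: "nat \<Rightarrow> real" where e: "\<And>n. 0 < e n" and lim: "e \<longlonglongrightarrow> 0"
    by (rule shrinking_margin[OF r]) (rule that)
  define K where "K n = {x::'a. r + e n \<le> norm x \<and> norm x \<le> R - e n}" for n
  have "compact (K n)" for n unfolding K_def by (rule compact_closed_annulus)
  moreover have "K n \<subseteq> annulus r R" for n using e[of n] by (auto simp: K_def annulus_def)
  ultimately have "f absolutely_integrable_on (K n)" for n using f unfolding locally_integrable_on_def by blast
  then have m: "(\<lambda>x. indicator (K n) x *\<^sub>R f x) \<in> borel_measurable lebesgue" for n
    unfolding set_integrable_def by auto
  show ?thesis
  proof (rule borel_measurable_LIMSEQ_metric[OF m])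
    fix x :: 'a
    have "eventually (\<lambda>n. indicator (K n) x *\<^sub>R f x = indicator (annulus r R) x *\<^sub>R f x) sequentially"
    proof (cases "x \<in> annulus r R")
      case True
      then have x: "r < norm x" "norm x < R" by (auto simp: annulus_def)
      have "eventually (\<lambda>n. e n < min (norm x - r) (R - norm x)) sequentially"
        by (rule order_tendstoD(2)[OF lim]) (use x in auto)
      then show ?thesis
        by eventually_elim (use True in \<open>auto simp: indicator_def K_def\<close>)
    next
      case False
      then have "x \<notin> K n" for n using e[of n] by (auto simp: K_def annulus_def)
      then show ?thesis using False by simp
    qed
    then show "(\<lambda>n. indicator (K n) x *\<^sub>R f x) \<longlonglongrightarrow> indicator (annulus r R) x *\<^sub>R f x"
      by (rule tendsto_eventually)
  qed
qed

lemma euler_C1_borel: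
  assumes "euler_C1 f d"
  shows "(\<lambda>x. indicator (- {0}) x *\<^sub>R f x) \<in> borel_measurable borel"
    and "(\<lambda>x. indicator (- {0}) x *\<^sub>R d x) \<in> borel_measurable borel"
proof -
  obtain f' where f': "continuous_on (- {0}) f'" "\<And>x. x \<noteq> 0 \<Longrightarrow> GDERIV f x :> f' x \<and> x \<bullet> f' x = d x"
    using assms unfolding euler_C1_def by blast
  have "continuous_on (- {0}) d"
    by (rule continuous_on_eq[of _ "\<lambda>x. x \<bullet> f' x"]) (use f' in \<open>auto intro!: continuous_intros\<close>)
  then show "(\<lambda>x. indicator (- {0}) x *\<^sub>R d x) \<in> borel_measurable borel"
    by (intro borel_measurable_continuous_on_indicator) auto
  show "(\<lambda>x. indicator (- {0}) x *\<^sub>R f x) \<in> borel_measurable borel"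
    using euler_C1_continuous[OF assms] by (intro borel_measurable_continuous_on_indicator) auto
qed

text \<open>
  Passage from Lebesgue measure, in which the functionals are stated, to Borel measure, in which product measures
  are formed.
\<close>

lemma set_integral_completion_AE:
  fixes f g :: "'a::euclidean_space \<Rightarrow> real"
  assumes A: "A \<in> sets borel" and g: "(\<lambda>x. indicator A x *\<^sub>R g x) \<in> borel_measurable borel"
    and eq: "AE x in lborel. x \<in> A \<longrightarrow> f x = g x"
  shows "(LINT x:A|lebesgue. f x) = (LINT x:A|lborel. g x)"
    and "set_integrable lebesgue A f \<longleftrightarrow> set_integrable lborel A g"
proof -
  have eq': "AE x in lebesgue. indicator A x *\<^sub>R f x = indicator A x *\<^sub>R g x"
    using eq by (intro AE_completion) (auto elim!: eventually_mono simp: indicator_def)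
  have gl: "(\<lambda>x. indicator A x *\<^sub>R g x) \<in> borel_measurable lebesgue"
    using g by (simp add: measurable_completion)
  have fl: "(\<lambda>x. indicator A x *\<^sub>R f x) \<in> borel_measurable lebesgue"
    using gl by (rule borel_measurable_AE) (use eq' in \<open>auto elim!: eventually_mono\<close>)
  show "(LINT x:A|lebesgue. f x) = (LINT x:A|lborel. g x)"
    unfolding set_lebesgue_integral_def
    using integral_cong_AE[OF fl gl eq'] integral_completion[of "\<lambda>x. indicator A x *\<^sub>R g x" lborel] g by simp
  show "set_integrable lebesgue A f \<longleftrightarrow> set_integrable lborel A g"
    unfolding set_integrable_def
    using integrable_cong_AE[OF fl gl eq'] integrable_completion[of "\<lambda>x. indicator A x *\<^sub>R g x" lborel] g by simp
qed

lemma continuous_AE_eq: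
  fixes f g :: "real \<Rightarrow> real"
  assumes r: "r < R" and f: "continuous_on {r..R} f" and g: "continuous_on {r..R} g"
    and eq: "AE t in lborel. r < t \<and> t < R \<longrightarrow> f t = g t" and t: "t \<in> {r..R}"
  shows "f t = g t"
proof -
  obtain N where N: "{t \<in> space lborel. \<not> (r < t \<and> t < R \<longrightarrow> f t = g t)} \<subseteq> N" "emeasure lborel N = 0" "N \<in> sets lborel"
    using AE_E[OF eq] .
  have "N \<in> null_sets lebesgue" using N by (intro null_sets_completionI) (auto simp: null_sets_def)
  then have neg: "negligible (N \<union> {r, R})" by (simp add: negligible_iff_null_sets[symmetric])
  have "((\<lambda>t. \<bar>f t - g t\<bar>) has_integral 0) {r..R}"
  proof (rule has_integral_spike[OF neg, of _ _ "\<lambda>_. 0"])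
    fix x assume "x \<in> {r..R} - (N \<union> {r, R})"
    then have "r < x \<and> x < R" "x \<notin> N" by auto
    then show "\<bar>f x - g x\<bar> = 0" using N(1) by auto
  qed simp
  then have "integral {r..R} (\<lambda>t. \<bar>f t - g t\<bar>) = 0" by (rule integral_unique)
  then have "\<forall>t\<in>{r..R}. \<bar>f t - g t\<bar> = 0"
    using f g r by (subst (asm) integral_eq_0_iff) (auto intro!: continuous_intros)
  then show ?thesis using t by auto
qed

text \<open>
  On almost every ray the two representatives agree at almost every radius, and both are continuous up to the
  endpoints. So every property of one representative along rays holds for the one chosen by \<open>radial_rep\<close>.
\<close>

lemma radial_rep_unique:
  fixes v v' :: "'a::euclidean_space \<Rightarrow> real"
  assumes r: "0 < r" "r < R" and v: "is_radial_rep r R u v" and v': "is_radial_rep r R u v'"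
  shows "AE \<omega> in sphere_measure. \<forall>t\<in>{r..R}. v (t *\<^sub>R \<omega>) = v' (t *\<^sub>R \<omega>)"
proof -
  have "AE x in lebesgue. x \<in> annulus r R \<longrightarrow> v x = u x" "AE x in lebesgue. x \<in> annulus r R \<longrightarrow> v' x = u x"
    using v v' by (auto simp: is_radial_rep_def)
  then have "AE x in lebesgue. x \<in> annulus r R \<longrightarrow> v x = v' x" by eventually_elim auto
  then have "AE x in lborel. x \<in> annulus r R \<longrightarrow> v x = v' x" by (simp add: AE_completion_iff)
  then have 1: "AE \<omega> in sphere_measure. AE t in lborel. r < t \<and> t < R \<longrightarrow> v (t *\<^sub>R \<omega>) = v' (t *\<^sub>R \<omega>)"
    by (rule polar_AE[OF _ r])
  have 2: "AE \<omega> in sphere_measure. absolutely_continuous_on {r..R} (\<lambda>t. v (t *\<^sub>R \<omega>))"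
    "AE \<omega> in sphere_measure. absolutely_continuous_on {r..R} (\<lambda>t. v' (t *\<^sub>R \<omega>))"
    using v v' by (auto simp: is_radial_rep_def)
  from 1 2 show ?thesis
  proof eventually_elim
    case (elim \<omega>)
    show ?case
      using continuous_AE_eq[OF r(2) absolutely_continuous_on_imp_continuous[OF elim(2)] absolutely_continuous_on_imp_continuous[OF elim(3)] elim(1)]
      by blast
  qed
qed

text \<open>
  The chosen representative is a primitive of the radial component of the chosen weak gradient, along almost
  every ray and up to both boundary spheres. The finite \<open>p\<close>-energy makes \<open>h\<close> integrable on the whole annulus,
  which gives absolute continuity up to the boundary and not only inside.
\<close>

lemma radial_rep_primitive:
  fixes u :: "'a::euclidean_space \<Rightarrow> real"
  assumes r: "0 < r" "r < R" and p: "p > 1" and adm: "admissible p r R u"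
  obtains h where "h \<in> borel_measurable borel"
    and "AE x in lborel. x \<in> annulus r R \<longrightarrow> (x \<bullet> weak_grad (annulus r R) u x) / norm x = h x"
    and "set_integrable lborel (annulus r R) (\<lambda>x. \<bar>h x\<bar> powr p)"
    and "is_radial_rep r R u (radial_rep r R u)"
    and "AE \<omega> in sphere_measure. (\<lambda>s. h (s *\<^sub>R \<omega>)) absolutely_integrable_on {r..R} \<and>
      (\<forall>t\<in>{r..R}. radial_rep r R u (t *\<^sub>R \<omega>) = radial_rep r R u (r *\<^sub>R \<omega>) + integral {r..t} (\<lambda>s. h (s *\<^sub>R \<omega>)))"
proof -
  let ?A = "annulus r R :: 'a set"
  define g where "g = weak_grad ?A u"
  have wg: "has_weak_gradient_on u g ?A"
  proof -
    have "\<exists>g. has_weak_gradient_on u g ?A"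
      using adm unfolding admissible_def weakly_differentiable_on_def by blast
    then show ?thesis unfolding g_def weak_grad_def by (rule someI_ex)
  qed
  have loc: "locally_integrable_on u ?A" "locally_integrable_on g ?A"
    using wg by (auto simp: has_weak_gradient_on_def)
  have "(\<lambda>x. indicator ?A x *\<^sub>R u x) \<in> borel_measurable lebesgue"
    by (rule locally_integrable_on_annulus_measurable[OF loc(1) r(2)])
  then obtain u1 where u1[measurable]: "u1 \<in> borel_measurable borel" and u1e: "AE x in lborel. indicator ?A x *\<^sub>R u x = u1 x"
    using completion_ex_borel_measurable_real[of "\<lambda>x. indicator ?A x *\<^sub>R u x" lborel] by auto
  have u1e: "AE x in lborel. x \<in> ?A \<longrightarrow> u x = u1 x" using u1e by eventually_elim auto
  have gm: "(\<lambda>x. indicator ?A x *\<^sub>R g x) \<in> borel_measurable lebesgue"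
    by (rule locally_integrable_on_annulus_measurable[OF loc(2) r(2)])
  have xm: "(\<lambda>x::'a. x) \<in> borel_measurable lebesgue" "(\<lambda>x::'a. norm x) \<in> borel_measurable lebesgue"
    by (auto intro: measurable_completion)
  have "(\<lambda>x. (x \<bullet> (indicator ?A x *\<^sub>R g x)) / norm x) \<in> borel_measurable lebesgue"
    using gm xm by (intro borel_measurable_divide borel_measurable_inner)
  then obtain h where h[measurable]: "h \<in> borel_measurable borel" and he: "AE x in lborel. (x \<bullet> (indicator ?A x *\<^sub>R g x)) / norm x = h x"
    using completion_ex_borel_measurable_real[of "\<lambda>x. (x \<bullet> (indicator ?A x *\<^sub>R g x)) / norm x" lborel] by auto
  have he: "AE x in lborel. x \<in> ?A \<longrightarrow> (x \<bullet> g x) / norm x = h x" using he by eventually_elim auto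
  have hp: "set_integrable lborel ?A (\<lambda>x. \<bar>h x\<bar> powr p)"
    unfolding set_integrable_def
  proof (rule integrableI_bounded)
    have "(\<integral>\<^sup>+x. ennreal (norm (indicat_real ?A x *\<^sub>R \<bar>h x\<bar> powr p)) \<partial>lborel) =
       (\<integral>\<^sup>+x\<in>?A. ennreal (\<bar>(x \<bullet> g x) / norm x\<bar> powr p) \<partial>lborel)"
    proof (rule nn_integral_cong_AE)
      show "AE x in lborel. ennreal (norm (indicat_real ?A x *\<^sub>R \<bar>h x\<bar> powr p)) =
          ennreal (\<bar>(x \<bullet> g x) / norm x\<bar> powr p) * indicator ?A x"
        using he by eventually_elim (simp add: indicator_def del: abs_divide)
    qed
    also have "\<dots> < \<infinity>" using adm unfolding admissible_def g_def by (simp add: nn_integral_completion)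
    finally show "(\<integral>\<^sup>+x. ennreal (norm (indicat_real ?A x *\<^sub>R \<bar>h x\<bar> powr p)) \<partial>lborel) < \<infinity>" .
  qed measurable
  have h1: "set_integrable lborel ?A h"
  proof -
    have fin: "emeasure lborel ?A < \<infinity>"
      by (rule emeasure_bounded_finite) (auto simp: annulus_def intro: bounded_diff)
    have "integrable lborel (\<lambda>x. indicator ?A x + indicator ?A x *\<^sub>R \<bar>h x\<bar> powr p)"
      using hp fin unfolding set_integrable_def by (intro Bochner_Integration.integrable_add integrable_real_indicator) auto
    then show ?thesis unfolding set_integrable_def
    proof (rule Bochner_Integration.integrable_bound)
      show "AE x in lborel. norm (indicat_real ?A x *\<^sub>R h x) \<le> norm (indicat_real ?A x + indicat_real ?A x *\<^sub>R \<bar>h x\<bar> powr p)"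
      proof (rule AE_I2)
        fix x
        have "\<bar>h x\<bar> \<le> 1 + \<bar>h x\<bar> powr p"
        proof (cases "\<bar>h x\<bar> \<le> 1")
          case False
          then have "\<bar>h x\<bar> powr 1 \<le> \<bar>h x\<bar> powr p" using p by (intro powr_mono) auto
          then show ?thesis using False by simp
        qed (use powr_ge_zero[of "\<bar>h x\<bar>" p] in linarith)
        then show "norm (indicat_real ?A x *\<^sub>R h x) \<le> norm (indicat_real ?A x + indicat_real ?A x *\<^sub>R \<bar>h x\<bar> powr p)"
          by (auto simp: indicator_def)
      qed
    qed measurable
  qed
  interpret radial_weak_derivative r R u1 h
  proof
    fix a b :: real assume ab: "r < a" "b < R"
    let ?K = "{x::'a. a \<le> norm x \<and> norm x \<le> b}"
    have K: "compact ?K" by (rule compact_closed_annulus)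
    have KA: "?K \<subseteq> ?A" using ab by (auto simp: annulus_def)
    have Kb: "?K \<in> sets borel" using K by (intro borel_closed compact_imp_closed)
    have "set_integrable lebesgue ?K u" using loc(1) K KA by (simp add: locally_integrable_on_def)
    moreover have "AE x in lborel. x \<in> ?K \<longrightarrow> u x = u1 x" using u1e by eventually_elim (use KA in auto)
    ultimately show "set_integrable lborel ?K u1"
      using set_integral_completion_AE(2)[OF Kb, of u1 u] Kb by simp
    fix \<psi> d :: "'a \<Rightarrow> real" assume \<psi>: "euler_C1 \<psi> d" and z: "\<And>x. norm x \<notin> {a..b} \<Longrightarrow> \<psi> x = 0"
    have "(LINT x:?A|lebesgue. d x / norm x ^ DIM('a) * u x) = - (LINT x:?A|lebesgue. \<psi> x / norm x ^ DIM('a) * (x \<bullet> g x))"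
      using r ab by (intro weak_radial_identity[OF wg \<psi> K KA]) (auto intro!: z)
    moreover have "(LINT x:?A|lebesgue. d x / norm x ^ DIM('a) * u x) = (LINT x:?A|lborel. d x / norm x ^ DIM('a) * u1 x)"
    proof (rule set_integral_completion_AE(1))
      have "(\<lambda>x. indicat_real ?A x *\<^sub>R (d x / norm x ^ DIM('a) * u1 x))
          = (\<lambda>x. indicat_real ?A x * ((indicator (- {0}) x *\<^sub>R d x) / norm x ^ DIM('a) * u1 x))"
        using r by (auto simp: indicator_def annulus_def)
      also have "\<dots> \<in> borel_measurable borel"
        using euler_C1_borel(2)[OF \<psi>] by measurable
      finally show "(\<lambda>x. indicat_real ?A x *\<^sub>R (d x / norm x ^ DIM('a) * u1 x)) \<in> borel_measurable borel" .
      show "AE x in lborel. x \<in> ?A \<longrightarrow> d x / norm x ^ DIM('a) * u x = d x / norm x ^ DIM('a) * u1 x"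
        using u1e by eventually_elim auto
    qed simp
    moreover have "(LINT x:?A|lebesgue. \<psi> x / norm x ^ DIM('a) * (x \<bullet> g x)) = (LINT x:?A|lborel. \<psi> x / norm x ^ DIM('a) * (norm x * h x))"
    proof (rule set_integral_completion_AE(1))
      have "(\<lambda>x. indicat_real ?A x *\<^sub>R (\<psi> x / norm x ^ DIM('a) * (norm x * h x)))
          = (\<lambda>x. indicat_real ?A x * ((indicator (- {0}) x *\<^sub>R \<psi> x) / norm x ^ DIM('a) * (norm x * h x)))"
        using r by (auto simp: indicator_def annulus_def)
      also have "\<dots> \<in> borel_measurable borel"
        using euler_C1_borel(1)[OF \<psi>] by measurable
      finally show "(\<lambda>x. indicat_real ?A x *\<^sub>R (\<psi> x / norm x ^ DIM('a) * (norm x * h x))) \<in> borel_measurable borel" .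
      show "AE x in lborel. x \<in> ?A \<longrightarrow> \<psi> x / norm x ^ DIM('a) * (x \<bullet> g x) = \<psi> x / norm x ^ DIM('a) * (norm x * h x)"
        using he
      proof eventually_elim
        case (elim x)
        show ?case
        proof
          assume x: "x \<in> ?A"
          then have "norm x \<noteq> 0" using r by (auto simp: annulus_def)
          then show "\<psi> x / norm x ^ DIM('a) * (x \<bullet> g x) = \<psi> x / norm x ^ DIM('a) * (norm x * h x)"
            using elim x by (auto simp: field_simps)
        qed
      qed
    qed simp
    ultimately show "(LINT x:?A|lborel. d x / norm x ^ DIM('a) * u1 x) = - (LINT x:?A|lborel. \<psi> x / norm x ^ DIM('a) * (norm x * h x))"
      by simp
  qed (use r h1 in auto)
  have vrep: "is_radial_rep r R u v"
    unfolding is_radial_rep_def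
  proof (intro conjI)
    show "v \<in> borel_measurable borel" by simp
    show "AE x in lebesgue. x \<in> ?A \<longrightarrow> v x = u x"
      by (rule AE_completion) (use v_eq_u u1e in eventually_elim, auto)
    show "AE \<omega> in sphere_measure. absolutely_continuous_on {r..R} (\<lambda>t. v (t *\<^sub>R \<omega>))"
      using v_primitive
    proof eventually_elim
      case (elim \<omega>)
      show ?case
        by (rule absolutely_continuous_on_primitive[where h="\<lambda>s. h (s *\<^sub>R \<omega>)" and v="\<lambda>t. v (t *\<^sub>R \<omega>)"])
           (use elim in blast)+
    qed
  qed
  have rep: "is_radial_rep r R u (radial_rep r R u)"
    unfolding radial_rep_def by (rule someI[of "is_radial_rep r R u", OF vrep])
  have "AE \<omega> in sphere_measure. (\<lambda>s. h (s *\<^sub>R \<omega>)) absolutely_integrable_on {r..R} \<and>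
      (\<forall>t\<in>{r..R}. radial_rep r R u (t *\<^sub>R \<omega>) = radial_rep r R u (r *\<^sub>R \<omega>) + integral {r..t} (\<lambda>s. h (s *\<^sub>R \<omega>)))"
    using v_primitive radial_rep_unique[OF r rep vrep]
  proof eventually_elim
    case (elim \<omega>)
    have e: "radial_rep r R u (t *\<^sub>R \<omega>) = v (t *\<^sub>R \<omega>)" if "t \<in> {r..R}" for t
      using elim(2) that by blast
    have "radial_rep r R u (t *\<^sub>R \<omega>) = radial_rep r R u (r *\<^sub>R \<omega>) + integral {r..t} (\<lambda>s. h (s *\<^sub>R \<omega>))" if "t \<in> {r..R}" for t
    proof -
      have "v (t *\<^sub>R \<omega>) = v (r *\<^sub>R \<omega>) + integral {r..t} (\<lambda>s. h (s *\<^sub>R \<omega>))" using elim(1) that by blast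
      then show ?thesis using e[OF that] e[of r] r by simp
    qed
    then show ?case using elim(1) by blast
  qed
  then show ?thesis by (rule that[OF h he[unfolded g_def] hp rep])
qed

section \<open>The inequality on a single ray\<close>

lemma lborel_slice_integral:
  fixes h :: "real \<Rightarrow> real"
  assumes h: "integrable lborel (\<lambda>t. indicator {a<..<b} t * h t)"
  shows "(LINT t|lborel. indicator {a<..<b} t * h t) = integral {a..b} h"
proof -
  have "(LINT t|lborel. indicator {a<..<b} t * h t) = integral UNIV (\<lambda>t. indicator {a<..<b} t * h t)"
    by (rule integral_unique[symmetric, OF has_integral_integral_lborel[OF h]])
  also have "\<dots> = integral UNIV (\<lambda>t. if t \<in> {a<..<b} then h t else 0)"
    by (intro integral_cong) (auto simp: indicator_def)
  also have "\<dots> = integral {a<..<b} h" by (rule integral_restrict_UNIV)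
  also have "\<dots> = integral {a..b} h" by (rule integral_open_interval_real[symmetric])
  finally show ?thesis .
qed

lemma continuous_slice_integrable:
  fixes k :: "real \<Rightarrow> real"
  assumes k: "continuous_on {a..b} k"
  shows "integrable lborel (\<lambda>t. indicator {a<..<b} t * k t)"
proof -
  have "integrable lborel (\<lambda>t. indicator {a..b} t *\<^sub>R k t)"
    by (rule borel_integrable_compact[OF _ k]) simp
  then have "set_integrable lborel {a..b} k" by (simp add: set_integrable_def)
  then have "set_integrable lborel {a<..<b} k" by (rule set_integrable_subset) auto
  then show ?thesis by (simp add: set_integrable_def)
qed

text \<open>
  Integrate the tangent inequality for \<open>y \<mapsto> y\<^sup>p\<close> at the mean \<open>c\<close> of \<open>|h|\<close>.
\<close>

lemma integral_powr_Jensen: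
  fixes h :: "real \<Rightarrow> real"
  assumes ab: "a < b" and p: "p > 1" and h: "h absolutely_integrable_on {a..b}"
    and hp: "(\<lambda>t. \<bar>h t\<bar> powr p) integrable_on {a..b}"
  shows "integral {a..b} (\<lambda>t. \<bar>h t\<bar>) powr p \<le> (b - a) powr (p - 1) * integral {a..b} (\<lambda>t. \<bar>h t\<bar> powr p)"
proof -
  define J where "J = integral {a..b} (\<lambda>t. \<bar>h t\<bar>)"
  \<comment> \<open>The mean of \<open>|h|\<close>, the point of tangency.\<close>
  define c where "c = J / (b - a)"
  have hi: "(\<lambda>t. \<bar>h t\<bar>) integrable_on {a..b}" using h by (simp add: absolutely_integrable_on_def)
  have J0: "J \<ge> 0" unfolding J_def by (intro Henstock_Kurzweil_Integration.integral_nonneg hi) auto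
  have c0: "c \<ge> 0" using J0 ab by (simp add: c_def)
  have "integral {a..b} (\<lambda>t. (p * c powr (p - 1)) * \<bar>h t\<bar>) \<le> integral {a..b} (\<lambda>t. (p - 1) * c powr p + \<bar>h t\<bar> powr p)"
  proof (rule integral_le)
    show "(\<lambda>t. (p * c powr (p - 1)) * \<bar>h t\<bar>) integrable_on {a..b}" using integrable_on_cmult_left[OF hi] by simp
    show "(\<lambda>t. (p - 1) * c powr p + \<bar>h t\<bar> powr p) integrable_on {a..b}" by (intro integrable_add hp) auto
    show "(p * c powr (p - 1)) * \<bar>h t\<bar> \<le> (p - 1) * c powr p + \<bar>h t\<bar> powr p" for t
      using powr_tangent_inequality[OF p c0, of "\<bar>h t\<bar>" 1] by simp
  qed
  moreover have "integral {a..b} (\<lambda>t. (p * c powr (p - 1)) * \<bar>h t\<bar>) = (p * c powr (p - 1)) * J"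
    unfolding J_def by (rule integral_mult_right)
  moreover have "integral {a..b} (\<lambda>t. (p - 1) * c powr p + \<bar>h t\<bar> powr p) = (p - 1) * c powr p * (b - a) + integral {a..b} (\<lambda>t. \<bar>h t\<bar> powr p)"
    using ab hp by (subst Henstock_Kurzweil_Integration.integral_add) auto
  ultimately have le: "(p * c powr (p - 1)) * J \<le> (p - 1) * c powr p * (b - a) + integral {a..b} (\<lambda>t. \<bar>h t\<bar> powr p)"
    by linarith
  have J: "J = c * (b - a)" using ab by (simp add: c_def)
  have "c powr (p - 1) * c = c powr p" using c0 by (cases "c = 0") (auto simp: powr_diff)
  then have "(p * c powr (p - 1)) * J = p * c powr p * (b - a)" by (simp add: J mult.assoc)
  with le have "c powr p * (b - a) \<le> integral {a..b} (\<lambda>t. \<bar>h t\<bar> powr p)" by (simp add: algebra_simps)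
  then have "(b - a) powr (p - 1) * (c powr p * (b - a)) \<le> (b - a) powr (p - 1) * integral {a..b} (\<lambda>t. \<bar>h t\<bar> powr p)"
    by (intro mult_left_mono) auto
  moreover have "(b - a) powr (p - 1) * (c powr p * (b - a)) = J powr p"
    using ab c0 by (simp add: J powr_mult powr_diff)
  ultimately show ?thesis by (simp add: J_def)
qed

text \<open>
  The heart of the proof. In \<open>powr_tangent_inequality\<close> the two numbers are \<open>G\<close> to the power \<open>1 / p\<close> times \<open>|v|\<close>
  and \<open>t\<close> to the power \<open>N / p\<close> times \<open>|h|\<close>; the assumption on \<open>|F|\<close> says that their product, with the first
  one raised to the power \<open>p - 1\<close>, is \<open>|F| |v|\<^sup>p\<^sup>-\<^sup>1 |h|\<close>.
\<close>

lemma ray_inequality: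
  fixes h v :: "real \<Rightarrow> real"
  assumes p: "p > 1" and r: "0 < r" and ab: "r < a" "a \<le> b" "b < R" and \<mu>: "\<mu> > 0"
    and h: "h absolutely_integrable_on {r..R}" and v: "\<And>t. t \<in> {r..R} \<Longrightarrow> v t = v r + integral {r..t} h"
    and hp: "integrable lborel (\<lambda>t. indicator {r<..<R} t * (t ^ N * \<bar>h t\<bar> powr p))"
    and F: "\<And>t. t \<in> {a..b} \<Longrightarrow> (F has_real_derivative - (p - 1) * G t) (at t)"
    and G: "continuous_on {a..b} G" "\<And>t. t \<in> {a..b} \<Longrightarrow> G t \<ge> 0"
    and FG: "\<And>t. t \<in> {a..b} \<Longrightarrow> \<bar>F t\<bar> = G t powr ((p - 1) / p) * t powr (real N / p)"
  shows "F b * \<bar>v b\<bar> powr p - F a * \<bar>v a\<bar> powr p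
      + (p - 1) * (1 - \<mu>) * (LINT t|lborel. indicator {a<..<b} t * (G t * \<bar>v t\<bar> powr p))
    \<le> \<mu> powr (1 - p) * (LINT t|lborel. indicator {r<..<R} t * (t ^ N * \<bar>h t\<bar> powr p))"
proof -
  have hi: "h integrable_on {r..R}" using h by (simp add: absolutely_integrable_on_def)
  have sub: "{a..b} \<subseteq> {r..R}" using ab by auto
  have hab: "h absolutely_integrable_on {a..b}" using h sub by (rule absolutely_integrable_on_subinterval)
  have vab: "v t = v a + integral {a..t} h" if "t \<in> {a..b}" for t
    using primitive_increment[OF hi v, of a t] that ab by auto
  have cv: "continuous_on {a..b} v"
    using primitive_continuous[OF hi v] sub by (rule continuous_on_subset)
  have ci: "continuous_on {a..b} (\<lambda>t. G t * \<bar>v t\<bar> powr p)"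
    using p by (intro continuous_intros G cv continuous_on_powr') auto
  have gi: "(\<lambda>t. G t * \<bar>v t\<bar> powr p) integrable_on {a..b}" by (rule integrable_continuous_real[OF ci])
  have gv: "(LINT t|lborel. indicator {a<..<b} t * (G t * \<bar>v t\<bar> powr p)) = integral {a..b} (\<lambda>t. G t * \<bar>v t\<bar> powr p)"
    by (rule lborel_slice_integral[OF continuous_slice_integrable[OF ci]])
  define E where "E t = t ^ N * \<bar>h t\<bar> powr p" for t
  have Ea: "E absolutely_integrable_on {r..R}"
    unfolding E_def by (rule lborel_slice_absolutely_integrable[OF hp])
  have Ei: "E integrable_on {r..R}" using Ea by (simp add: absolutely_integrable_on_def)
  have Eab: "E integrable_on {a..b}" by (rule integrable_subinterval_real[OF Ei sub])
  have Ele: "integral {a..b} E \<le> (LINT t|lborel. indicator {r<..<R} t * (t ^ N * \<bar>h t\<bar> powr p))"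
  proof -
    have "integral {a..b} E \<le> integral {r..R} E"
      using r by (intro integral_subset_le sub Eab Ei) (auto simp: E_def)
    also have "\<dots> = (LINT t|lborel. indicator {r<..<R} t * (t ^ N * \<bar>h t\<bar> powr p))"
      unfolding E_def by (rule lborel_slice_integral[OF hp, symmetric])
    finally show ?thesis .
  qed
  have "((\<lambda>t. - (p - 1) * G t * \<bar>v t\<bar> powr p + F t * (p * \<bar>v t\<bar> powr (p - 1) * sgn (v t)) * h t) has_integral
      (F b * \<bar>v b\<bar> powr p - F a * \<bar>v a\<bar> powr p)) {a..b}"
    by (rule chain_product_primitive[OF ab(2) hab vab F _ abs_powr_has_derivative[OF p] continuous_on_abs_powr_sgn[OF p]])
       (auto intro!: continuous_intros G)
  moreover have "((\<lambda>t. - ((p - 1) * (1 - \<mu>)) * (G t * \<bar>v t\<bar> powr p) + \<mu> powr (1 - p) * E t) has_integral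
     (- ((p - 1) * (1 - \<mu>)) * integral {a..b} (\<lambda>t. G t * \<bar>v t\<bar> powr p) + \<mu> powr (1 - p) * integral {a..b} E)) {a..b}"
    by (intro has_integral_add has_integral_mult_right integrable_integral gi Eab)
  ultimately have "F b * \<bar>v b\<bar> powr p - F a * \<bar>v a\<bar> powr p \<le>
     - ((p - 1) * (1 - \<mu>)) * integral {a..b} (\<lambda>t. G t * \<bar>v t\<bar> powr p) + \<mu> powr (1 - p) * integral {a..b} E"
  proof (rule has_integral_le)
    fix t assume t: "t \<in> {a..b}"
    have t0: "t > 0" using t ab r by auto
    have G0: "G t \<ge> 0" using G(2)[OF t] .
    let ?x = "G t powr (1 / p) * \<bar>v t\<bar>" and ?y = "t powr (real N / p) * \<bar>h t\<bar>"
    have "p * ?x powr (p - 1) * ?y \<le> (p - 1) * \<mu> * ?x powr p + \<mu> powr (1 - p) * ?y powr p"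
      by (rule powr_tangent_inequality[OF p _ _ \<mu>]) auto
    also have "?x powr p = G t * \<bar>v t\<bar> powr p"
      using p G0 by (simp add: powr_mult powr_powr)
    also have "?y powr p = E t"
      using p t0 by (simp add: E_def powr_mult powr_powr powr_realpow)
    also have "p * ?x powr (p - 1) * ?y = \<bar>F t\<bar> * (p * \<bar>v t\<bar> powr (p - 1)) * \<bar>h t\<bar>"
      using p by (simp add: FG[OF t] powr_mult powr_powr)
    finally have Y: "\<bar>F t\<bar> * (p * \<bar>v t\<bar> powr (p - 1)) * \<bar>h t\<bar> \<le> (p - 1) * \<mu> * (G t * \<bar>v t\<bar> powr p) + \<mu> powr (1 - p) * E t" .
    have "F t * (p * \<bar>v t\<bar> powr (p - 1) * sgn (v t)) * h t \<le> \<bar>F t * (p * \<bar>v t\<bar> powr (p - 1) * sgn (v t)) * h t\<bar>"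
      by (rule abs_ge_self)
    also have "\<dots> = \<bar>F t\<bar> * (p * \<bar>v t\<bar> powr (p - 1)) * \<bar>h t\<bar> * \<bar>sgn (v t)\<bar>"
      using p by (simp add: abs_mult)
    also have "\<dots> \<le> \<bar>F t\<bar> * (p * \<bar>v t\<bar> powr (p - 1)) * \<bar>h t\<bar>"
      using p by (intro mult_left_le) (auto simp: sgn_real_def)
    finally show "- (p - 1) * G t * \<bar>v t\<bar> powr p + F t * (p * \<bar>v t\<bar> powr (p - 1) * sgn (v t)) * h t
       \<le> - ((p - 1) * (1 - \<mu>)) * (G t * \<bar>v t\<bar> powr p) + \<mu> powr (1 - p) * E t"
      using Y by (simp add: algebra_simps)
  qed
  moreover have "\<mu> powr (1 - p) * integral {a..b} E \<le> \<mu> powr (1 - p) * (LINT t|lborel. indicator {r<..<R} t * (t ^ N * \<bar>h t\<bar> powr p))"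
    using Ele by (intro mult_left_mono) auto
  ultimately show ?thesis unfolding gv by (simp only: mult_minus_left)
qed

section \<open>Integration over the sphere\<close>

text \<open>
  \<open>V\<close> is the radial representative and \<open>h\<close> its radial derivative. Finite \<open>p\<close>-mass on one sphere is all that is
  extracted from the class \<open>M\<^sub>i\<close> at this point; on the other spheres it follows.
\<close>

locale radial_family =
  fixes r R p :: real and V h :: "'a::euclidean_space \<Rightarrow> real"
  assumes r: "0 < r" "r < R" and p: "p > 1"
    and V_borel [measurable]: "V \<in> borel_measurable borel"
    and h_borel [measurable]: "h \<in> borel_measurable borel"
    and hp: "set_integrable lborel (annulus r R) (\<lambda>x. \<bar>h x\<bar> powr p)"
    and primitive: "AE \<omega> in sphere_measure. (\<lambda>s. h (s *\<^sub>R \<omega>)) absolutely_integrable_on {r..R} \<and>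
      (\<forall>t\<in>{r..R}. V (t *\<^sub>R \<omega>) = V (r *\<^sub>R \<omega>) + integral {r..t} (\<lambda>s. h (s *\<^sub>R \<omega>)))"
    and finite_mass: "\<exists>\<rho>\<in>{r..R}. integrable sphere_measure (\<lambda>\<omega>. \<bar>V (\<rho> *\<^sub>R \<omega>)\<bar> powr p)"
begin

definition E :: "'a \<Rightarrow> real" where
  "E \<omega> = (LINT t|lborel. indicator {r<..<R} t * (t ^ (DIM('a) - 1) * \<bar>h (t *\<^sub>R \<omega>)\<bar> powr p))"

definition energy :: real where "energy = (LINT x:annulus r R|lborel. \<bar>h x\<bar> powr p)"

lemma E_cylinder: "integrable cylinder_measure (\<lambda>z. indicator {r<..<R} (fst z) * (fst z ^ (DIM('a) - 1) * \<bar>h (fst z *\<^sub>R snd z)\<bar> powr p))"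
  using hp polar_integrable[of "\<lambda>x. \<bar>h x\<bar> powr p" r R] r by (simp add: mult.assoc)

lemma E_ray: "AE \<omega> in sphere_measure. integrable lborel (\<lambda>t. indicator {r<..<R} t * (t ^ (DIM('a) - 1) * \<bar>h (t *\<^sub>R \<omega>)\<bar> powr p))"
  using cylinder_slices(1)[OF E_cylinder] by simp

lemma E_integrable: "integrable sphere_measure E"
  using cylinder_slices(2)[OF E_cylinder] by (simp add: E_def[abs_def])

lemma E_integral: "(LINT \<omega>|sphere_measure. E \<omega>) = energy"
  using cylinder_slices(3)[OF E_cylinder] polar_integral[of "\<lambda>x. \<bar>h x\<bar> powr p" r R] r
  by (simp add: E_def[abs_def] energy_def mult.assoc)

definition mass :: "real \<Rightarrow> real" where "mass t = (LINT \<omega>|sphere_measure. \<bar>V (t *\<^sub>R \<omega>)\<bar> powr p)"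

lemma V_ray_measurable [measurable]: "(\<lambda>\<omega>. V (t *\<^sub>R \<omega>)) \<in> borel_measurable borel"
  by measurable

text \<open>
  The value at radius \<open>t\<close> differs from the value at the good radius \<open>\<rho>\<close> by at most the integral of \<open>|h|\<close> along the
  ray, whose \<open>p\<close>-th power is bounded by the energy of the ray. The majorant does not depend on \<open>t\<close>, which makes
  \<open>mass\<close> continuous by dominated convergence.
\<close>

lemma V_dominated:
  obtains D where "integrable sphere_measure D"
    and "AE \<omega> in sphere_measure. \<forall>t\<in>{r..R}. \<bar>V (t *\<^sub>R \<omega>)\<bar> powr p \<le> D \<omega>"
proof -
  obtain \<rho> where \<rho>: "\<rho> \<in> {r..R}" "integrable sphere_measure (\<lambda>\<omega>. \<bar>V (\<rho> *\<^sub>R \<omega>)\<bar> powr p)"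
    using finite_mass by blast
  define C where "C = (R - r) powr (p - 1) * inverse (r ^ (DIM('a) - 1))"
  define D where "D \<omega> = 2 powr p * (\<bar>V (\<rho> *\<^sub>R \<omega>)\<bar> powr p + C * E \<omega>)" for \<omega>
  have "integrable sphere_measure D" unfolding D_def
    by (intro integrable_mult_right Bochner_Integration.integrable_add \<rho> E_integrable)
  moreover have "AE \<omega> in sphere_measure. \<forall>t\<in>{r..R}. \<bar>V (t *\<^sub>R \<omega>)\<bar> powr p \<le> D \<omega>"
    using primitive E_ray
  proof eventually_elim
    case (elim \<omega>)
    show ?case
    proof
      fix t assume t: "t \<in> {r..R}"
      let ?h = "\<lambda>s. h (s *\<^sub>R \<omega>)"
      have ha: "?h absolutely_integrable_on {r..R}" using elim by blast
      have hi: "?h integrable_on {r..R}" "(\<lambda>s. \<bar>?h s\<bar>) integrable_on {r..R}"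
        using ha by (auto simp: absolutely_integrable_on_def)
      define J where "J = integral {r..R} (\<lambda>s. \<bar>?h s\<bar>)"
      have inc: "\<bar>V (b *\<^sub>R \<omega>) - V (a *\<^sub>R \<omega>)\<bar> \<le> J" if "r \<le> a" "a \<le> b" "b \<le> R" for a b
      proof -
        have sub: "{a..b} \<subseteq> {r..R}" using that by auto
        have "V (b *\<^sub>R \<omega>) - V (a *\<^sub>R \<omega>) = integral {a..b} ?h"
          by (rule primitive_increment[OF hi(1) _ that]) (use elim in blast)
        also have "norm \<dots> \<le> integral {a..b} (\<lambda>s. \<bar>?h s\<bar>)"
          using hi integrable_subinterval_real[OF _ sub] by (intro integral_norm_bound_integral) auto
        also have "\<dots> \<le> J" unfolding J_def
          using hi integrable_subinterval_real[OF _ sub] by (intro integral_subset_le sub) auto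
        finally show ?thesis by simp
      qed
      have Vt: "\<bar>V (t *\<^sub>R \<omega>)\<bar> \<le> \<bar>V (\<rho> *\<^sub>R \<omega>)\<bar> + J"
        using inc[of t \<rho>] inc[of \<rho> t] t \<rho> by (cases "t \<le> \<rho>") auto
      have J0: "J \<ge> 0" unfolding J_def using hi by (intro Henstock_Kurzweil_Integration.integral_nonneg) auto
      have ea: "(\<lambda>t. t ^ (DIM('a) - 1) * \<bar>?h t\<bar> powr p) absolutely_integrable_on {r..R}"
        by (rule lborel_slice_absolutely_integrable) (use elim in simp)
      have ei: "(\<lambda>t. t ^ (DIM('a) - 1) * \<bar>?h t\<bar> powr p) integrable_on {r..R}" using ea by (simp add: absolutely_integrable_on_def)
      have "(\<lambda>t. inverse (t ^ (DIM('a) - 1)) * (t ^ (DIM('a) - 1) * \<bar>?h t\<bar> powr p)) absolutely_integrable_on {r..R}"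
        using r by (intro abs_integrable_continuous_mult ea continuous_intros) auto
      then have "(\<lambda>t. inverse (t ^ (DIM('a) - 1)) * (t ^ (DIM('a) - 1) * \<bar>?h t\<bar> powr p)) integrable_on {r..R}"
        by (simp add: absolutely_integrable_on_def)
      then have hpi: "(\<lambda>t. \<bar>?h t\<bar> powr p) integrable_on {r..R}"
        by (rule integrable_eq) (use r in auto)
      have "J powr p \<le> (R - r) powr (p - 1) * integral {r..R} (\<lambda>t. \<bar>?h t\<bar> powr p)"
        unfolding J_def by (rule integral_powr_Jensen[OF r(2) p ha hpi])
      also have "integral {r..R} (\<lambda>t. \<bar>?h t\<bar> powr p) \<le> integral {r..R} (\<lambda>t. inverse (r ^ (DIM('a) - 1)) * (t ^ (DIM('a) - 1) * \<bar>?h t\<bar> powr p))"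
      proof (rule integral_le[OF hpi])
        show "(\<lambda>t. inverse (r ^ (DIM('a) - 1)) * (t ^ (DIM('a) - 1) * \<bar>?h t\<bar> powr p)) integrable_on {r..R}"
          using integrable_on_cmult_left[OF ei] by simp
        fix s assume s: "s \<in> {r..R}"
        have "1 \<le> inverse (r ^ (DIM('a) - 1)) * s ^ (DIM('a) - 1)" using r s power_mono[of r s "DIM('a) - 1"] by (simp add: field_simps)
        then have "1 * \<bar>?h s\<bar> powr p \<le> inverse (r ^ (DIM('a) - 1)) * s ^ (DIM('a) - 1) * \<bar>?h s\<bar> powr p" by (intro mult_right_mono) auto
        then show "\<bar>?h s\<bar> powr p \<le> inverse (r ^ (DIM('a) - 1)) * (s ^ (DIM('a) - 1) * \<bar>?h s\<bar> powr p)" by (simp add: mult.assoc)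
      qed
      also have "integral {r..R} (\<lambda>t. inverse (r ^ (DIM('a) - 1)) * (t ^ (DIM('a) - 1) * \<bar>?h t\<bar> powr p)) = inverse (r ^ (DIM('a) - 1)) * E \<omega>"
        unfolding E_def using lborel_slice_integral[of r R "\<lambda>t. t ^ (DIM('a) - 1) * \<bar>?h t\<bar> powr p"] elim by simp
      finally have JE: "J powr p \<le> C * E \<omega>" by (simp add: C_def mult.assoc mult_left_mono)
      have "\<bar>V (t *\<^sub>R \<omega>)\<bar> powr p \<le> (2 * max \<bar>V (\<rho> *\<^sub>R \<omega>)\<bar> J) powr p"
        using Vt p by (intro powr_mono2) auto
      also have "\<dots> = 2 powr p * max \<bar>V (\<rho> *\<^sub>R \<omega>)\<bar> J powr p" using J0 by (simp add: powr_mult)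
      also have "max \<bar>V (\<rho> *\<^sub>R \<omega>)\<bar> J powr p \<le> \<bar>V (\<rho> *\<^sub>R \<omega>)\<bar> powr p + J powr p"
        by (simp add: max_def)
      finally have "\<bar>V (t *\<^sub>R \<omega>)\<bar> powr p \<le> 2 powr p * (\<bar>V (\<rho> *\<^sub>R \<omega>)\<bar> powr p + J powr p)" by simp
      also have "\<dots> \<le> D \<omega>" unfolding D_def using JE by (intro mult_left_mono add_left_mono) auto
      finally show "\<bar>V (t *\<^sub>R \<omega>)\<bar> powr p \<le> D \<omega>" .
    qed
  qed
  ultimately show ?thesis by (rule that)
qed

lemma mass_integrable:
  assumes t: "t \<in> {r..R}" shows "integrable sphere_measure (\<lambda>\<omega>. \<bar>V (t *\<^sub>R \<omega>)\<bar> powr p)"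
proof -
  obtain D where D: "integrable sphere_measure D" "AE \<omega> in sphere_measure. \<forall>t\<in>{r..R}. \<bar>V (t *\<^sub>R \<omega>)\<bar> powr p \<le> D \<omega>"
    by (rule V_dominated)
  show ?thesis
  proof (rule Bochner_Integration.integrable_bound[OF D(1)])
    show "AE \<omega> in sphere_measure. norm (\<bar>V (t *\<^sub>R \<omega>)\<bar> powr p) \<le> norm (D \<omega>)"
      using D(2) by eventually_elim (use t in force)
  qed measurable
qed

lemma mass_nonneg: "mass t \<ge> 0" unfolding mass_def by (intro Bochner_Integration.integral_nonneg) simp

lemma mass_continuous: "continuous_on {r..R} mass"
proof -
  obtain D where D: "integrable sphere_measure D" "AE \<omega> in sphere_measure. \<forall>t\<in>{r..R}. \<bar>V (t *\<^sub>R \<omega>)\<bar> powr p \<le> D \<omega>"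
    by (rule V_dominated)
  show ?thesis unfolding continuous_on_sequentially
  proof (intro allI ballI impI)
    fix x :: "nat \<Rightarrow> real" and a assume a: "a \<in> {r..R}" and x: "(\<forall>n. x n \<in> {r..R}) \<and> x \<longlonglongrightarrow> a"
    show "(mass \<circ> x) \<longlonglongrightarrow> mass a"
      unfolding mass_def comp_def
    proof (rule integral_dominated_convergence[OF _ _ D(1)])
      show "AE \<omega> in sphere_measure. (\<lambda>n. \<bar>V (x n *\<^sub>R \<omega>)\<bar> powr p) \<longlonglongrightarrow> \<bar>V (a *\<^sub>R \<omega>)\<bar> powr p"
        using primitive
      proof eventually_elim
        case (elim \<omega>)
        have "continuous_on {r..R} (\<lambda>t. V (t *\<^sub>R \<omega>))"
          by (rule primitive_continuous[where h="\<lambda>s. h (s *\<^sub>R \<omega>)"]) (use elim absolutely_integrable_on_def in blast)+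
        then have "(\<lambda>n. V (x n *\<^sub>R \<omega>)) \<longlonglongrightarrow> V (a *\<^sub>R \<omega>)"
          using a x unfolding continuous_on_sequentially comp_def by blast
        then show ?case using p by (intro tendsto_powr' tendsto_rabs) auto
      qed
      show "AE \<omega> in sphere_measure. norm (\<bar>V (x n *\<^sub>R \<omega>)\<bar> powr p) \<le> D \<omega>" for n
        using D(2) by eventually_elim (use x in auto)
    qed measurable
  qed
qed

end

text \<open>
  \<open>F\<close> is the flux and \<open>G\<close> the density of \<open>K1\<close> in polar coordinates, both including the Jacobian. Since
  \<open>F b * mass b - F a * mass a\<close> is the boundary term for \<open>ball 0 b - ball 0 a\<close>, \<open>\<kappa>0\<close> is the value of \<open>K0\<close>.
\<close>

locale radial_flux = radial_family +
  fixes F G :: "real \<Rightarrow> real" and \<kappa>0 :: real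
  assumes F: "\<And>t. r < t \<Longrightarrow> t < R \<Longrightarrow> (F has_real_derivative - (p - 1) * G t) (at t)"
    and G_cont: "continuous_on {r<..<R} G" and G_nonneg: "\<And>t. r < t \<Longrightarrow> t < R \<Longrightarrow> G t \<ge> 0"
    and FG: "\<And>t. r < t \<Longrightarrow> t < R \<Longrightarrow> \<bar>F t\<bar> = G t powr ((p - 1) / p) * t powr (real (DIM('a) - 1) / p)"
    and flux_limit: "((\<lambda>(a, b). F b * mass b - F a * mass a) \<longlongrightarrow> \<kappa>0) (at_right r \<times>\<^sub>F at_left R)"
    and kappa0_nonneg: "\<kappa>0 \<ge> 0"
begin

definition q :: "real \<times> 'a \<Rightarrow> real" where "q z = G (fst z) * \<bar>V (fst z *\<^sub>R snd z)\<bar> powr p"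

lemma q_cutoff_measurable [measurable]:
  assumes "r < a" "b < R"
  shows "(\<lambda>z. indicator {a<..<b} (fst z) * q z) \<in> borel_measurable (borel \<Otimes>\<^sub>M borel)"
proof -
  have "continuous_on {a<..<b} G" by (rule continuous_on_subset[OF G_cont]) (use assms in auto)
  then have [measurable]: "(\<lambda>t. indicator {a<..<b} t *\<^sub>R G t) \<in> borel_measurable borel"
    by (intro borel_measurable_continuous_on_indicator) auto
  have "(\<lambda>z. (indicator {a<..<b} (fst z) *\<^sub>R G (fst z)) * \<bar>V (fst z *\<^sub>R snd z)\<bar> powr p) \<in> borel_measurable (borel \<Otimes>\<^sub>M (borel :: 'a measure))"
    by measurable
  then show ?thesis by (simp add: q_def mult.assoc)
qed

lemma q_cutoff_integrable:
  assumes ab: "r < a" "b < R"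
  shows "integrable cylinder_measure (\<lambda>z. indicator {a<..<b} (fst z) * q z)"
proof -
  interpret pair_sigma_finite "lborel :: real measure" "sphere_measure :: 'a measure"
    by (rule pair_sigma_finite_lborel_sphere)
  obtain D where D: "integrable sphere_measure D" "AE \<omega> in sphere_measure. \<forall>t\<in>{r..R}. \<bar>V (t *\<^sub>R \<omega>)\<bar> powr p \<le> D \<omega>"
    by (rule V_dominated)
  have cG: "continuous_on {a..b} G" by (rule continuous_on_subset[OF G_cont]) (use ab in auto)
  have "integrable cylinder_measure (\<lambda>z. (indicator {a<..<b} (fst z) * G (fst z)) * D (snd z))"
    by (rule cylinder_product(1)[OF continuous_slice_integrable[OF cG] D(1)])
  then show ?thesis
  proof (rule Bochner_Integration.integrable_bound)
    show "(\<lambda>z. indicator {a<..<b} (fst z) * q z) \<in> borel_measurable cylinder_measure"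
      using q_cutoff_measurable[OF ab] by simp
    have [measurable]: "D \<in> borel_measurable borel" using D(1) by auto
    have "AE z in cylinder_measure. indicator {a<..<b} (fst z) * \<bar>V (fst z *\<^sub>R snd z)\<bar> powr p \<le> indicator {a<..<b} (fst z) * D (snd z)"
    proof (subst AE_pair_iff[symmetric, where P="\<lambda>t \<omega>. indicator {a<..<b} t * \<bar>V (t *\<^sub>R \<omega>)\<bar> powr p \<le> indicator {a<..<b} t * D \<omega>"])
      show "AE t in lborel. AE \<omega> in sphere_measure. indicator {a<..<b} t * \<bar>V (t *\<^sub>R \<omega>)\<bar> powr p \<le> indicator {a<..<b} t * D \<omega>"
      proof (rule AE_I2)
        fix t :: real
        show "AE \<omega> in sphere_measure. indicator {a<..<b} t * \<bar>V (t *\<^sub>R \<omega>)\<bar> powr p \<le> indicator {a<..<b} t * D \<omega>"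
          using D(2) by eventually_elim (use ab in \<open>auto simp: indicator_def\<close>)
      qed
    qed measurable
    then show "AE z in cylinder_measure. norm (indicator {a<..<b} (fst z) * q z) \<le> norm (indicator {a<..<b} (fst z) * G (fst z) * D (snd z))"
    proof eventually_elim
      case (elim z)
      show ?case
      proof (cases "fst z \<in> {a<..<b}")
        case True
        then have "G (fst z) \<ge> 0" using ab by (intro G_nonneg) auto
        moreover have "\<bar>V (fst z *\<^sub>R snd z)\<bar> powr p \<le> \<bar>D (snd z)\<bar>" using elim True by simp
        ultimately show ?thesis using True by (simp add: q_def abs_mult mult_left_mono)
      qed simp
    qed
  qed
qed

definition \<kappa> :: "real \<Rightarrow> real \<Rightarrow> real" where "\<kappa> a b = (LINT z|cylinder_measure. indicator {a<..<b} (fst z) * q z)"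

lemma truncated_inequality:
  assumes ab: "r < a" "a \<le> b" "b < R" and \<mu>: "\<mu> > 0"
  shows "F b * mass b - F a * mass a + (p - 1) * (1 - \<mu>) * \<kappa> a b \<le> \<mu> powr (1 - p) * energy"
proof -
  note Q = q_cutoff_integrable[OF ab(1,3)]
  have Qi: "integrable sphere_measure (\<lambda>\<omega>. LINT t|lborel. indicator {a<..<b} t * (G t * \<bar>V (t *\<^sub>R \<omega>)\<bar> powr p))"
    using cylinder_slices(2)[OF Q] by (simp add: q_def)
  have KQ: "\<kappa> a b = (LINT \<omega>|sphere_measure. (LINT t|lborel. indicator {a<..<b} t * (G t * \<bar>V (t *\<^sub>R \<omega>)\<bar> powr p)))"
    using cylinder_slices(3)[OF Q] by (simp add: q_def \<kappa>_def)
  have mi: "integrable sphere_measure (\<lambda>\<omega>. \<bar>V (a *\<^sub>R \<omega>)\<bar> powr p)" "integrable sphere_measure (\<lambda>\<omega>. \<bar>V (b *\<^sub>R \<omega>)\<bar> powr p)"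
    using ab by (auto intro!: mass_integrable)
  have "F b * mass b - F a * mass a + (p - 1) * (1 - \<mu>) * \<kappa> a b =
     (LINT \<omega>|sphere_measure. F b * \<bar>V (b *\<^sub>R \<omega>)\<bar> powr p - F a * \<bar>V (a *\<^sub>R \<omega>)\<bar> powr p
      + (p - 1) * (1 - \<mu>) * (LINT t|lborel. indicator {a<..<b} t * (G t * \<bar>V (t *\<^sub>R \<omega>)\<bar> powr p)))"
    unfolding mass_def KQ using mi Qi by simp
  also have "\<dots> \<le> (LINT \<omega>|sphere_measure. \<mu> powr (1 - p) * E \<omega>)"
  proof (rule integral_mono_AE)
    show "integrable sphere_measure (\<lambda>\<omega>. F b * \<bar>V (b *\<^sub>R \<omega>)\<bar> powr p - F a * \<bar>V (a *\<^sub>R \<omega>)\<bar> powr p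
      + (p - 1) * (1 - \<mu>) * (LINT t|lborel. indicator {a<..<b} t * (G t * \<bar>V (t *\<^sub>R \<omega>)\<bar> powr p)))"
      using mi Qi by simp
    show "integrable sphere_measure (\<lambda>\<omega>. \<mu> powr (1 - p) * E \<omega>)" using E_integrable by simp
    show "AE \<omega> in sphere_measure. F b * \<bar>V (b *\<^sub>R \<omega>)\<bar> powr p - F a * \<bar>V (a *\<^sub>R \<omega>)\<bar> powr p
      + (p - 1) * (1 - \<mu>) * (LINT t|lborel. indicator {a<..<b} t * (G t * \<bar>V (t *\<^sub>R \<omega>)\<bar> powr p)) \<le> \<mu> powr (1 - p) * E \<omega>"
      using primitive E_ray
    proof eventually_elim
      case (elim \<omega>)
      have prim: "V (t *\<^sub>R \<omega>) = V (r *\<^sub>R \<omega>) + integral {r..t} (\<lambda>s. h (s *\<^sub>R \<omega>))" if "t \<in> {r..R}" for t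
        using elim(1) that by blast
      show ?case unfolding E_def
      proof (rule ray_inequality[where h="\<lambda>t. h (t *\<^sub>R \<omega>)" and v="\<lambda>t. V (t *\<^sub>R \<omega>)", OF p r(1) ab \<mu> _ prim elim(2)])
        show "(\<lambda>s. h (s *\<^sub>R \<omega>)) absolutely_integrable_on {r..R}" using elim(1) by blast
        show "continuous_on {a..b} G" by (rule continuous_on_subset[OF G_cont]) (use ab in auto)
        show "(F has_real_derivative - (p - 1) * G t) (at t)" if "t \<in> {a..b}" for t
          using that ab by (intro F) auto
        show "G t \<ge> 0" if "t \<in> {a..b}" for t
          using that ab by (intro G_nonneg) auto
        show "\<bar>F t\<bar> = G t powr ((p - 1) / p) * t powr (real (DIM('a) - 1) / p)" if "t \<in> {a..b}" for t
          using that ab by (intro FG) auto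
      qed
    qed
  qed
  also have "\<dots> = \<mu> powr (1 - p) * energy" using E_integrable by (simp add: E_integral)
  finally show ?thesis .
qed

lemma truncation_sequence:
  obtains a b :: "nat \<Rightarrow> real" where "\<And>k. r < a k" "\<And>k. a k \<le> b k" "\<And>k. b k < R" "decseq a" "incseq b" "a \<longlonglongrightarrow> r" "b \<longlonglongrightarrow> R"
    "(\<lambda>k. F (b k) * mass (b k) - F (a k) * mass (a k)) \<longlonglongrightarrow> \<kappa>0"
proof -
  obtain e :: "nat \<Rightarrow> real" where e: "\<And>n. 0 < e n" "\<And>n. 2 * e n \<le> R - r" and dec: "decseq e" and lim: "e \<longlonglongrightarrow> 0"
    by (rule shrinking_margin[OF r(2)]) (rule that)
  have la: "(\<lambda>k. r + e k) \<longlonglongrightarrow> r" using tendsto_add[OF tendsto_const lim, of r] by simp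
  have lb: "(\<lambda>k. R - e k) \<longlonglongrightarrow> R" using tendsto_diff[OF tendsto_const lim, of R] by simp
  have fa: "filterlim (\<lambda>k. r + e k) (at_right r) sequentially"
    using la e by (auto simp: filterlim_at less_imp_neq[symmetric] intro!: always_eventually)
  have fb: "filterlim (\<lambda>k. R - e k) (at_left R) sequentially"
    using lb e by (auto simp: filterlim_at less_imp_neq[symmetric] intro!: always_eventually)
  have "filterlim (\<lambda>k. (r + e k, R - e k)) (at_right r \<times>\<^sub>F at_left R) sequentially"
    by (rule filterlim_Pair[OF fa fb])
  from filterlim_compose[OF flux_limit this]
  have "(\<lambda>k. F (R - e k) * mass (R - e k) - F (r + e k) * mass (r + e k)) \<longlonglongrightarrow> \<kappa>0" by simp
  then show ?thesis
    by (intro that[of "\<lambda>k. r + e k" "\<lambda>k. R - e k"] la lb)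
       (use e dec in \<open>auto simp: decseq_def incseq_def algebra_simps\<close>)
qed

lemma energy_nonneg: "energy \<ge> 0"
  unfolding energy_def set_lebesgue_integral_def by (intro Bochner_Integration.integral_nonneg) simp

definition \<kappa>1 :: real where "\<kappa>1 = (LINT z|cylinder_measure. indicator {r<..<R} (fst z) * q z)"

text \<open>
  The boundary terms converge, so they are eventually above \<open>-1\<close>, and \<open>\<mu> = 1/2\<close> leaves a positive coefficient in
  front of the truncated integrals. These are therefore bounded, and monotone convergence applies.
\<close>

lemma kappa1_integrable: "integrable cylinder_measure (\<lambda>z. indicator {r<..<R} (fst z) * q z)"
  and kappa1_inequality: "\<mu> > 0 \<Longrightarrow> \<kappa>0 + (p - 1) * (1 - \<mu>) * \<kappa>1 \<le> \<mu> powr (1 - p) * energy"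
proof -
  obtain a b :: "nat \<Rightarrow> real" where ab: "\<And>k. r < a k" "\<And>k. a k \<le> b k" "\<And>k. b k < R" "decseq a" "incseq b" "a \<longlonglongrightarrow> r" "b \<longlonglongrightarrow> R"
    and lim: "(\<lambda>k. F (b k) * mass (b k) - F (a k) * mass (a k)) \<longlonglongrightarrow> \<kappa>0"
    by (rule truncation_sequence) (rule that)
  define f where "f k z = indicator {a k<..<b k} (fst z) * q z" for k z
  have fi: "integrable cylinder_measure (f k)" for k
    unfolding f_def by (rule q_cutoff_integrable[OF ab(1,3)])
  have q0: "r < fst z \<Longrightarrow> fst z < R \<Longrightarrow> q z \<ge> 0" for z unfolding q_def using G_nonneg by simp
  have mono: "f i z \<le> f j z" if "i \<le> j" for i j z
  proof -
    have "a j \<le> a i" "b i \<le> b j" using that ab by (auto simp: decseq_def incseq_def)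
    moreover have "q z \<ge> 0" if "fst z \<in> {a j<..<b j}" using that q0[of z] ab(1)[of j] ab(3)[of j] by auto
    ultimately show ?thesis unfolding f_def by (auto simp: indicator_def)
  qed
  have KK: "\<kappa> (a k) (b k) = (LINT z|cylinder_measure. f k z)" for k by (simp add: \<kappa>_def f_def)
  have inc: "incseq (\<lambda>k. \<kappa> (a k) (b k))"
    unfolding incseq_def KK using mono fi by (auto intro!: integral_mono)
  have lim_pt: "(\<lambda>k. f k z) \<longlonglongrightarrow> indicator {r<..<R} (fst z) * q z" for z
  proof (cases "r < fst z \<and> fst z < R")
    case True
    have "eventually (\<lambda>k. a k < fst z) sequentially" by (rule order_tendstoD(2)[OF ab(6)]) (use True in simp)
    moreover have "eventually (\<lambda>k. fst z < b k) sequentially" by (rule order_tendstoD(1)[OF ab(7)]) (use True in simp)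
    ultimately have "eventually (\<lambda>k. f k z = indicator {r<..<R} (fst z) * q z) sequentially"
      by eventually_elim (use True in \<open>simp add: f_def\<close>)
    then show ?thesis by (rule tendsto_eventually)
  next
    case False
    then have "f k z = indicator {r<..<R} (fst z) * q z" for k
      using ab(1)[of k] ab(3)[of k] by (auto simp: f_def indicator_def)
    then show ?thesis by simp
  qed
  have bound: "\<exists>B. \<forall>k. \<kappa> (a k) (b k) \<le> B"
  proof -
    have "eventually (\<lambda>k. F (b k) * mass (b k) - F (a k) * mass (a k) > -1) sequentially"
      by (rule order_tendstoD(1)[OF lim]) (use kappa0_nonneg in simp)
    then obtain k0 where k0: "\<And>k. k \<ge> k0 \<Longrightarrow> F (b k) * mass (b k) - F (a k) * mass (a k) > -1"
      by (auto simp: eventually_sequentially)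
    define B where "B = ((1/2) powr (1 - p) * energy + 1) / ((p - 1) / 2)"
    have B: "\<kappa> (a k) (b k) \<le> B" if "k \<ge> k0" for k
    proof -
      have "(p - 1) / 2 * \<kappa> (a k) (b k) \<le> (1/2) powr (1 - p) * energy + 1"
        using truncated_inequality[OF ab(1-3)[of k], of "1/2"] k0[OF that] by simp
      then show ?thesis unfolding B_def using p by (subst pos_le_divide_eq) (auto simp: mult.commute)
    qed
    have "\<kappa> (a k) (b k) \<le> B" for k
    proof -
      have "\<kappa> (a k) (b k) \<le> \<kappa> (a (max k k0)) (b (max k k0))" using inc unfolding incseq_def by simp
      also have "\<dots> \<le> B" by (rule B) simp
      finally show ?thesis .
    qed
    then show ?thesis by blast
  qed
  then obtain B where B: "\<And>k. \<kappa> (a k) (b k) \<le> B" by blast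
  obtain x where x: "(\<lambda>k. \<kappa> (a k) (b k)) \<longlonglongrightarrow> x"
    by (rule incseq_convergent[OF inc, of B]) (use B in auto)
  have qm: "(\<lambda>z. indicator {r<..<R} (fst z) * q z) \<in> borel_measurable cylinder_measure"
    by (rule borel_measurable_LIMSEQ_real[OF lim_pt]) (use fi in auto)
  have I: "integrable cylinder_measure (\<lambda>z. indicator {r<..<R} (fst z) * q z)"
    by (rule integrable_monotone_convergence[OF fi _ _ x[unfolded KK] qm])
       (use mono lim_pt in \<open>auto simp: mono_def intro!: AE_I2\<close>)
  have "(LINT z|cylinder_measure. indicator {r<..<R} (fst z) * q z) = x"
    by (rule integral_monotone_convergence[OF fi _ _ x[unfolded KK] qm])
       (use mono lim_pt in \<open>auto simp: mono_def intro!: AE_I2\<close>)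
  then have kappa1x: "\<kappa>1 = x" by (simp add: \<kappa>1_def)
  show "integrable cylinder_measure (\<lambda>z. indicator {r<..<R} (fst z) * q z)" by (rule I)
  show "\<kappa>0 + (p - 1) * (1 - \<mu>) * \<kappa>1 \<le> \<mu> powr (1 - p) * energy" if \<mu>: "\<mu> > 0"
  proof (rule LIMSEQ_le_const2)
    show "(\<lambda>k. F (b k) * mass (b k) - F (a k) * mass (a k) + (p - 1) * (1 - \<mu>) * \<kappa> (a k) (b k)) \<longlonglongrightarrow> \<kappa>0 + (p - 1) * (1 - \<mu>) * \<kappa>1"
      unfolding kappa1x by (intro tendsto_intros lim x)
    show "\<exists>N. \<forall>n\<ge>N. F (b n) * mass (b n) - F (a n) * mass (a n) + (p - 1) * (1 - \<mu>) * \<kappa> (a n) (b n) \<le> \<mu> powr (1 - p) * energy"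
      using truncated_inequality[OF ab(1-3) \<mu>] by blast
  qed
qed

lemma kappa1_nonneg: "\<kappa>1 \<ge> 0"
  unfolding \<kappa>1_def by (intro Bochner_Integration.integral_nonneg) (auto simp: indicator_def q_def G_nonneg)

lemma flux_inequality:
  "energy \<ge> (1 / p) powr p * ((\<kappa>0 + (p - 1) * \<kappa>1) powr p / \<kappa>1 powr (p - 1))"
proof -
  let ?X = "\<kappa>0 + (p - 1) * \<kappa>1"
  have X0: "?X \<ge> 0" using kappa0_nonneg kappa1_nonneg p by simp
  show ?thesis
  proof (cases "\<kappa>1 = 0 \<or> ?X = 0")
    case True then show ?thesis using energy_nonneg by auto
  next
    case False
    then have \<kappa>: "\<kappa>1 > 0" and X: "?X > 0" using kappa1_nonneg X0 by auto
    \<comment> \<open>The maximiser of \<open>\<mu>\<^sup>p\<^sup>-\<^sup>1 (X - (p - 1) \<mu> \<kappa>1)\<close>.\<close>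
    define \<mu> where "\<mu> = ?X / (p * \<kappa>1)"
    have \<mu>: "\<mu> > 0" using \<kappa> X p by (simp add: \<mu>_def)
    have "?X - (p - 1) * \<mu> * \<kappa>1 \<le> \<mu> powr (1 - p) * energy" using kappa1_inequality[OF \<mu>] by (simp add: algebra_simps)
    also have "?X - (p - 1) * \<mu> * \<kappa>1 = ?X / p"
    proof -
      have "\<mu> * \<kappa>1 = ?X / p" using \<kappa> p by (simp add: \<mu>_def)
      then have "(p - 1) * \<mu> * \<kappa>1 = (p - 1) * (?X / p)" by (simp add: mult.assoc)
      moreover have "?X - (p - 1) * (?X / p) = ?X / p" using p by (simp add: field_simps)
      ultimately show ?thesis by simp
    qed
    finally have "\<mu> powr (p - 1) * (?X / p) \<le> \<mu> powr (p - 1) * (\<mu> powr (1 - p) * energy)"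
      by (intro mult_left_mono) auto
    also have "\<dots> = energy" using \<mu> by (simp add: mult.assoc[symmetric] flip: powr_add)
    also have "\<mu> powr (p - 1) * (?X / p) = (1 / p) powr p * (?X powr p / \<kappa>1 powr (p - 1))"
    proof -
      have "\<mu> powr (p - 1) = ?X powr (p - 1) / (p powr (p - 1) * \<kappa>1 powr (p - 1))"
        using \<kappa> X p unfolding \<mu>_def by (simp add: powr_divide powr_mult)
      then have "\<mu> powr (p - 1) * (?X / p) = (?X powr (p - 1) * ?X) / ((p powr (p - 1) * p) * \<kappa>1 powr (p - 1))"
        by simp
      also have "?X powr (p - 1) * ?X = ?X powr p" using X by (simp add: powr_diff)
      also have "p powr (p - 1) * p = p powr p" using p by (simp add: powr_diff)
      also have "?X powr p / (p powr p * \<kappa>1 powr (p - 1)) = (1 / p) powr p * (?X powr p / \<kappa>1 powr (p - 1))"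
        using p by (simp add: powr_divide)
      finally show ?thesis .
    qed
    finally show ?thesis .
  qed
qed

end

section \<open>The radial profile of the harmonic functions\<close>

text \<open>
  The integral of \<open>s\<close> to the power \<open>m - 1\<close> over \<open>{a..b}\<close>. It treats the cases \<open>m \<noteq> 0\<close> and \<open>m = 0\<close> alike: both the
  functions \<open>\<psi>\<close> and the weights of the classes \<open>M\<^sub>i\<close> are expressed by it.
\<close>

definition radial_gap :: "real \<Rightarrow> real \<Rightarrow> real \<Rightarrow> real" where
  "radial_gap m a b = (if m \<noteq> 0 then (b powr m - a powr m) / m else ln (b / a))"

lemma radial_gap_pos:
  assumes "0 < a" "a < b" shows "radial_gap m a b > 0"
proof (cases m "0::real" rule: linorder_cases)
  case less
  then have "b powr m < a powr m" using assms by (intro powr_less_mono2_neg) auto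
  then show ?thesis using less by (simp add: radial_gap_def divide_neg_neg)
next
  case equal then show ?thesis using assms by (simp add: radial_gap_def)
next
  case greater
  then have "a powr m < b powr m" using assms by (intro powr_less_mono2) auto
  then show ?thesis using greater by (simp add: radial_gap_def)
qed

lemma radial_gap_derivative_upper:
  assumes "0 < a" "0 < t" shows "((\<lambda>t. radial_gap m a t) has_real_derivative t powr (m - 1)) (at t)"
proof (cases "m = 0")
  case True
  have "((\<lambda>t. ln (t / a)) has_real_derivative t powr (m - 1)) (at t)"
    using assms True by (auto intro!: derivative_eq_intros simp: powr_minus field_simps)
  then show ?thesis using True by (simp add: radial_gap_def)
next
  case False
  have "((\<lambda>t. (t powr m - a powr m) / m) has_real_derivative t powr (m - 1)) (at t)"
    using assms False by (auto intro!: derivative_eq_intros)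
  then show ?thesis using False by (simp add: radial_gap_def)
qed

lemma radial_gap_derivative_lower:
  assumes "0 < b" "0 < t" shows "((\<lambda>t. radial_gap m t b) has_real_derivative - (t powr (m - 1))) (at t)"
proof (cases "m = 0")
  case True
  have "((\<lambda>t. ln (b / t)) has_real_derivative - (t powr (m - 1))) (at t)"
    using assms True by (auto intro!: derivative_eq_intros simp: powr_minus field_simps power2_eq_square)
  then show ?thesis using True by (simp add: radial_gap_def)
next
  case False
  have "((\<lambda>t. (b powr m - t powr m) / m) has_real_derivative - (t powr (m - 1))) (at t)"
    using assms False by (auto intro!: derivative_eq_intros)
  then show ?thesis using False by (simp add: radial_gap_def)
qed

lemma m_exp_eq_0: "p > 1 \<Longrightarrow> m_exp n p = 0 \<longleftrightarrow> p = real n"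
  by (auto simp: m_exp_def)

lemma m_exp_mult: "p > 1 \<Longrightarrow> (m_exp n p - 1) * (p - 1) = 1 - real n"
  by (simp add: m_exp_def field_simps)

lemma weight_eq_radial_gap:
  assumes p: "p > 1" and ab: "0 < a" "a < b"
  shows "weight n p a b = radial_gap (m_exp n p) a b powr (1 - p)"
proof (cases "m_exp n p = 0")
  case True
  then have "p = real n" using m_exp_eq_0[OF p] by simp
  then show ?thesis using ab True by (simp add: weight_def radial_gap_def Let_def)
next
  case False
  then show ?thesis using radial_gap_pos[OF ab, of "m_exp n p"] by (simp add: weight_def radial_gap_def Let_def del: abs_divide)
qed

text \<open>
  The dimension is a parameter here, so that the one-dimensional profile does not mention the space.
\<close>

locale psi_setting =
  fixes r R p :: real and i n :: nat
  assumes n: "n \<ge> 1" and r: "0 < r" "r < R" and p: "p > 1" and i: "i \<in> {1, 2}"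
begin

text \<open>
  \<open>T\<close> is \<open>\<psi>\<close> without its normalising factor \<open>T0\<close>, and \<open>sg\<close> is the sign of its derivative. Normalisation does not
  change \<open>\<nabla>\<psi> / \<psi>\<close>.
\<close>

definition m :: real where "m = m_exp n p"
definition T :: "real \<Rightarrow> real" where "T t = (if i = 1 then radial_gap m t R else radial_gap m r t)"
definition sg :: real where "sg = (if i = 1 then -1 else 1)"
definition T0 :: real where "T0 = radial_gap m r R"
definition F :: "real \<Rightarrow> real" where "F t = sg * T t powr (1 - p)"
definition G :: "real \<Rightarrow> real" where "G t = t powr (m - 1) * T t powr (- p)"

lemma sg_simps [simp]: "sg * sg = 1" "\<bar>sg\<bar> = 1" "sg * (sg * x) = x" by (auto simp: sg_def)

lemma T0_pos: "T0 > 0" unfolding T0_def using r by (intro radial_gap_pos)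

lemma T_pos: "r < t \<Longrightarrow> t < R \<Longrightarrow> T t > 0"
  unfolding T_def using r by (auto intro!: radial_gap_pos)

lemma T_derivative: "t > 0 \<Longrightarrow> (T has_real_derivative sg * t powr (m - 1)) (at t)"
  using radial_gap_derivative_upper[of r t m] radial_gap_derivative_lower[of R t m] r
  unfolding T_def[abs_def] sg_def by auto

lemma T_measurable [measurable]: "T \<in> borel_measurable borel"
  unfolding T_def[abs_def] radial_gap_def by measurable

lemma psi_eq: "DIM('a::euclidean_space) = n \<Longrightarrow> psi i p r R (x::'a) = T (norm x) / T0"
  using i r unfolding psi_def psi1_def psi2_def T_def T0_def radial_gap_def m_def Let_def
  by auto

lemma n_exponent: "(m - 1) * (p - 1) = - real (n - 1)"
  using m_exp_mult[OF p, of n] n by (simp add: m_def of_nat_diff Suc_le_eq)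

lemma grad_psi:
  assumes n: "DIM('a::euclidean_space) = n" and x: "x \<noteq> (0::'a)" shows "grad (psi i p r R) x = (sg * norm x powr (m - 1) / T0) *\<^sub>R sgn x"
proof (rule grad_eq)
  have "((\<lambda>t. T t / T0) has_real_derivative sg * norm x powr (m - 1) / T0) (at (norm x))"
    using x by (intro DERIV_cdivide T_derivative) auto
  then have "GDERIV (\<lambda>x. T (norm x) / T0) x :> (sg * norm x powr (m - 1) / T0) *\<^sub>R sgn x"
    by (rule GDERIV_DERIV_compose[OF GDERIV_norm[OF x]])
  then show "GDERIV (psi i p r R) x :> (sg * norm x powr (m - 1) / T0) *\<^sub>R sgn x"
    by (simp add: psi_eq[OF n, abs_def])
qed

lemma grad_log_psi:
  assumes n: "DIM('a::euclidean_space) = n" and x: "x \<noteq> (0::'a)" shows "grad_log_psi i p r R x = (sg * norm x powr (m - 1) / T (norm x)) *\<^sub>R sgn x"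
  using T0_pos by (simp add: grad_log_psi_def grad_psi[OF n x] psi_eq[OF n] divide_inverse mult_ac)

lemma F_derivative:
  assumes "r < t" "t < R" shows "(F has_real_derivative - (p - 1) * G t) (at t)"
proof -
  have "(F has_real_derivative sg * ((1 - p) * T t powr (1 - p - 1) * (sg * t powr (m - 1)))) (at t)"
    unfolding F_def[abs_def]
  proof (rule DERIV_cmult)
    have "(T has_real_derivative sg * t powr (m - 1)) (at t)" using r assms by (intro T_derivative) auto
    from DERIV_fun_powr[OF this T_pos[OF assms], of "1 - p"]
    show "((\<lambda>t. T t powr (1 - p)) has_real_derivative (1 - p) * T t powr (1 - p - 1) * (sg * t powr (m - 1))) (at t)"
      by simp
  qed
  moreover have "sg * ((1 - p) * T t powr (1 - p - 1) * (sg * t powr (m - 1))) = - (p - 1) * G t"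
  proof -
    have "sg * ((1 - p) * T t powr (1 - p - 1) * (sg * t powr (m - 1))) = (sg * sg) * ((1 - p) * T t powr (- p) * t powr (m - 1))"
      by (simp add: mult_ac)
    then show ?thesis by (simp add: G_def mult_ac)
  qed
  ultimately show ?thesis by (rule DERIV_cong)
qed

lemma T_continuous: "continuous_on {0<..} T"
  by (intro continuous_at_imp_continuous_on ballI) (auto intro: DERIV_isCont[OF T_derivative])

lemma G_continuous: "continuous_on {r<..<R} G"
proof -
  have "continuous_on {r<..<R} T" by (rule continuous_on_subset[OF T_continuous]) (use r in auto)
  then show ?thesis unfolding G_def[abs_def]
    using T_pos r by (intro continuous_intros) (auto simp: less_imp_neq[symmetric])
qed

lemma G_nonneg: "G t \<ge> 0" unfolding G_def by simp

lemma F_G: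
  assumes "r < t" "t < R" shows "\<bar>F t\<bar> = G t powr ((p - 1) / p) * t powr (real (n - 1) / p)"
proof -
  have t: "t > 0" using assms r by simp
  have "G t powr ((p - 1) / p) = t powr ((m - 1) * (p - 1) / p) * T t powr (- p * ((p - 1) / p))"
    using t T_pos[OF assms] by (simp add: G_def powr_mult powr_powr)
  also have "- p * ((p - 1) / p) = 1 - p" using p by simp
  also have "(m - 1) * (p - 1) / p = - (real (n - 1) / p)" by (simp add: n_exponent)
  finally have "G t powr ((p - 1) / p) * t powr (real (n - 1) / p)
     = (t powr (- (real (n - 1) / p)) * t powr (real (n - 1) / p)) * T t powr (1 - p)"
    by (simp only: mult_ac)
  also have "t powr (- (real (n - 1) / p)) * t powr (real (n - 1) / p) = 1"
    using t by (simp only: powr_add[symmetric]) simp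
  finally show ?thesis by (simp add: F_def abs_mult)
qed

text \<open>
  This is \<open>p\<close>-harmonicity: \<open>(m - 1) (p - 1) = 1 - n\<close>, so \<open>|T'|\<^sup>p\<^sup>-\<^sup>1\<close> is the reciprocal of the Jacobian.
\<close>

lemma flux_density:
  assumes "r < t" "t < R" shows "t ^ (n - 1) * (t powr (m - 1) / T t) powr (p - 1) = T t powr (1 - p)"
proof -
  have t: "t > 0" using assms r by simp
  have "(t powr (m - 1) / T t) powr (p - 1) = t powr ((m - 1) * (p - 1)) / T t powr (p - 1)"
    using t T_pos[OF assms] by (simp add: powr_divide powr_powr)
  also have "\<dots> = inverse (t ^ (n - 1)) * T t powr (1 - p)"
    unfolding n_exponent using t by (simp only: powr_minus powr_realpow) (simp add: powr_minus[symmetric] divide_inverse)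
  finally show ?thesis using t by simp
qed

lemma K1_density:
  assumes "r < t" "t < R" shows "t ^ (n - 1) * (t powr (m - 1) / T t) powr p = G t"
proof -
  have t: "t > 0" using assms r by simp
  have pos: "t powr (m - 1) / T t > 0" using t T_pos[OF assms] by simp
  have split: "y powr p = y powr (p - 1) * y" if "y > 0" for y :: real
    using that by (simp add: powr_diff)
  have "t ^ (n - 1) * (t powr (m - 1) / T t) powr p = T t powr (1 - p) * (t powr (m - 1) / T t)"
    unfolding split[OF pos] flux_density[OF assms, symmetric] by (simp only: mult.assoc)
  also have "\<dots> = G t" using T_pos[OF assms] by (simp add: G_def powr_diff powr_minus field_simps)
  finally show ?thesis .
qed

end

section \<open>The inequality on the annulus\<close>

lemma filter_right_left_nontrivial:
  fixes r R :: real shows "at_right r \<times>\<^sub>F at_left R \<noteq> bot"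
  by (simp add: prod_filter_eq_bot)

lemma tendsto_difference_prod_filter:
  fixes f g :: "real \<Rightarrow> real"
  assumes f: "(f \<longlongrightarrow> A) (at_left R)" and g: "(g \<longlongrightarrow> B) (at_right r)"
  shows "((\<lambda>(a, b). f b - g a) \<longlongrightarrow> A - B) (at_right r \<times>\<^sub>F at_left R)"
proof -
  have "((\<lambda>z. f (snd z) - g (fst z)) \<longlongrightarrow> A - B) (at_right r \<times>\<^sub>F at_left R)"
    by (intro tendsto_diff filterlim_compose[OF f filterlim_snd] filterlim_compose[OF g filterlim_fst])
  then show ?thesis by (simp add: split_beta')
qed

text \<open>
  The flux \<open>F\<close> is, up to sign, the weight in the definition of \<open>M\<^sub>i\<close>, so membership says that the boundary term on
  the sphere where \<open>\<psi>\<close> vanishes tends to \<open>0\<close>. On the other sphere \<open>F\<close> and \<open>mass\<close> are continuous up to the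
  boundary, and the sign of the limit is that of the outward derivative of \<open>\<psi>\<close>. What remains is to recognise \<open>L\<close>,
  \<open>K1\<close> and the truncations of \<open>K0\<close> in polar coordinates.
\<close>

lemma hardy_inequality_annulus:
  fixes u :: "'a::euclidean_space \<Rightarrow> real" and p r R :: real and i :: nat
  assumes p: "p > 1" and r: "0 < r" "r < R" and i: "i \<in> {1, 2}" and u: "u \<in> M i p r R"
  shows "K_well_defined i p r R u \<and>
    L i p r R u \<ge>
      (1 / p) powr p * ((K0 i p r R u + (p - 1) * K1 i p r R u) powr p / K1 i p r R u powr (p - 1))"
proof -
  let ?A = "annulus r R :: 'a set"
  let ?n = "DIM('a)"
  define V where "V = radial_rep r R u"
  have adm: "admissible p r R u" using u i by (auto simp: M_def M1_def M2_def)
  obtain h where h[measurable]: "h \<in> borel_measurable borel"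
    and he: "AE x in lborel. x \<in> ?A \<longrightarrow> (x \<bullet> weak_grad ?A u x) / norm x = h x"
    and hp: "set_integrable lborel ?A (\<lambda>x. \<bar>h x\<bar> powr p)"
    and rep: "is_radial_rep r R u V"
    and prim: "AE \<omega> in sphere_measure. (\<lambda>s. h (s *\<^sub>R \<omega>)) absolutely_integrable_on {r..R} \<and>
      (\<forall>t\<in>{r..R}. V (t *\<^sub>R \<omega>) = V (r *\<^sub>R \<omega>) + integral {r..t} (\<lambda>s. h (s *\<^sub>R \<omega>)))"
    unfolding V_def by (rule radial_rep_primitive[OF r p adm])
  have V[measurable]: "V \<in> borel_measurable borel" using rep by (simp add: is_radial_rep_def)
  have Vu: "AE x in lborel. x \<in> ?A \<longrightarrow> V x = u x" using rep by (simp add: is_radial_rep_def AE_completion_iff)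
  interpret P: psi_setting r R p i ?n by unfold_locales (use r p i in \<open>auto simp: Suc_le_eq\<close>)
  have sm: "sphere_mass p r R u \<rho> = ennreal (\<rho> ^ (?n - 1)) * (\<integral>\<^sup>+\<omega>. ennreal (\<bar>V (\<rho> *\<^sub>R \<omega>)\<bar> powr p) \<partial>sphere_measure)" if "\<rho> > 0" for \<rho>
    unfolding sphere_mass_def V_def[symmetric] using that by (subst nn_integral_surface_measure_scale) auto
  have T1: "P.T t = radial_gap (m_exp ?n p) t R" "P.sg = -1" if "i = 1" for t
    unfolding P.T_def P.m_def P.sg_def by (simp_all only: that refl if_True)
  have T2: "P.T t = radial_gap (m_exp ?n p) r t" "P.sg = 1" if "i = 2" for t
    unfolding P.T_def P.m_def P.sg_def by (simp_all add: that)
  \<comment> \<open>The expression in the definition of the class, in terms of the profile \<open>T\<close>.\<close>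
  define vanish where "vanish \<rho> = ennreal (P.T \<rho> powr (1 - p)) * sphere_mass p r R u \<rho>" for \<rho>
  have van: "i = 1 \<Longrightarrow> (vanish \<longlongrightarrow> 0) (at_left R)" "i = 2 \<Longrightarrow> (vanish \<longlongrightarrow> 0) (at_right r)"
  proof -
    assume i1: "i = 1"
    have ev: "eventually (\<lambda>\<rho>. ennreal (weight ?n p \<rho> R) * sphere_mass p r R u \<rho> = vanish \<rho>) (at_left R)"
    proof -
      have "eventually (\<lambda>\<rho>. \<rho> \<in> {r<..<R}) (at_left R)" using r by (intro eventually_at_left_real)
      then show ?thesis
        by eventually_elim (use r p in \<open>auto simp: vanish_def T1[OF i1] weight_eq_radial_gap\<close>)
    qed
    have "((\<lambda>\<rho>. ennreal (weight ?n p \<rho> R) * sphere_mass p r R u \<rho>) \<longlongrightarrow> 0) (at_left R)"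
      using u i1 by (simp add: M_def M1_def)
    then show "(vanish \<longlongrightarrow> 0) (at_left R)" using tendsto_cong[OF ev] by simp
  next
    assume i2: "i = 2"
    have ev: "eventually (\<lambda>\<rho>. ennreal (weight ?n p r \<rho>) * sphere_mass p r R u \<rho> = vanish \<rho>) (at_right r)"
    proof -
      have "eventually (\<lambda>\<rho>. \<rho> \<in> {r<..<R}) (at_right r)" using r by (intro eventually_at_right_real)
      then show ?thesis
        by eventually_elim (use r p in \<open>auto simp: vanish_def T2[OF i2] weight_eq_radial_gap\<close>)
    qed
    have "((\<lambda>\<rho>. ennreal (weight ?n p r \<rho>) * sphere_mass p r R u \<rho>) \<longlongrightarrow> 0) (at_right r)"
      using u i2 by (simp add: M_def M2_def)
    then show "(vanish \<longlongrightarrow> 0) (at_right r)" using tendsto_cong[OF ev] by simp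
  qed
  have "\<exists>\<rho>\<in>{r<..<R}. vanish \<rho> < 1"
  proof -
    consider "i = 1" | "i = 2" using i by auto
    then show ?thesis
    proof cases
      case 1
      have "eventually (\<lambda>\<rho>. vanish \<rho> < 1) (at_left R)" using van(1)[OF 1] by (rule order_tendstoD) simp
      moreover have "eventually (\<lambda>\<rho>. \<rho> \<in> {r<..<R}) (at_left R)" using r by (intro eventually_at_left_real)
      ultimately have "eventually (\<lambda>\<rho>. \<rho> \<in> {r<..<R} \<and> vanish \<rho> < 1) (at_left R)" by eventually_elim auto
      then show ?thesis by (auto dest!: eventually_happens'[OF trivial_limit_at_left_real])
    next
      case 2
      have "eventually (\<lambda>\<rho>. vanish \<rho> < 1) (at_right r)" using van(2)[OF 2] by (rule order_tendstoD) simp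
      moreover have "eventually (\<lambda>\<rho>. \<rho> \<in> {r<..<R}) (at_right r)" using r by (intro eventually_at_right_real)
      ultimately have "eventually (\<lambda>\<rho>. \<rho> \<in> {r<..<R} \<and> vanish \<rho> < 1) (at_right r)" by eventually_elim auto
      then show ?thesis by (auto dest!: eventually_happens'[OF trivial_limit_at_right_real])
    qed
  qed
  then obtain \<rho> where \<rho>: "r < \<rho>" "\<rho> < R" "vanish \<rho> < 1" by auto
  have fm: "integrable sphere_measure (\<lambda>\<omega>. \<bar>V (\<rho> *\<^sub>R \<omega>)\<bar> powr p)"
  proof (rule integrableI_bounded)
    have "(\<integral>\<^sup>+\<omega>. ennreal (\<bar>V (\<rho> *\<^sub>R \<omega>)\<bar> powr p) \<partial>sphere_measure) \<noteq> \<infinity>"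
    proof
      assume "(\<integral>\<^sup>+\<omega>. ennreal (\<bar>V (\<rho> *\<^sub>R \<omega>)\<bar> powr p) \<partial>sphere_measure) = \<infinity>"
      then have "vanish \<rho> = \<infinity>"
        using \<rho> r P.T_pos[of \<rho>] by (simp add: vanish_def sm ennreal_mult_top ennreal_mult_eq_top_iff powr_gt_zero)
      then show False using \<rho> by simp
    qed
    then show "(\<integral>\<^sup>+\<omega>. ennreal (norm (\<bar>V (\<rho> *\<^sub>R \<omega>)\<bar> powr p)) \<partial>sphere_measure) < \<infinity>"
      by (simp add: top.not_eq_extremum)
  qed measurable
  have fm': "\<exists>\<rho>\<in>{r..R}. integrable sphere_measure (\<lambda>\<omega>. \<bar>V (\<rho> *\<^sub>R \<omega>)\<bar> powr p)"
    using \<rho> by (intro bexI[of _ \<rho>] fm) auto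
  interpret Fam: radial_family r R p V h
    by (rule radial_family.intro[OF r p V h hp prim fm'])
  have mass_vanish: "vanish \<rho> = ennreal (P.T \<rho> powr (1 - p) * (\<rho> ^ (?n - 1) * Fam.mass \<rho>))" if "r < \<rho>" "\<rho> < R" for \<rho>
  proof -
    have I: "integrable sphere_measure (\<lambda>\<omega>. \<bar>V (\<rho> *\<^sub>R \<omega>)\<bar> powr p)" using that by (intro Fam.mass_integrable) auto
    have "(\<integral>\<^sup>+\<omega>. ennreal (\<bar>V (\<rho> *\<^sub>R \<omega>)\<bar> powr p) \<partial>sphere_measure) = ennreal (Fam.mass \<rho>)"
      unfolding Fam.mass_def by (rule nn_integral_eq_integral[OF I]) simp
    moreover have "\<rho> > 0" using that r by simp
    ultimately show ?thesis by (simp add: vanish_def sm ennreal_mult Fam.mass_nonneg)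
  qed
  have vanish_flux: "((\<lambda>\<rho>. P.F \<rho> * Fam.mass \<rho>) \<longlongrightarrow> 0) X"
    if v: "(vanish \<longlongrightarrow> 0) X" and ev: "eventually (\<lambda>\<rho>. \<rho> \<in> {r<..<R}) X" for X
  proof (rule Lim_null_comparison)
    have ev': "eventually (\<lambda>\<rho>. vanish \<rho> = ennreal (P.T \<rho> powr (1 - p) * (\<rho> ^ (?n - 1) * Fam.mass \<rho>))) X"
      using ev by eventually_elim (simp add: mass_vanish)
    have "((\<lambda>\<rho>. ennreal (P.T \<rho> powr (1 - p) * (\<rho> ^ (?n - 1) * Fam.mass \<rho>))) \<longlongrightarrow> ennreal 0) X"
      using v tendsto_cong[OF ev'] by simp
    moreover have "eventually (\<lambda>\<rho>. 0 \<le> P.T \<rho> powr (1 - p) * (\<rho> ^ (?n - 1) * Fam.mass \<rho>)) X"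
      using ev by eventually_elim (use r in \<open>auto intro!: mult_nonneg_nonneg Fam.mass_nonneg\<close>)
    ultimately have "((\<lambda>\<rho>. P.T \<rho> powr (1 - p) * (\<rho> ^ (?n - 1) * Fam.mass \<rho>)) \<longlongrightarrow> 0) X"
      by (subst (asm) tendsto_ennreal_iff) auto
    from tendsto_mult_right_zero[OF this, of "inverse (r ^ (?n - 1))"]
    show "((\<lambda>\<rho>. inverse (r ^ (?n - 1)) * (P.T \<rho> powr (1 - p) * (\<rho> ^ (?n - 1) * Fam.mass \<rho>))) \<longlongrightarrow> 0) X" .
    show "eventually (\<lambda>\<rho>. norm (P.F \<rho> * Fam.mass \<rho>) \<le> inverse (r ^ (?n - 1)) * (P.T \<rho> powr (1 - p) * (\<rho> ^ (?n - 1) * Fam.mass \<rho>))) X"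
      using ev
    proof eventually_elim
      case (elim \<rho>)
      have "1 \<le> inverse (r ^ (?n - 1)) * \<rho> ^ (?n - 1)"
        using r elim power_mono[of r \<rho> "?n - 1"] by (simp add: field_simps)
      then have "1 * (P.T \<rho> powr (1 - p) * Fam.mass \<rho>) \<le> inverse (r ^ (?n - 1)) * \<rho> ^ (?n - 1) * (P.T \<rho> powr (1 - p) * Fam.mass \<rho>)"
        by (intro mult_right_mono mult_nonneg_nonneg Fam.mass_nonneg) auto
      then show ?case by (simp add: P.F_def abs_mult Fam.mass_nonneg mult_ac)
    qed
  qed
  have F_cont: "continuous_on S P.F" if "S \<subseteq> {0<..}" "\<And>t. t \<in> S \<Longrightarrow> P.T t > 0" for S
  proof -
    have "continuous_on S P.T" using P.T_continuous that(1) by (rule continuous_on_subset)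
    then show ?thesis unfolding P.F_def[abs_def] using that(2) by (intro continuous_intros) (auto simp: less_imp_neq[symmetric])
  qed
  have "\<exists>\<kappa>\<ge>0. ((\<lambda>(a, b). P.F b * Fam.mass b - P.F a * Fam.mass a) \<longlongrightarrow> \<kappa>) (at_right r \<times>\<^sub>F at_left R)"
  proof -
    have evl: "eventually (\<lambda>\<rho>. \<rho> \<in> {r<..<R}) (at_left R)" and evr: "eventually (\<lambda>\<rho>. \<rho> \<in> {r<..<R}) (at_right r)"
      using eventually_at_left_real[OF r(2)] eventually_at_right_real[OF r(2)] by simp_all
    consider "i = 1" | "i = 2" using i by auto
    then show ?thesis
    proof cases
      case 1
      have "continuous_on {r..<R} (\<lambda>\<rho>. P.F \<rho> * Fam.mass \<rho>)"
      proof (intro continuous_on_mult F_cont continuous_on_subset[OF Fam.mass_continuous])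
        show "P.T t > 0" if "t \<in> {r..<R}" for t unfolding T1[OF 1] using that r by (auto intro!: radial_gap_pos)
      qed (use r in auto)
      then have "((\<lambda>\<rho>. P.F \<rho> * Fam.mass \<rho>) \<longlongrightarrow> P.F r * Fam.mass r) (at r within {r..<R})"
        using r by (auto simp: continuous_on_def)
      then have "((\<lambda>\<rho>. P.F \<rho> * Fam.mass \<rho>) \<longlongrightarrow> P.F r * Fam.mass r) (at_right r)"
        by (subst (asm) at_within_nhd[of r "{..<R}" _ "{r<..}"]) (use r in auto)
      from tendsto_difference_prod_filter[OF vanish_flux[OF van(1)[OF 1] evl] this]
      have "((\<lambda>(a, b). P.F b * Fam.mass b - P.F a * Fam.mass a) \<longlongrightarrow> 0 - P.F r * Fam.mass r) (at_right r \<times>\<^sub>F at_left R)" .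
      moreover have "0 - P.F r * Fam.mass r \<ge> 0" using Fam.mass_nonneg[of r] by (simp add: P.F_def T1[OF 1])
      ultimately show ?thesis by blast
    next
      case 2
      have "continuous_on {r<..R} (\<lambda>\<rho>. P.F \<rho> * Fam.mass \<rho>)"
      proof (intro continuous_on_mult F_cont continuous_on_subset[OF Fam.mass_continuous])
        show "P.T t > 0" if "t \<in> {r<..R}" for t unfolding T2[OF 2] using that r by (auto intro!: radial_gap_pos)
      qed (use r in auto)
      then have "((\<lambda>\<rho>. P.F \<rho> * Fam.mass \<rho>) \<longlongrightarrow> P.F R * Fam.mass R) (at R within {r<..R})"
        using r by (auto simp: continuous_on_def)
      then have "((\<lambda>\<rho>. P.F \<rho> * Fam.mass \<rho>) \<longlongrightarrow> P.F R * Fam.mass R) (at_left R)"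
        by (subst (asm) at_within_nhd[of R "{r<..}" _ "{..<R}"]) (use r in auto)
      from tendsto_difference_prod_filter[OF this vanish_flux[OF van(2)[OF 2] evr]]
      have "((\<lambda>(a, b). P.F b * Fam.mass b - P.F a * Fam.mass a) \<longlongrightarrow> P.F R * Fam.mass R - 0) (at_right r \<times>\<^sub>F at_left R)" .
      moreover have "P.F R * Fam.mass R - 0 \<ge> 0" using Fam.mass_nonneg[of R] by (simp add: P.F_def T2[OF 2])
      ultimately show ?thesis by blast
    qed
  qed
  then obtain \<kappa> where \<kappa>: "\<kappa> \<ge> 0" "((\<lambda>(a, b). P.F b * Fam.mass b - P.F a * Fam.mass a) \<longlongrightarrow> \<kappa>) (at_right r \<times>\<^sub>F at_left R)"
    by blast
  interpret Fl: radial_flux r R p V h P.F P.G \<kappa>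
    by unfold_locales (use \<kappa> P.F_derivative P.G_continuous P.G_nonneg P.F_G in auto)

  have gl: "grad_log_psi i p r R x = (P.sg * norm x powr (P.m - 1) / P.T (norm x)) *\<^sub>R sgn x" if "x \<noteq> 0" for x :: 'a
    by (rule P.grad_log_psi[OF refl that])
  have nrm: "norm x \<noteq> 0" "r < norm x" "norm x < R" "x \<noteq> 0" if "x \<in> ?A" for x
    using that r by (auto simp: annulus_def)
  have L_eq: "L i p r R u = Fam.energy"
    unfolding L_def Fam.energy_def
  proof (rule set_integral_completion_AE(1))
    show "AE x in lborel. x \<in> ?A \<longrightarrow>
       \<bar>grad (psi i p r R) x \<bullet> weak_grad ?A u x / norm (grad (psi i p r R) x)\<bar> powr p = \<bar>h x\<bar> powr p"
      using he
    proof eventually_elim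
      case (elim x)
      show ?case
      proof
        assume x: "x \<in> ?A"
        have pos: "norm x powr (P.m - 1) / P.T0 > 0" using nrm[OF x] P.T0_pos by simp
        define c where "c = norm x powr (P.m - 1) / P.T0"
        have c: "c > 0" using pos by (simp add: c_def)
        have g: "grad (psi i p r R) x = (P.sg * c) *\<^sub>R sgn x"
          using P.grad_psi[OF refl nrm(4)[OF x]] by (simp add: c_def)
        have "norm (grad (psi i p r R) x) = c" unfolding g using c nrm[OF x] by (simp add: abs_mult norm_sgn)
        then have "grad (psi i p r R) x \<bullet> weak_grad ?A u x / norm (grad (psi i p r R) x) = P.sg * (sgn x \<bullet> weak_grad ?A u x)"
          using c by (simp add: g)
        also have "sgn x \<bullet> weak_grad ?A u x = h x" using elim x by (simp add: sgn_div_norm divide_inverse mult.commute)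
        finally show "\<bar>grad (psi i p r R) x \<bullet> weak_grad ?A u x / norm (grad (psi i p r R) x)\<bar> powr p = \<bar>h x\<bar> powr p"
          by (simp add: abs_mult)
      qed
    qed
  qed measurable
  define k where "k x = (norm x powr (P.m - 1) / P.T (norm x)) powr p * \<bar>V x\<bar> powr p" for x
  have k[measurable]: "k \<in> borel_measurable borel" unfolding k_def by measurable
  have k_cyl: "AE z in cylinder_measure. indicator {r<..<R} (fst z) * fst z ^ (?n - 1) * k (fst z *\<^sub>R snd z) = indicator {r<..<R} (fst z) * Fl.q z"
    using AE_pair_norm_1
  proof eventually_elim
    case (elim z)
    show ?case
    proof (cases "r < fst z \<and> fst z < R")
      case True
      then have "fst z > 0" using r by simp
      then have "norm (fst z *\<^sub>R snd z) = fst z" using elim by simp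
      then have "fst z ^ (?n - 1) * k (fst z *\<^sub>R snd z) = (fst z ^ (?n - 1) * (fst z powr (P.m - 1) / P.T (fst z)) powr p) * \<bar>V (fst z *\<^sub>R snd z)\<bar> powr p"
        unfolding k_def by (simp only: mult.assoc)
      also have "\<dots> = Fl.q z" unfolding Fl.q_def using True by (simp only: P.K1_density)
      finally show ?thesis using True by (simp add: mult.assoc)
    qed auto
  qed
  have qm: "(\<lambda>z. indicator {r<..<R} (fst z) * Fl.q z) \<in> borel_measurable cylinder_measure"
    using Fl.kappa1_integrable by auto
  have kI: "set_integrable lborel ?A k"
    unfolding polar_integrable[OF k r] using Fl.kappa1_integrable
    by (subst integrable_cong_AE[OF _ qm k_cyl]) measurable
  have kE: "(LINT x:?A|lborel. k x) = Fl.\<kappa>1"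
    unfolding polar_integral[OF k r] Fl.\<kappa>1_def
    by (rule integral_cong_AE[OF _ qm k_cyl]) measurable
  have K1k: "AE x in lborel. x \<in> ?A \<longrightarrow> K1_integrand i p r R u x = k x"
    using Vu
  proof eventually_elim
    case (elim x)
    show ?case
    proof
      assume x: "x \<in> ?A"
      have "norm (grad_log_psi i p r R x) = norm x powr (P.m - 1) / P.T (norm x)"
        using gl[OF nrm(4)[OF x]] nrm[OF x] P.T_pos[of "norm x"] by (simp add: abs_mult norm_sgn)
      then show "K1_integrand i p r R u x = k x" using elim x by (simp add: K1_integrand_def k_def)
    qed
  qed
  have kA: "(\<lambda>x. indicator ?A x *\<^sub>R k x) \<in> borel_measurable borel" by measurable
  have K1_int: "set_integrable lebesgue ?A (K1_integrand i p r R u)"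
    using set_integral_completion_AE(2)[OF annulus_borel kA K1k] kI by simp
  have K1_eq: "K1 i p r R u = Fl.\<kappa>1"
    unfolding K1_def using set_integral_completion_AE(1)[OF annulus_borel kA K1k] kE by simp
  have flux_int: "(LINT x|surface_measure \<rho>. K0_integrand i p r R u (x /\<^sub>R norm x) x) = P.F \<rho> * Fam.mass \<rho>"
    if \<rho>: "r < \<rho>" "\<rho> < R" for \<rho>
  proof -
    let ?f = "\<lambda>x::'a. K0_integrand i p r R u (x /\<^sub>R norm x) x"
    have f_eq: "?f x = (\<bar>norm x powr (P.m - 1) / P.T (norm x)\<bar>) powr (p - 2) * (P.sg * norm x powr (P.m - 1) / P.T (norm x)) * \<bar>V x\<bar> powr p"
      if "x \<noteq> 0" for x
    proof -
      have 1: "sgn x \<bullet> (x /\<^sub>R norm x) = 1"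
        using that by (simp add: sgn_div_norm dot_square_norm power2_eq_square)
      show ?thesis
        unfolding K0_integrand_def V_def[symmetric] gl[OF that] inner_scaleR_left 1
        using that by (simp add: abs_mult norm_sgn)
    qed
    have [measurable]: "?f \<in> borel_measurable borel"
    proof -
      have "?f = (\<lambda>x. if x \<noteq> 0 then (\<bar>norm x powr (P.m - 1) / P.T (norm x)\<bar>) powr (p - 2) * (P.sg * norm x powr (P.m - 1) / P.T (norm x)) * \<bar>V x\<bar> powr p else ?f 0)"
        using f_eq by auto
      also have "\<dots> \<in> borel_measurable borel" by measurable
      finally show ?thesis .
    qed
    have \<rho>0: "\<rho> > 0" using \<rho> r by simp
    have "(LINT x|surface_measure \<rho>. ?f x) = \<rho> ^ (?n - 1) * (LINT \<omega>|sphere_measure. ?f (\<rho> *\<^sub>R \<omega>))"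
      by (rule integral_surface_measure[OF _ \<rho>0]) measurable
    also have "(LINT \<omega>|sphere_measure. ?f (\<rho> *\<^sub>R \<omega>)) = (LINT \<omega>|sphere_measure. P.sg * (\<rho> powr (P.m - 1) / P.T \<rho>) powr (p - 1) * \<bar>V (\<rho> *\<^sub>R \<omega>)\<bar> powr p)"
    proof (rule integral_cong_AE)
      show "AE \<omega> in sphere_measure. ?f (\<rho> *\<^sub>R \<omega>) = P.sg * (\<rho> powr (P.m - 1) / P.T \<rho>) powr (p - 1) * \<bar>V (\<rho> *\<^sub>R \<omega>)\<bar> powr p"
        using AE_sphere_measure_norm
      proof eventually_elim
        case (elim \<omega>)
        define y where "y = \<rho> powr (P.m - 1) / P.T \<rho>"
        have y: "y > 0" using \<rho>0 P.T_pos[OF \<rho>] by (simp add: y_def)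
        have nz: "\<rho> *\<^sub>R \<omega> \<noteq> 0" and nn: "norm (\<rho> *\<^sub>R \<omega>) = \<rho>" using elim \<rho>0 by auto
        note f_eq[OF nz]
        also have "\<bar>norm (\<rho> *\<^sub>R \<omega>) powr (P.m - 1) / P.T (norm (\<rho> *\<^sub>R \<omega>))\<bar> powr (p - 2) *
            (P.sg * norm (\<rho> *\<^sub>R \<omega>) powr (P.m - 1) / P.T (norm (\<rho> *\<^sub>R \<omega>))) = \<bar>y\<bar> powr (p - 2) * (P.sg * y)"
          unfolding nn y_def by simp
        also have "\<bar>y\<bar> powr (p - 2) * (P.sg * y) = P.sg * (y powr (p - 2) * y powr 1)" using y by simp
        also have "y powr (p - 2) * y powr 1 = y powr (p - 1)" by (simp only: powr_add[symmetric]) simp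
        finally show ?case by (simp only: y_def)
      qed
    qed measurable
    also have "\<rho> ^ (?n - 1) * \<dots> = P.sg * (\<rho> ^ (?n - 1) * (\<rho> powr (P.m - 1) / P.T \<rho>) powr (p - 1)) * Fam.mass \<rho>"
      unfolding Fam.mass_def by simp
    also have "\<dots> = P.F \<rho> * Fam.mass \<rho>" unfolding P.flux_density[OF \<rho>] P.F_def by simp
    finally show ?thesis .
  qed
  have trunc: "K0_trunc i p r R u a b = P.F b * Fam.mass b - P.F a * Fam.mass a" if "r < a" "a < R" "r < b" "b < R" for a b
  proof -
    have "K0_integrand i p r R u (- (x /\<^sub>R norm x)) x = - K0_integrand i p r R u (x /\<^sub>R norm x) x" for x :: 'a
      by (simp add: K0_integrand_def)
    then show ?thesis unfolding K0_trunc_def using flux_int that by simp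
  qed
  have lim: "((\<lambda>(a, b). K0_trunc i p r R u a b) \<longlongrightarrow> \<kappa>) (at_right r \<times>\<^sub>F at_left R)"
  proof -
    have "eventually (\<lambda>z. fst z \<in> {r<..<R} \<and> snd z \<in> {r<..<R}) (at_right r \<times>\<^sub>F at_left R)"
      unfolding eventually_prod_filter
      using eventually_at_left_real[OF r(2)] eventually_at_right_real[OF r(2)]
      by (intro exI[of _ "\<lambda>a. a \<in> {r<..<R}"] conjI) simp_all
    then have "eventually (\<lambda>z. (\<lambda>(a, b). K0_trunc i p r R u a b) z = (\<lambda>(a, b). P.F b * Fam.mass b - P.F a * Fam.mass a) z) (at_right r \<times>\<^sub>F at_left R)"
      by eventually_elim (auto simp: trunc split_beta')
    from tendsto_cong[OF this] show ?thesis using \<kappa>(2) by simp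
  qed
  then have K0_eq: "K0 i p r R u = \<kappa>"
    unfolding K0_def by (rule tendsto_Lim[OF filter_right_left_nontrivial])
  have "integrable (surface_measure \<rho>) (\<lambda>x. \<bar>radial_rep r R u x\<bar> powr p)" if "\<rho> \<in> {r<..<R}" for \<rho>
    unfolding V_def[symmetric] using that r Fam.mass_integrable[of \<rho>]
    by (subst integrable_surface_measure) auto
  then have "K_well_defined i p r R u"
    unfolding K_well_defined_def using K1_int lim by (simp add: K0_eq)
  moreover have "L i p r R u \<ge>
      (1 / p) powr p * ((K0 i p r R u + (p - 1) * K1 i p r R u) powr p / K1 i p r R u powr (p - 1))"
    unfolding L_eq K0_eq K1_eq by (rule Fl.flux_inequality)
  ultimately show ?thesis ..
qed

theorem theorem2p1:
  fixes u :: "real ^ 'n \<Rightarrow> real" and p r R :: real and i :: nat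
  assumes "CARD('n) \<ge> 2" and "p > 1" and "0 < r" and "r < R" and "i \<in> {1, 2}"
    and "u \<in> M i p r R"
  shows "K_well_defined i p r R u \<and>
    L i p r R u \<ge>
      (1 / p) powr p * ((K0 i p r R u + (p - 1) * K1 i p r R u) powr p / K1 i p r R u powr (p - 1))"
  using hardy_inequality_annulus[OF assms(2-6)] .

end
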